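(* Let $\Phi=(\phi_j)_{1\le j\le N}$ be a sequence of nonzero elements of a real vector space $F$, generating $F$ and spanning a salient cone $\mathfrak c(\Phi)$. Let $\tau\subset F$ be a $\Phi$-tope contained in $\mathfrak c(\Phi)$. Let $h(x)$ be a polynomial function on $\mathbb R^N$. Fix a Lebesgue measure on $V=\{x\in\mathbb R^N:\sum_i x_i\phi_i=0\}$ and let $dm_\Phi(x)$ be the corresponding Lebesgue measure on $V(\Phi,\lambda)$. Define, for $\lambda\in F$, $$I(\Phi,\tau,h)(\lambda)=\int_{V(\Phi,\lambda)}\mathcal X(\Phi,\tau)(x)\,h(x)\,dm_\Phi(x).$$ In the case where $F$ is a rational space with lattice $\Lambda$ and the $\phi_i$ are lattice vectors, define, for $\lambda\in\Lambda$, $$S(\Phi,\tau,h)(\lambda)=\sum_{x\in V(\Phi,\lambda)\cap\mathbb Z^N}\mathcal X(\Phi,\tau)(x)\,h(x).$$ Then: (i) $\lambda\mapsto I(\Phi,\tau,h)(\lambda)$ is a polynomial function on $F$. (ii) $\lambda\mapsto S(\Phi,\tau,h)(\lambda)$ is a quasi-polynomial function on the lattice $\Lambda\subset F$. (iii) If $\lambda$ belongs to the closure of the tope $\tau$, then $$I(\Phi,\tau,h)(\lambda)=\int_{\mathfrak p(\Phi,\lambda)}h(x)\,dm_\Phi(x).$$ If $\lambda\in(\tau-\mathfrak b(\Phi))\cap\Lambda$, then $$S(\Phi,\tau,h)(\lambda)=\sum_{x\in\mathfrak p(\Phi,\lambda)\cap\mathbb Z^N}h(x).$$ (iv) Let $\tau_1,\tau_2$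 be adjacent $\Phi$-topes with $\tau_1\subset\mathfrak c(\Phi)$, let $H$ be their common wall, and let $A$ be the set of $i\in\{1,\dots,N\}$ such that $\phi_i$ is in the open side of $H$ which contains $\tau_1$. For $\lambda\in\tau_2$, $$I(\Phi,\tau_1,h)(\lambda)=\int_{\mathfrak p(\Phi,\lambda)}h(x)\,dm_\Phi(x)-(-1)^{|A|}\int_{\mathfrak p_{\rm flip}(\Phi,A,\lambda)}h(x)\,dm_\Phi(x),$$ and (in the lattice case, for $\lambda\in\tau_2\cap\Lambda$) $$S(\Phi,\tau_1,h)(\lambda)=\sum_{x\in\mathfrak p(\Phi,\lambda)\cap\mathbb Z^N}h(x)-(-1)^{|A|}\sum_{x\in\mathfrak p_{\rm flip}(\Phi,A,\lambda)\cap\mathbb Z^N}h(x).$$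
   Context: $F$ is finite dimensional, $r=\dim F$; $\mathfrak c(\Phi)=\{\sum_i t_i\phi_i:t_i\ge 0\}$; a cone is salient if it contains no affine line. $V(\Phi,\lambda)=\{x\in\mathbb R^N:\sum_i x_i\phi_i=\lambda\}$ (a translate of $V$), $\mathfrak p(\Phi,\lambda)=\{x\in V(\Phi,\lambda):x_i\ge 0\text{ for all }i\}$, $\mathfrak p_{\rm flip}(\Phi,A,\lambda)=\{x\in V(\Phi,\lambda):x_i<0\text{ for }i\in A,\ x_i\ge 0\text{ for }i\notin A\}$. $\mathfrak b(\Phi)=\{\sum_i t_i\phi_i:0\le t_i\le 1\}$, $\tau-\mathfrak b(\Phi)=\{u-v:u\in\tau,v\in\mathfrak b(\Phi)\}$. A $\Phi$-wall is a hyperplane of $F$ spanned by $r-1$ linearly independent elements of $\Phi$; a $\Phi$-tope is a connected component of the complement in $F$ of the union of all $\Phi$-walls. Two topes are adjacent if the intersection of their closures is contained in a wall and spans this wall (their common wall). $\mathcal G(\Phi,\tau)$ is the set of $I\subseteq\{1,\dots,N\}$ such that $\{\phi_i,i\in I\}$ generates $F$ and $\tau$ is contained in the cone generated by $\{\phi_i,i\in I\}$; with $I^c$ the complement of $I$ and $[\cdot]$ denoting characteristic functions, $\mathcal X(\Phi,\tau)=\sum_{I\in\mathcal G(\Phi,\tau)}(-1)^{|I|-\dim F}\prod_{i\in I^c}[x_i\ge 0]$, a function on $\mathbb R^N$ whose restriction to each $V(\Phi,\lambda)$ has bounded support. A function $f$ on $\Lambda$ is quasi-polynomial if there is a sublattice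 $\Lambda'\subset\Lambda$ (of finite index) such that for every $\lambda_0\in\Lambda$ the function $\lambda'\mapsto f(\lambda_0+\lambda')$ on $\Lambda'$ is the restriction to $\Lambda'$ of a polynomial function on $F$. *)

theory Defs
  imports "HOL-Analysis.Analysis"
begin

text \<open>
  A sequence of \<open>N\<close> vectors of \<open>F\<close> is a function \<open>\<Phi> :: 'n \<Rightarrow> 'f\<close> on a finite index type with
  \<open>N = CARD('n)\<close>; \<open>F\<close> is the whole type \<open>'f\<close>, of dimension \<open>DIM('f)\<close>. The inner product of \<open>'f\<close>
  serves only to describe half-spaces.
\<close>

definition gen_cone :: "('n::finite \<Rightarrow> 'f::euclidean_space) \<Rightarrow> 'n set \<Rightarrow> 'f set" where
  "gen_cone \<Phi> I = {(\<Sum>i\<in>I. t i *\<^sub>R \<Phi> i) | t. \<forall>i\<in>I. 0 \<le> t i}"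

definition salient :: "'f::euclidean_space set \<Rightarrow> bool" where
  "salient C \<longleftrightarrow> \<not> (\<exists>x d. d \<noteq> 0 \<and> (\<forall>t::real. x + t *\<^sub>R d \<in> C))"

definition zonotope :: "('n::finite \<Rightarrow> 'f::euclidean_space) \<Rightarrow> 'f set" where
  "zonotope \<Phi> = {(\<Sum>i\<in>UNIV. t i *\<^sub>R \<Phi> i) | t. \<forall>i. 0 \<le> t i \<and> t i \<le> 1}"

definition fiber :: "('n::finite \<Rightarrow> 'f::euclidean_space) \<Rightarrow> 'f \<Rightarrow> (real ^ 'n) set" where
  "fiber \<Phi> \<nu> = {x. (\<Sum>i\<in>UNIV. x $ i *\<^sub>R \<Phi> i) = \<nu>}"

definition partition_polytope :: "('n::finite \<Rightarrow> 'f::euclidean_space) \<Rightarrow> 'f \<Rightarrow> (real ^ 'n) set" where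
  "partition_polytope \<Phi> \<nu> = {x \<in> fiber \<Phi> \<nu>. \<forall>i. 0 \<le> x $ i}"

definition flipped_polytope ::
    "('n::finite \<Rightarrow> 'f::euclidean_space) \<Rightarrow> 'n set \<Rightarrow> 'f \<Rightarrow> (real ^ 'n) set" where
  "flipped_polytope \<Phi> A \<nu> =
     {x \<in> fiber \<Phi> \<nu>. (\<forall>i\<in>A. x $ i < 0) \<and> (\<forall>i. i \<notin> A \<longrightarrow> 0 \<le> x $ i)}"

definition wall :: "('n::finite \<Rightarrow> 'f::euclidean_space) \<Rightarrow> 'f set \<Rightarrow> bool" where
  "wall \<Phi> H \<longleftrightarrow>
     (\<exists>B. B \<subseteq> range \<Phi> \<and> independent B \<and> card B = DIM('f) - 1 \<and> H = span B)"

definition tope :: "('n::finite \<Rightarrow> 'f::euclidean_space) \<Rightarrow> 'f set \<Rightarrow> bool" where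
  "tope \<Phi> \<tau> \<longleftrightarrow> \<tau> \<in> components (- \<Union>{H. wall \<Phi> H})"

text \<open>\<open>adjacent_topes \<Phi> \<tau>\<^sub>1 \<tau>\<^sub>2 H\<close>: the topes are adjacent and \<open>H\<close> is their common wall.\<close>

definition adjacent_topes ::
    "('n::finite \<Rightarrow> 'f::euclidean_space) \<Rightarrow> 'f set \<Rightarrow> 'f set \<Rightarrow> 'f set \<Rightarrow> bool" where
  "adjacent_topes \<Phi> \<tau>\<^sub>1 \<tau>\<^sub>2 H \<longleftrightarrow>
     tope \<Phi> \<tau>\<^sub>1 \<and> tope \<Phi> \<tau>\<^sub>2 \<and> wall \<Phi> H \<and>
     closure \<tau>\<^sub>1 \<inter> closure \<tau>\<^sub>2 \<subseteq> H \<and> span (closure \<tau>\<^sub>1 \<inter> closure \<tau>\<^sub>2) = H"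

text \<open>For a linear hyperplane \<open>H\<close>: \<open>U\<close> is one of the two open half-spaces bounded by \<open>H\<close>.\<close>

definition open_side :: "'f::euclidean_space set \<Rightarrow> 'f set \<Rightarrow> bool" where
  "open_side H U \<longleftrightarrow> (\<exists>a. a \<noteq> 0 \<and> H = {x. a \<bullet> x = 0} \<and> U = {x. a \<bullet> x > 0})"

definition side_indices ::
    "('n::finite \<Rightarrow> 'f::euclidean_space) \<Rightarrow> 'f set \<Rightarrow> 'f set \<Rightarrow> 'n set" where
  "side_indices \<Phi> H \<tau> = {i. \<exists>U. open_side H U \<and> \<tau> \<subseteq> U \<and> \<Phi> i \<in> U}"

definition generating_sets ::
    "('n::finite \<Rightarrow> 'f::euclidean_space) \<Rightarrow> 'f set \<Rightarrow> 'n set set" where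
  "generating_sets \<Phi> \<tau> = {I. span (\<Phi> ` I) = UNIV \<and> \<tau> \<subseteq> gen_cone \<Phi> I}"

text \<open>The subtraction in the exponent never truncates: a generating set has at least \<open>DIM('f)\<close>
  elements.\<close>

definition XX ::
    "('n::finite \<Rightarrow> 'f::euclidean_space) \<Rightarrow> 'f set \<Rightarrow> real ^ 'n \<Rightarrow> real" where
  "XX \<Phi> \<tau> x = (\<Sum>I\<in>generating_sets \<Phi> \<tau>.
     (-1) ^ (card I - DIM('f)) * (\<Prod>i\<in>-I. of_bool (0 \<le> x $ i)))"

text \<open>
  A Lebesgue measure on a linear subspace \<open>V\<close> is the image of the standard Lebesgue (Borel) measure
  under the coordinates given by some basis of \<open>V\<close>, up to a positive factor. The factor matters only
  for \<open>V = {0}\<close>, where the basis is empty and the measure is a multiple of the unit point mass.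
\<close>

definition lebesgue_measure_on :: "'v::euclidean_space set \<Rightarrow> 'v measure \<Rightarrow> bool" where
  "lebesgue_measure_on V \<mu> \<longleftrightarrow>
     (\<exists>B c. independent B \<and> span B = V \<and> (0::real) < c \<and>
        \<mu> = scale_measure (ennreal c)
              (distr (PiM B (\<lambda>_. lborel)) (restrict_space borel V) (\<lambda>t. \<Sum>b\<in>B. t b *\<^sub>R b)))"

text \<open>The translate to \<open>fiber \<Phi> \<nu>\<close> of a measure on \<open>fiber \<Phi> 0\<close>; the base point is irrelevant when
  the measure is translation invariant.\<close>

definition fiber_measure ::
    "('n::finite \<Rightarrow> 'f::euclidean_space) \<Rightarrow> (real ^ 'n) measure \<Rightarrow> 'f \<Rightarrow> (real ^ 'n) measure" where
  "fiber_measure \<Phi> \<mu> \<nu> =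
     distr \<mu> (restrict_space borel (fiber \<Phi> \<nu>)) (\<lambda>v. (SOME x. x \<in> fiber \<Phi> \<nu>) + v)"

definition integer_points :: "(real ^ 'n::finite) set" where
  "integer_points = {x. \<forall>i. x $ i \<in> \<int>}"

definition I_int ::
    "('n::finite \<Rightarrow> 'f::euclidean_space) \<Rightarrow> (real ^ 'n) measure \<Rightarrow> 'f set \<Rightarrow>
     (real ^ 'n \<Rightarrow> real) \<Rightarrow> 'f \<Rightarrow> real" where
  "I_int \<Phi> \<mu> \<tau> h \<nu> = (LINT x|fiber_measure \<Phi> \<mu> \<nu>. XX \<Phi> \<tau> x * h x)"

text \<open>\<open>infsum\<close> because the index set may be infinite; only finitely many terms are nonzero.\<close>

definition S_sum ::
    "('n::finite \<Rightarrow> 'f::euclidean_space) \<Rightarrow> 'f set \<Rightarrow> (real ^ 'n \<Rightarrow> real) \<Rightarrow> 'f \<Rightarrow> real" where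
  "S_sum \<Phi> \<tau> h \<nu> = (\<Sum>\<^sub>\<infinity>x\<in>fiber \<Phi> \<nu> \<inter> integer_points. XX \<Phi> \<tau> x * h x)"

definition full_lattice :: "'f::euclidean_space set \<Rightarrow> bool" where
  "full_lattice \<Lambda> \<longleftrightarrow>
     (\<exists>B. independent B \<and> span B = UNIV \<and>
          \<Lambda> = {(\<Sum>b\<in>B. of_int (c b) *\<^sub>R b) | c :: 'f \<Rightarrow> int. True})"

definition quasi_polynomial_on :: "'f::euclidean_space set \<Rightarrow> ('f \<Rightarrow> real) \<Rightarrow> bool" where
  "quasi_polynomial_on \<Lambda> f \<longleftrightarrow>
     (\<exists>\<Lambda>'. full_lattice \<Lambda>' \<and> \<Lambda>' \<subseteq> \<Lambda> \<and> finite ((\<lambda>x. (+) x ` \<Lambda>') ` \<Lambda>) \<and>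
        (\<forall>\<nu>\<^sub>0\<in>\<Lambda>. \<exists>p. real_polynomial_function p \<and> (\<forall>\<nu>'\<in>\<Lambda>'. f (\<nu>\<^sub>0 + \<nu>') = p \<nu>')))"

end

theory Submission
  imports Defs
begin

text \<open>
A point \<open>x\<close> enters \<open>XX \<Phi> \<tau> x\<close> only through the set \<open>J\<close> of its negative coordinates: the value is the
alternating count of the index sets \<open>I \<supseteq> J\<close> whose cone contains one (equivalently, every) vector
\<open>u\<close> of the tope. Linear programming evaluates this count. Give every index a generic cost \<open>c\<close>. Each
\<open>I\<close> with \<open>u\<close> in its cone contains exactly one basis \<open>\<sigma>\<close> that expresses \<open>u\<close> at minimal cost, and
\<open>\<sigma>\<close> is recognised by the positive reduced costs of the other elements of \<open>I\<close>. Sorted by \<open>\<sigma>\<close>, the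
sets \<open>I\<close> form intervals, on which the signs cancel except when the interval is a single set
(\<open>signed_count_polarized\<close>, a form of the Lawrence--Varchenko decomposition). A surviving basis
has positive reduced costs on \<open>J - \<sigma>\<close> and nonpositive ones elsewhere, so if \<open>x\<close> has the sign pattern
\<open>J\<close>, then the cost of \<open>x\<close> is at most that of the solution supported on \<open>\<sigma>\<close>
(\<open>signed_count_separation\<close>, for all costs by density).

Suitable costs give everything needed about \<open>XX\<close>. The linear form \<open>- x j\<close> separates a point with
\<open>x j < 0\<close> from the nonnegative solutions; hence \<open>XX\<close> is the indicator of the polytope over the
closure of the tope and, at integral points, over its difference with the zonotope. The forms \<open>x i\<close>
and \<open>- x i\<close> bound the support of \<open>XX\<close> on a fibre linearly in \<open>\<nu>\<close>. Across the wall between two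
adjacent topes the count changes by a product of a count inside the wall and an alternating sum over
the vectors off the wall. The latter isolates the vectors on the side of \<open>\<tau>\<^sub>1\<close>, and the former is
evaluated by reversing these vectors and applying the first result to the reversed family
(\<open>wall_crossing\<close>).

For polynomiality, integration and lattice summation are treated together as operators \<open>L\<close> with
\<open>L (\<lambda>x. F (x + t e\<^sub>k)) \<nu> = L F (\<nu> + t \<Phi>\<^sub>k)\<close>. Moving \<open>\<nu>\<close> by \<open>t \<Phi>\<^sub>k\<close> therefore shifts
the coordinate \<open>x\<^sub>k\<close>: the difference consists of a term in which \<open>h\<close> is replaced by its
difference, and a term supported on the strip where \<open>x\<^sub>k\<close> changes sign, in which \<open>\<Phi>\<^sub>k\<close> is
deleted from the family. By induction some fixed number of differences annihilates the result
(\<open>operator_diff_nilpotent\<close>). Newton interpolation along a basis turns this into a polynomial: on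
the cosets of a sublattice in the discrete case, and everywhere, by one-sided continuity, in the case
of integrals.
\<close>

section \<open>Cones spanned by index sets\<close>

lemma linear_functional_inner:
  fixes g :: "'f::euclidean_space \<Rightarrow> real"
  assumes "linear g" shows "\<exists>d. \<forall>x. g x = d \<bullet> x"
proof -
  have "g x = adjoint g 1 \<bullet> x" for x
    using adjoint_works[OF assms, of x 1] by (simp add: inner_commute)
  then show ?thesis by blast
qed

lemma dual_vectors_exist:
  fixes B :: "'f::euclidean_space set"
  assumes "independent B"
  shows "\<exists>d. \<forall>b. \<forall>b'\<in>B. d b \<bullet> b' = (of_bool (b' = b) :: real)"
proof -
  have "\<exists>d. \<forall>b'\<in>B. d \<bullet> b' = (of_bool (b' = b) :: real)" for b
  proof -
    obtain g :: "'f \<Rightarrow> real" where g: "linear g" "\<forall>b'\<in>B. g b' = of_bool (b' = b)"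
      using linear_independent_extend[OF assms, of "\<lambda>b'. of_bool (b' = b)"] by metis
    obtain d where "\<forall>x. g x = d \<bullet> x" using linear_functional_inner[OF g(1)] by blast
    with g(2) show ?thesis by (intro exI[of _ d]) simp
  qed
  then show ?thesis by (intro choice allI)
qed

text \<open>
For a generating family these are the vectors off all walls. In terms of spans the notion is visibly
independent of the signs of the vectors, which \<open>wall_crossing\<close> exploits.
\<close>

definition regular :: "('n::finite \<Rightarrow> 'f::euclidean_space) \<Rightarrow> 'f \<Rightarrow> bool" where
  "regular \<Phi> u \<longleftrightarrow> (\<forall>I. u \<in> span (\<Phi> ` I) \<longrightarrow> span (\<Phi> ` I) = UNIV)"

text \<open>
For nonzero vectors this is salience of the cone, as a statement about linear relations.
\<close>

definition pointed :: "('n::finite \<Rightarrow> 'f::euclidean_space) \<Rightarrow> bool" where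
  "pointed \<Phi> \<longleftrightarrow> (\<forall>w. (\<forall>i. 0 \<le> w i) \<longrightarrow> (\<Sum>i\<in>UNIV. w i *\<^sub>R \<Phi> i) = 0 \<longrightarrow> (\<forall>i. w i = 0))"

text \<open>
Bases are sets of indices because \<open>\<Phi>\<close> may repeat a vector.
\<close>

definition ibasis :: "('n::finite \<Rightarrow> 'f::euclidean_space) \<Rightarrow> 'n set \<Rightarrow> bool" where
  "ibasis \<Phi> \<sigma> \<longleftrightarrow> inj_on \<Phi> \<sigma> \<and> independent (\<Phi> ` \<sigma>) \<and> span (\<Phi> ` \<sigma>) = UNIV"

text \<open>
The dual basis, so that \<open>dual \<Phi> \<sigma> k \<bullet> v\<close> is the coefficient of \<open>\<Phi> k\<close> in \<open>v\<close>.
\<close>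

definition dual :: "('n::finite \<Rightarrow> 'f::euclidean_space) \<Rightarrow> 'n set \<Rightarrow> 'n \<Rightarrow> 'f" where
  "dual \<Phi> \<sigma> k = (SOME d. \<forall>i\<in>\<sigma>. d \<bullet> \<Phi> i = of_bool (i = k))"

lemma dual_inner:
  fixes \<Phi> :: "'n::finite \<Rightarrow> 'f::euclidean_space"
  assumes "ibasis \<Phi> \<sigma>" "i \<in> \<sigma>"
  shows "dual \<Phi> \<sigma> k \<bullet> \<Phi> i = of_bool (i = k)"
proof -
  have inj: "inj_on \<Phi> \<sigma>" and ind: "independent (\<Phi> ` \<sigma>)" using assms by (auto simp: ibasis_def)
  obtain g :: "'f \<Rightarrow> real" where g: "linear g"
    "\<forall>x\<in>\<Phi> ` \<sigma>. g x = of_bool (inv_into \<sigma> \<Phi> x = k)"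
    using linear_independent_extend[OF ind, of "\<lambda>x. of_bool (inv_into \<sigma> \<Phi> x = k)"] by metis
  obtain d where "\<forall>x. g x = d \<bullet> x" using linear_functional_inner[OF g(1)] by blast
  then have "\<exists>d. \<forall>i\<in>\<sigma>. d \<bullet> \<Phi> i = of_bool (i = k)"
    using g inj by (intro exI[of _ d]) (auto simp: inv_into_f_f)
  then have "\<forall>i\<in>\<sigma>. dual \<Phi> \<sigma> k \<bullet> \<Phi> i = of_bool (i = k)"
    unfolding dual_def by (rule someI_ex)
  with assms(2) show ?thesis by blast
qed

lemma dual_expansion:
  assumes "ibasis \<Phi> \<sigma>"
  shows "(\<Sum>k\<in>\<sigma>. (dual \<Phi> \<sigma> k \<bullet> v) *\<^sub>R \<Phi> k) = v"
proof -
  have "linear (\<lambda>v. \<Sum>k\<in>\<sigma>. (dual \<Phi> \<sigma> k \<bullet> v) *\<^sub>R \<Phi> k)"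
    by (intro linearI) (simp_all add: inner_add_right scaleR_add_left sum.distrib scaleR_sum_right)
  moreover have "linear (\<lambda>v::'b. v)" by (intro linearI) auto
  moreover have "v \<in> span (\<Phi> ` \<sigma>)" using assms by (simp add: ibasis_def)
  moreover have "(\<Sum>k\<in>\<sigma>. (dual \<Phi> \<sigma> k \<bullet> b) *\<^sub>R \<Phi> k) = b" if "b \<in> \<Phi> ` \<sigma>" for b
  proof -
    from that obtain i where i: "i \<in> \<sigma>" "b = \<Phi> i" by blast
    have "(\<Sum>k\<in>\<sigma>. (dual \<Phi> \<sigma> k \<bullet> b) *\<^sub>R \<Phi> k) = (\<Sum>k\<in>\<sigma>. if k = i then \<Phi> i else 0)"
      using i by (intro sum.cong) (auto simp: dual_inner[OF assms])
    then show ?thesis using i by simp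
  qed
  ultimately show ?thesis by (rule linear_eq_on)
qed

lemma dual_combination:
  assumes "ibasis \<Phi> \<sigma>" "k \<in> \<sigma>"
  shows "dual \<Phi> \<sigma> k \<bullet> (\<Sum>i\<in>\<sigma>. t i *\<^sub>R \<Phi> i) = t k"
  using assms by (simp add: inner_sum_right dual_inner[OF assms(1)])

lemma sum_in_gen_cone:
  assumes "\<And>i. i \<in> I \<Longrightarrow> 0 \<le> t i" shows "(\<Sum>i\<in>I. t i *\<^sub>R \<Phi> i) \<in> gen_cone \<Phi> I"
  using assms by (auto simp: gen_cone_def)

lemma gen_cone_mono:
  assumes "I \<subseteq> J" shows "gen_cone \<Phi> I \<subseteq> gen_cone \<Phi> J"
proof
  fix u assume "u \<in> gen_cone \<Phi> I"
  then obtain t where t: "\<forall>i\<in>I. 0 \<le> t i" "u = (\<Sum>i\<in>I. t i *\<^sub>R \<Phi> i)" by (auto simp: gen_cone_def)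
  have "(\<Sum>i\<in>J. (if i \<in> I then t i else 0) *\<^sub>R \<Phi> i) = (\<Sum>i\<in>I. t i *\<^sub>R \<Phi> i)"
    using assms by (intro sum.mono_neutral_cong_right) auto
  moreover have "(\<Sum>i\<in>J. (if i \<in> I then t i else 0) *\<^sub>R \<Phi> i) \<in> gen_cone \<Phi> J"
    using t(1) by (intro sum_in_gen_cone) auto
  ultimately show "u \<in> gen_cone \<Phi> J" using t(2) by simp
qed

lemma ibasis_gen_cone_iff:
  assumes "ibasis \<Phi> \<sigma>"
  shows "v \<in> gen_cone \<Phi> \<sigma> \<longleftrightarrow> (\<forall>k\<in>\<sigma>. 0 \<le> dual \<Phi> \<sigma> k \<bullet> v)"
proof
  assume "v \<in> gen_cone \<Phi> \<sigma>"
  then obtain t where t: "\<forall>i\<in>\<sigma>. 0 \<le> t i" "v = (\<Sum>i\<in>\<sigma>. t i *\<^sub>R \<Phi> i)" by (auto simp: gen_cone_def)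
  have "dual \<Phi> \<sigma> k \<bullet> v = t k" if "k \<in> \<sigma>" for k
    using that by (simp add: t(2) inner_sum_right dual_inner[OF assms])
  with t(1) show "\<forall>k\<in>\<sigma>. 0 \<le> dual \<Phi> \<sigma> k \<bullet> v" by simp
next
  assume "\<forall>k\<in>\<sigma>. 0 \<le> dual \<Phi> \<sigma> k \<bullet> v"
  then show "v \<in> gen_cone \<Phi> \<sigma>"
    using sum_in_gen_cone[of \<sigma> "\<lambda>k. dual \<Phi> \<sigma> k \<bullet> v" \<Phi>] by (simp add: dual_expansion[OF assms])
qed

lemma gen_cone_subset_span: "gen_cone \<Phi> I \<subseteq> span (\<Phi> ` I)"
  unfolding gen_cone_def by (clarify, intro span_sum span_scale, rule span_base) blast

lemma indep_family:
  assumes "\<And>w. (\<Sum>i\<in>\<sigma>. w i *\<^sub>R \<Phi> i) = 0 \<Longrightarrow> \<forall>i\<in>\<sigma>. w i = (0::real)"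
  shows "inj_on \<Phi> \<sigma> \<and> independent ((\<Phi>::'n::finite \<Rightarrow> 'f::euclidean_space) ` \<sigma>)"
proof
  show inj: "inj_on \<Phi> \<sigma>"
  proof (rule inj_onI, rule ccontr)
    fix i j assume ij: "i \<in> \<sigma>" "j \<in> \<sigma>" "\<Phi> i = \<Phi> j" "i \<noteq> j"
    define w where "w k = (if k = i then 1 else if k = j then - 1 else (0::real))" for k
    have "(\<Sum>k\<in>\<sigma>. w k *\<^sub>R \<Phi> k) = (\<Sum>k\<in>{i,j}. w k *\<^sub>R \<Phi> k)"
      using ij by (intro sum.mono_neutral_right) (auto simp: w_def)
    also have "\<dots> = 0" using ij by (auto simp: w_def)
    finally have "w i = 0" using assms ij by blast
    then show False by (simp add: w_def)
  qed
  show "independent (\<Phi> ` \<sigma>)"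
  proof (rule ccontr)
    assume "\<not> independent (\<Phi> ` \<sigma>)"
    then obtain u where u: "\<exists>v\<in>\<Phi> ` \<sigma>. u v \<noteq> 0" "(\<Sum>v\<in>\<Phi> ` \<sigma>. u v *\<^sub>R v) = 0"
      using dependent_finite[of "\<Phi> ` \<sigma>"] by auto
    have "(\<Sum>i\<in>\<sigma>. u (\<Phi> i) *\<^sub>R \<Phi> i) = 0" using u(2) by (simp add: sum.reindex[OF inj])
    from assms[OF this] u(1) show False by blast
  qed
qed

lemma gen_cone_drop:
  assumes t: "\<And>i. i \<in> \<sigma> \<Longrightarrow> 0 \<le> t i" and k: "k \<in> \<sigma>" "t k = 0"
  shows "(\<Sum>i\<in>\<sigma>. t i *\<^sub>R \<Phi> i) \<in> gen_cone \<Phi> (\<sigma> - {k})"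
proof -
  have "(\<Sum>i\<in>\<sigma>. t i *\<^sub>R \<Phi> i) = (\<Sum>i\<in>\<sigma> - {k}. t i *\<^sub>R \<Phi> i)"
    using k by (intro sum.mono_neutral_right) auto
  then show ?thesis using t sum_in_gen_cone[of "\<sigma> - {k}" t \<Phi>] by simp
qed

text \<open>
Walk from \<open>t\<close> in the direction \<open>- w\<close> until the first coordinate vanishes. This is the step to
a neighbouring vertex in the simplex algorithm.
\<close>

lemma ratio_test:
  fixes t w :: "'n::finite \<Rightarrow> real"
  assumes t: "\<And>i. i \<in> \<sigma> \<Longrightarrow> 0 \<le> t i" and k: "k \<in> \<sigma>" "w k > 0"
  obtains s k0 where "s \<ge> 0" "k0 \<in> \<sigma>" "w k0 > 0" "t k0 = s * w k0"
    "\<And>i. i \<in> \<sigma> \<Longrightarrow> 0 \<le> t i - s * w i"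
proof -
  let ?P = "{i \<in> \<sigma>. w i > 0}"
  have ne: "?P \<noteq> {}" using k by blast
  define k0 where "k0 = arg_min_on (\<lambda>i. t i / w i) ?P"
  have k0: "k0 \<in> ?P" "\<And>i. i \<in> ?P \<Longrightarrow> t k0 / w k0 \<le> t i / w i"
    unfolding k0_def using arg_min_if_finite(1)[OF _ ne] arg_min_least[OF _ ne, where f = "\<lambda>i. t i / w i"]
    by auto
  have s0: "t k0 / w k0 \<ge> 0" using k0(1) t by simp
  show thesis
  proof (rule that[of "t k0 / w k0" k0])
    fix i assume i: "i \<in> \<sigma>"
    show "0 \<le> t i - t k0 / w k0 * w i"
    proof (cases "w i > 0")
      case True
      then show ?thesis using k0(2)[of i] i by (simp add: pos_le_divide_eq)
    next
      case False
      then have "t k0 / w k0 * w i \<le> 0" using s0 by (intro mult_nonneg_nonpos) auto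
      then show ?thesis using t[OF i] by linarith
    qed
  qed (use k0 s0 in auto)
qed

text \<open>
In a smallest subset of \<open>I\<close> whose cone contains \<open>u\<close> there is no linear relation, because walking
along one would make another coefficient vanish.
\<close>

lemma gen_cone_caratheodory:
  fixes \<Phi> :: "'n::finite \<Rightarrow> 'f::euclidean_space"
  assumes "u \<in> gen_cone \<Phi> I"
  obtains \<sigma> t where "\<sigma> \<subseteq> I" "inj_on \<Phi> \<sigma>" "independent (\<Phi> ` \<sigma>)" "\<And>k. k \<in> \<sigma> \<Longrightarrow> t k > (0::real)"
    "u = (\<Sum>k\<in>\<sigma>. t k *\<^sub>R \<Phi> k)"
proof -
  let ?Q = "\<lambda>\<sigma>. \<sigma> \<subseteq> I \<and> u \<in> gen_cone \<Phi> \<sigma>"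
  obtain \<sigma> where \<sigma>: "?Q \<sigma>" and least: "\<And>\<rho>. ?Q \<rho> \<Longrightarrow> card \<sigma> \<le> card \<rho>"
    using ex_has_least_nat[of ?Q I card] assms by blast
  have no_drop: False if "k \<in> \<sigma>" "u \<in> gen_cone \<Phi> (\<sigma> - {k})" for k
    using least[of "\<sigma> - {k}"] that \<sigma> card_Diff1_less[of \<sigma> k] by auto
  obtain t where t: "\<And>i. i \<in> \<sigma> \<Longrightarrow> 0 \<le> t i" "u = (\<Sum>i\<in>\<sigma>. t i *\<^sub>R \<Phi> i)"
    using \<sigma> by (auto simp: gen_cone_def)
  have pos: "t k > 0" if "k \<in> \<sigma>" for k
    using no_drop[OF that] gen_cone_drop[of \<sigma> t k \<Phi>] t that by (metis less_eq_real_def)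
  have no_pos: False if w: "(\<Sum>i\<in>\<sigma>. w i *\<^sub>R \<Phi> i) = 0" and k: "k \<in> \<sigma>" "w k > (0::real)" for w k
  proof -
    obtain s k0 where s: "k0 \<in> \<sigma>" "t k0 = s * w k0" "\<And>i. i \<in> \<sigma> \<Longrightarrow> 0 \<le> t i - s * w i"
      using ratio_test[of \<sigma> t k w] t k by metis
    have "(\<Sum>i\<in>\<sigma>. (t i - s * w i) *\<^sub>R \<Phi> i) = (\<Sum>i\<in>\<sigma>. t i *\<^sub>R \<Phi> i) - s *\<^sub>R (\<Sum>i\<in>\<sigma>. w i *\<^sub>R \<Phi> i)"
      by (simp add: scaleR_diff_left sum_subtractf scaleR_sum_right)
    also have "\<dots> = u" using w t by simp
    finally show False using gen_cone_drop[of \<sigma> "\<lambda>i. t i - s * w i" k0 \<Phi>] s no_drop by auto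
  qed
  have "inj_on \<Phi> \<sigma> \<and> independent (\<Phi> ` \<sigma>)"
  proof (rule indep_family, rule ballI, rule ccontr)
    fix w :: "'n \<Rightarrow> real" and k assume w: "(\<Sum>i\<in>\<sigma>. w i *\<^sub>R \<Phi> i) = 0" and k: "k \<in> \<sigma>" "w k \<noteq> 0"
    have "(\<Sum>i\<in>\<sigma>. (- w i) *\<^sub>R \<Phi> i) = 0" using w by (simp add: sum_negf)
    then show False using no_pos[of w k] no_pos[of "\<lambda>i. - w i" k] w k by fastforce
  qed
  then show thesis using that \<sigma> pos t(2) by blast
qed

lemma regular_caratheodory:
  assumes "regular \<Phi> u" "u \<in> gen_cone \<Phi> I"
  obtains \<sigma> where "\<sigma> \<subseteq> I" "ibasis \<Phi> \<sigma>" "u \<in> gen_cone \<Phi> \<sigma>"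
proof -
  obtain \<sigma> t where \<sigma>: "\<sigma> \<subseteq> I" "inj_on \<Phi> \<sigma>" "independent (\<Phi> ` \<sigma>)"
    "\<And>k. k \<in> \<sigma> \<Longrightarrow> t k > (0::real)" "u = (\<Sum>k\<in>\<sigma>. t k *\<^sub>R \<Phi> k)"
    by (rule gen_cone_caratheodory[OF assms(2)]) blast
  have "u \<in> gen_cone \<Phi> \<sigma>" unfolding \<sigma>(5) by (intro sum_in_gen_cone less_imp_le \<sigma>(4))
  moreover have "span (\<Phi> ` \<sigma>) = UNIV"
    using assms(1) calculation gen_cone_subset_span unfolding regular_def by blast
  ultimately show thesis using that \<sigma> by (auto simp: ibasis_def)
qed

lemma ibasis_card: "ibasis \<Phi> \<sigma> \<Longrightarrow> card \<sigma> = DIM('f)"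
  for \<Phi> :: "'n::finite \<Rightarrow> 'f::euclidean_space"
  using basis_card_eq_dim[of "\<Phi> ` \<sigma>" UNIV] card_image[of \<Phi> \<sigma>] by (auto simp: ibasis_def)

lemma span_facet:
  assumes "ibasis \<Phi> \<sigma>" "k \<in> \<sigma>"
  shows "span (\<Phi> ` (\<sigma> - {k})) = {v. dual \<Phi> \<sigma> k \<bullet> v = 0}"
proof
  show "span (\<Phi> ` (\<sigma> - {k})) \<subseteq> {v. dual \<Phi> \<sigma> k \<bullet> v = 0}"
    by (rule span_minimal) (auto simp: dual_inner[OF assms(1)] subspace_hyperplane)
  show "{v. dual \<Phi> \<sigma> k \<bullet> v = 0} \<subseteq> span (\<Phi> ` (\<sigma> - {k}))"
  proof
    fix v assume "v \<in> {v. dual \<Phi> \<sigma> k \<bullet> v = 0}"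
    then have "v = (\<Sum>j\<in>\<sigma> - {k}. (dual \<Phi> \<sigma> j \<bullet> v) *\<^sub>R \<Phi> j)"
      using dual_expansion[OF assms(1), of v] assms(2) by (simp add: sum.remove)
    also have "\<dots> \<in> span (\<Phi> ` (\<sigma> - {k}))" by (intro span_sum span_scale span_base) auto
    finally show "v \<in> span (\<Phi> ` (\<sigma> - {k}))" .
  qed
qed

lemma dual_nonzero: "ibasis \<Phi> \<sigma> \<Longrightarrow> k \<in> \<sigma> \<Longrightarrow> dual \<Phi> \<sigma> k \<noteq> 0"
  using dual_inner[of \<Phi> \<sigma> k k] by auto

text \<open>
If a coordinate of \<open>u\<close> vanished, then \<open>u\<close> would lie on the hyperplane spanned by a facet.
\<close>

lemma regular_dual_pos:
  assumes "regular \<Phi> u" "ibasis \<Phi> \<sigma>" "u \<in> gen_cone \<Phi> \<sigma>" "k \<in> \<sigma>"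
  shows "0 < dual \<Phi> \<sigma> k \<bullet> u"
proof -
  have "0 \<le> dual \<Phi> \<sigma> k \<bullet> u" using assms ibasis_gen_cone_iff by blast
  moreover have "dual \<Phi> \<sigma> k \<bullet> u \<noteq> 0"
  proof
    assume "dual \<Phi> \<sigma> k \<bullet> u = 0"
    then have "span (\<Phi> ` (\<sigma> - {k})) = UNIV"
      using span_facet[OF assms(2,4)] assms(1) unfolding regular_def by auto
    then have "{v. dual \<Phi> \<sigma> k \<bullet> v = 0} = UNIV" using span_facet[OF assms(2,4)] by simp
    then have "dual \<Phi> \<sigma> k \<bullet> dual \<Phi> \<sigma> k = 0" by blast
    then show False using dual_nonzero[OF assms(2,4)] by simp
  qed
  ultimately show ?thesis by linarith
qed

section \<open>Optimal bases for a generic cost\<close>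

text \<open>
The reduced cost of linear programming: what \<open>i\<close> costs, minus the value at \<open>\<Phi> i\<close> of the linear
functional that takes the values \<open>c k\<close> at the vectors \<open>\<Phi> k\<close> of the basis \<open>\<sigma>\<close>.
\<close>

definition reduced_cost :: "('n::finite \<Rightarrow> 'f::euclidean_space) \<Rightarrow> ('n \<Rightarrow> real) \<Rightarrow> 'n set \<Rightarrow> 'n \<Rightarrow> real" where
  "reduced_cost \<Phi> c \<sigma> i = c i - (\<Sum>k\<in>\<sigma>. c k * (dual \<Phi> \<sigma> k \<bullet> \<Phi> i))"

text \<open>
The value of the same functional at \<open>v\<close>, which is the cost of the solution of
\<open>(\<Sum>i\<in>UNIV. x i *\<^sub>R \<Phi> i) = v\<close> that is supported on \<open>\<sigma>\<close>.
\<close>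

definition basic_cost :: "('n::finite \<Rightarrow> 'f::euclidean_space) \<Rightarrow> ('n \<Rightarrow> real) \<Rightarrow> 'n set \<Rightarrow> 'f \<Rightarrow> real" where
  "basic_cost \<Phi> c \<sigma> v = (\<Sum>k\<in>\<sigma>. c k * (dual \<Phi> \<sigma> k \<bullet> v))"

lemma reduced_cost_basic: "ibasis \<Phi> \<sigma> \<Longrightarrow> i \<in> \<sigma> \<Longrightarrow> reduced_cost \<Phi> c \<sigma> i = 0"
  by (simp add: reduced_cost_def dual_inner)

text \<open>
Every comparison of costs below is an instance of this identity: the cost of a solution \<open>x\<close> exceeds
that of the basic solution by the reduced costs weighted with \<open>x\<close>.
\<close>

lemma sum_reduced_cost:
  "(\<Sum>i\<in>S. x i * reduced_cost \<Phi> c \<sigma> i)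
     = (\<Sum>i\<in>S. c i * x i) - basic_cost \<Phi> c \<sigma> (\<Sum>i\<in>S. x i *\<^sub>R \<Phi> i)"
proof -
  have "basic_cost \<Phi> c \<sigma> (\<Sum>i\<in>S. x i *\<^sub>R \<Phi> i)
      = (\<Sum>k\<in>\<sigma>. \<Sum>i\<in>S. x i * (c k * (dual \<Phi> \<sigma> k \<bullet> \<Phi> i)))"
    unfolding basic_cost_def by (simp add: inner_sum_right sum_distrib_left mult.left_commute)
  also have "\<dots> = (\<Sum>i\<in>S. x i * (\<Sum>k\<in>\<sigma>. c k * (dual \<Phi> \<sigma> k \<bullet> \<Phi> i)))"
    by (subst sum.swap) (simp add: sum_distrib_left)
  finally show ?thesis
    by (simp add: reduced_cost_def right_diff_distrib sum_subtractf mult.commute)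
qed

definition generic_cost :: "('n::finite \<Rightarrow> 'f::euclidean_space) \<Rightarrow> ('n \<Rightarrow> real) \<Rightarrow> bool" where
  "generic_cost \<Phi> c \<longleftrightarrow> (\<forall>\<sigma> i. ibasis \<Phi> \<sigma> \<longrightarrow> i \<notin> \<sigma> \<longrightarrow> reduced_cost \<Phi> c \<sigma> i \<noteq> 0)"

text \<open>
For regular \<open>u\<close> these sets are the supports of the vertices of the polytope of nonnegative
solutions of \<open>(\<Sum>i\<in>UNIV. x i *\<^sub>R \<Phi> i) = u\<close>.
\<close>

definition vertex_bases :: "('n::finite \<Rightarrow> 'f::euclidean_space) \<Rightarrow> 'f \<Rightarrow> 'n set set" where
  "vertex_bases \<Phi> u = {\<sigma>. ibasis \<Phi> \<sigma> \<and> u \<in> gen_cone \<Phi> \<sigma>}"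

lemma basic_cost_combination:
  assumes "ibasis \<Phi> \<sigma>"
  shows "basic_cost \<Phi> c \<sigma> (\<Sum>i\<in>\<sigma>. y i *\<^sub>R \<Phi> i) = (\<Sum>i\<in>\<sigma>. c i * y i)"
  using sum_reduced_cost[of y \<Phi> c \<sigma> \<sigma>] reduced_cost_basic[OF assms] by simp

text \<open>
A cheapest basis contained in \<open>I\<close> has this property. Otherwise an index with negative reduced cost
could enter the basis; some index has to leave because the cone is pointed, and the new basis would
be cheaper.
\<close>

lemma optimal_basis_exists:
  fixes \<Phi> :: "'n::finite \<Rightarrow> 'f::euclidean_space"
  assumes reg: "regular \<Phi> u" and pt: "pointed \<Phi>" and gen: "generic_cost \<Phi> c"
    and u: "u \<in> gen_cone \<Phi> I"
  shows "\<exists>\<sigma>\<in>vertex_bases \<Phi> u. \<sigma> \<subseteq> I \<and> (\<forall>i\<in>I - \<sigma>. 0 < reduced_cost \<Phi> c \<sigma> i)"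
proof -
  let ?C = "{\<sigma> \<in> vertex_bases \<Phi> u. \<sigma> \<subseteq> I}"
  have ne: "?C \<noteq> {}"
    using regular_caratheodory[OF reg u] by (fastforce simp: vertex_bases_def)
  define \<sigma> where "\<sigma> = arg_min_on (\<lambda>\<sigma>. basic_cost \<Phi> c \<sigma> u) ?C"
  have \<sigma>: "\<sigma> \<in> ?C" unfolding \<sigma>_def by (rule arg_min_if_finite(1)[OF _ ne]) simp
  have least: "basic_cost \<Phi> c \<sigma> u \<le> basic_cost \<Phi> c \<rho> u" if "\<rho> \<in> ?C" for \<rho>
    unfolding \<sigma>_def using arg_min_least[OF _ ne that] by simp
  have b: "ibasis \<Phi> \<sigma>" and cone: "u \<in> gen_cone \<Phi> \<sigma>" using \<sigma> by (auto simp: vertex_bases_def)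
  have "0 < reduced_cost \<Phi> c \<sigma> i" if i: "i \<in> I - \<sigma>" for i
  proof (rule ccontr)
    assume "\<not> 0 < reduced_cost \<Phi> c \<sigma> i"
    then have neg: "reduced_cost \<Phi> c \<sigma> i < 0"
      using gen b i by (auto simp: generic_cost_def not_less order_le_less)
    define a where "a k = dual \<Phi> \<sigma> k \<bullet> \<Phi> i" for k
    define t where "t k = dual \<Phi> \<sigma> k \<bullet> u" for k
    have tpos: "t k > 0" if "k \<in> \<sigma>" for k
      unfolding t_def by (rule regular_dual_pos[OF reg b cone that])
    have "\<exists>k\<in>\<sigma>. a k > 0"
    proof (rule ccontr)
      assume "\<not> (\<exists>k\<in>\<sigma>. a k > 0)"
      then have npos: "\<And>k. k \<in> \<sigma> \<Longrightarrow> a k \<le> 0" by force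
      define w where "w k = (if k = i then 1 else if k \<in> \<sigma> then - a k else 0)" for k
      have "(\<Sum>k\<in>UNIV. w k *\<^sub>R \<Phi> k) = (\<Sum>k\<in>insert i \<sigma>. w k *\<^sub>R \<Phi> k)"
        by (rule sum.mono_neutral_right) (auto simp: w_def)
      also have "\<dots> = \<Phi> i + (\<Sum>k\<in>\<sigma>. w k *\<^sub>R \<Phi> k)" using i by (simp add: w_def)
      also have "(\<Sum>k\<in>\<sigma>. w k *\<^sub>R \<Phi> k) = (\<Sum>k\<in>\<sigma>. - (a k *\<^sub>R \<Phi> k))"
        using i by (intro sum.cong) (auto simp: w_def)
      also have "\<dots> = - \<Phi> i" using dual_expansion[OF b, of "\<Phi> i"] by (simp add: sum_negf a_def)
      finally have "(\<Sum>k\<in>UNIV. w k *\<^sub>R \<Phi> k) = 0" by simp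
      moreover have "\<forall>k. 0 \<le> w k" using npos by (auto simp: w_def)
      ultimately have "w i = 0" using pt unfolding pointed_def by blast
      then show False by (simp add: w_def)
    qed
    then obtain k where k: "k \<in> \<sigma>" "a k > 0" by blast
    obtain s k0 where s: "s \<ge> 0" "k0 \<in> \<sigma>" "a k0 > 0" "t k0 = s * a k0"
      "\<And>k. k \<in> \<sigma> \<Longrightarrow> 0 \<le> t k - s * a k"
      using ratio_test[of \<sigma> t k a] tpos k by (metis less_imp_le)
    have s0: "s > 0" using s tpos[of k0] by (metis less_eq_real_def less_irrefl mult_zero_left)
    define y where "y k = (if k = i then s else if k \<in> \<sigma> then t k - s * a k else 0)" for k
    let ?\<rho> = "insert i (\<sigma> - {k0})"
    have isum: "(\<Sum>k\<in>insert i \<sigma>. y k *\<^sub>R \<Phi> k) = u"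
    proof -
      have "(\<Sum>k\<in>insert i \<sigma>. y k *\<^sub>R \<Phi> k) = s *\<^sub>R \<Phi> i + (\<Sum>k\<in>\<sigma>. (t k - s * a k) *\<^sub>R \<Phi> k)"
        using i by (auto simp: y_def intro!: sum.cong)
      also have "(\<Sum>k\<in>\<sigma>. (t k - s * a k) *\<^sub>R \<Phi> k) = u - s *\<^sub>R \<Phi> i"
        using dual_expansion[OF b, of u] dual_expansion[OF b, of "\<Phi> i"]
        by (simp add: scaleR_diff_left sum_subtractf scaleR_sum_right[symmetric] a_def t_def
            flip: scaleR_scaleR)
      finally show ?thesis by simp
    qed
    (* y is the solution after the pivot: i enters with value s and k0 leaves. *)
    have y0: "y k0 = 0" using s i by (auto simp: y_def)
    have rsum: "(\<Sum>k\<in>?\<rho>. y k *\<^sub>R \<Phi> k) = u"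
      unfolding isum[symmetric] using y0 s i by (intro sum.mono_neutral_left) auto
    have "u \<in> gen_cone \<Phi> ?\<rho>"
      unfolding rsum[symmetric] using s s0 by (intro sum_in_gen_cone) (auto simp: y_def)
    then obtain \<rho> where \<rho>: "\<rho> \<subseteq> ?\<rho>" "ibasis \<Phi> \<rho>" "u \<in> gen_cone \<Phi> \<rho>"
      by (rule regular_caratheodory[OF reg])
    have "card ?\<rho> = Suc (card (\<sigma> - {k0}))" using i by simp
    also have "\<dots> = card \<sigma>" using s(2) by (intro card_Suc_Diff1) auto
    finally have "card ?\<rho> = card \<sigma>" .
    then have "\<rho> = ?\<rho>" using \<rho> ibasis_card[OF b] ibasis_card[OF \<rho>(2)]
      by (intro card_subset_eq) auto
    with \<rho> have b': "ibasis \<Phi> ?\<rho>" "u \<in> gen_cone \<Phi> ?\<rho>" by auto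
    have "basic_cost \<Phi> c ?\<rho> u = (\<Sum>k\<in>?\<rho>. c k * y k)"
      using basic_cost_combination[OF b'(1), of c y] rsum by simp
    also have "\<dots> = (\<Sum>k\<in>insert i \<sigma>. c k * y k)"
      using y0 s i by (intro sum.mono_neutral_left) auto
    also have "\<dots> = basic_cost \<Phi> c \<sigma> u + (\<Sum>k\<in>insert i \<sigma>. y k * reduced_cost \<Phi> c \<sigma> k)"
      using sum_reduced_cost[of y \<Phi> c \<sigma> "insert i \<sigma>"] isum by simp
    also have "(\<Sum>k\<in>insert i \<sigma>. y k * reduced_cost \<Phi> c \<sigma> k) = s * reduced_cost \<Phi> c \<sigma> i"
      using i reduced_cost_basic[OF b] by (simp add: y_def)
    finally have "basic_cost \<Phi> c ?\<rho> u < basic_cost \<Phi> c \<sigma> u"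
      using s0 neg by (simp add: mult_pos_neg)
    moreover have "?\<rho> \<in> ?C" using b' \<sigma> i by (auto simp: vertex_bases_def)
    ultimately show False using least by fastforce
  qed
  then show ?thesis using \<sigma> by blast
qed

text \<open>
Evaluating \<open>sum_reduced_cost\<close> for the solution on one basis with the reduced costs of the other
shows that both have the same cost. As all coordinates of a regular \<open>u\<close> are positive, the reduced
costs then vanish on the other basis, which forces equality.
\<close>

lemma optimal_basis_unique:
  fixes \<Phi> :: "'n::finite \<Rightarrow> 'f::euclidean_space"
  assumes reg: "regular \<Phi> u"
    and 1: "\<sigma> \<in> vertex_bases \<Phi> u" "\<sigma> \<subseteq> I" "\<forall>i\<in>I - \<sigma>. 0 < reduced_cost \<Phi> c \<sigma> i"
    and 2: "\<rho> \<in> vertex_bases \<Phi> u" "\<rho> \<subseteq> I" "\<forall>i\<in>I - \<rho>. 0 < reduced_cost \<Phi> c \<rho> i"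
  shows "\<sigma> = \<rho>"
proof -
  have step: "basic_cost \<Phi> c \<sigma> u \<le> basic_cost \<Phi> c \<rho> u
      \<and> (basic_cost \<Phi> c \<rho> u \<le> basic_cost \<Phi> c \<sigma> u \<longrightarrow> \<rho> \<subseteq> \<sigma>)"
    if "\<sigma> \<in> vertex_bases \<Phi> u" "\<forall>i\<in>I - \<sigma>. 0 < reduced_cost \<Phi> c \<sigma> i"
      "\<rho> \<in> vertex_bases \<Phi> u" "\<rho> \<subseteq> I" for \<sigma> \<rho>
  proof -
    have b: "ibasis \<Phi> \<sigma>" "ibasis \<Phi> \<rho>" "u \<in> gen_cone \<Phi> \<rho>" using that by (auto simp: vertex_bases_def)
    define y where "y k = dual \<Phi> \<rho> k \<bullet> u" for k
    have ypos: "y k > 0" if "k \<in> \<rho>" for k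
      unfolding y_def by (rule regular_dual_pos[OF reg b(2,3) that])
    have usum: "(\<Sum>k\<in>\<rho>. y k *\<^sub>R \<Phi> k) = u" using dual_expansion[OF b(2)] by (simp add: y_def)
    have eq: "(\<Sum>k\<in>\<rho>. y k * reduced_cost \<Phi> c \<sigma> k) = basic_cost \<Phi> c \<rho> u - basic_cost \<Phi> c \<sigma> u"
      using sum_reduced_cost[of y \<Phi> c \<sigma> \<rho>] usum basic_cost_combination[OF b(2), of c y] by simp
    have nn: "0 \<le> reduced_cost \<Phi> c \<sigma> k" if "k \<in> \<rho>" for k
      using that \<open>\<rho> \<subseteq> I\<close> \<open>\<forall>i\<in>I - \<sigma>. 0 < reduced_cost \<Phi> c \<sigma> i\<close> reduced_cost_basic[OF b(1)]
      by (cases "k \<in> \<sigma>") (auto simp: subset_iff intro: less_imp_le)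
    have term_nn: "0 \<le> y k * reduced_cost \<Phi> c \<sigma> k" if "k \<in> \<rho>" for k
      using ypos[OF that] nn[OF that] by simp
    have "\<rho> \<subseteq> \<sigma>" if le: "basic_cost \<Phi> c \<rho> u \<le> basic_cost \<Phi> c \<sigma> u"
    proof -
      have "(\<Sum>k\<in>\<rho>. y k * reduced_cost \<Phi> c \<sigma> k) = 0"
        using eq le sum_nonneg[of \<rho> "\<lambda>k. y k * reduced_cost \<Phi> c \<sigma> k"] term_nn by fastforce
      then have "\<forall>k\<in>\<rho>. y k * reduced_cost \<Phi> c \<sigma> k = 0"
        using sum_nonneg_eq_0_iff[of \<rho> "\<lambda>k. y k * reduced_cost \<Phi> c \<sigma> k"] term_nn by simp
      then have z: "\<forall>k\<in>\<rho>. reduced_cost \<Phi> c \<sigma> k = 0" using ypos by fastforce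
      show ?thesis
      proof
        fix k assume k: "k \<in> \<rho>"
        show "k \<in> \<sigma>"
        proof (rule ccontr)
          assume "k \<notin> \<sigma>"
          then have "0 < reduced_cost \<Phi> c \<sigma> k" using k \<open>\<rho> \<subseteq> I\<close>
            \<open>\<forall>i\<in>I - \<sigma>. 0 < reduced_cost \<Phi> c \<sigma> i\<close> by blast
          then show False using z k by force
        qed
      qed
    qed
    moreover have "basic_cost \<Phi> c \<sigma> u \<le> basic_cost \<Phi> c \<rho> u"
      using eq sum_nonneg[of \<rho> "\<lambda>k. y k * reduced_cost \<Phi> c \<sigma> k"] term_nn by fastforce
    ultimately show ?thesis by blast
  qed
  show ?thesis using step[of \<sigma> \<rho>] step[of \<rho> \<sigma>] 1 2 by fastforce
qed

section \<open>Alternating counts of generating sets\<close>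

lemma exists_off_hyperplanes:
  fixes W :: "'v::euclidean_space set"
  assumes "finite W" "0 \<notin> W" "open U" "U \<noteq> {}"
  shows "\<exists>c\<in>U. \<forall>w\<in>W. w \<bullet> c \<noteq> 0"
proof (rule ccontr)
  assume "\<not> ?thesis"
  then have "U \<subseteq> (\<Union>w\<in>W. {c. w \<bullet> c = 0})" by blast
  moreover have "negligible (\<Union>w\<in>W. {c. w \<bullet> c = 0})"
    using assms by (intro negligible_Union finite_imageI) (auto intro!: negligible_hyperplane)
  ultimately show False using open_not_negligible[OF assms(3,4)] negligible_subset by blast
qed

text \<open>
Each of the finitely many conditions removes a hyperplane from the space of costs: the reduced cost
of \<open>i\<close> is a linear form in \<open>c\<close> in which \<open>c i\<close> has coefficient \<open>1\<close>.
\<close>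

lemma generic_cost_dense:
  fixes \<Phi> :: "'n::finite \<Rightarrow> 'f::euclidean_space" and U :: "(real ^ 'n) set"
  assumes "open U" "U \<noteq> {}"
  shows "\<exists>c\<in>U. generic_cost \<Phi> (($) c)"
proof -
  define circ :: "'n set \<times> 'n \<Rightarrow> real ^ 'n" where
    "circ = (\<lambda>(\<sigma>, i). \<chi> j. of_bool (j = i) - (if j \<in> \<sigma> then dual \<Phi> \<sigma> j \<bullet> \<Phi> i else 0))"
  have circ: "circ (\<sigma>, i) \<bullet> c = reduced_cost \<Phi> (($) c) \<sigma> i" for \<sigma> i c
  proof -
    have "circ (\<sigma>, i) \<bullet> c = (\<Sum>j\<in>UNIV. of_bool (j = i) * c $ j)
        - (\<Sum>j\<in>UNIV. (if j \<in> \<sigma> then dual \<Phi> \<sigma> j \<bullet> \<Phi> i else 0) * c $ j)"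
      by (simp add: circ_def inner_vec_def left_diff_distrib sum_subtractf)
    also have "(\<Sum>j\<in>UNIV. (if j \<in> \<sigma> then dual \<Phi> \<sigma> j \<bullet> \<Phi> i else 0) * c $ j)
        = (\<Sum>j\<in>\<sigma>. c $ j * (dual \<Phi> \<sigma> j \<bullet> \<Phi> i))"
      by (intro sum.mono_neutral_cong_right) auto
    finally show ?thesis by (simp add: reduced_cost_def)
  qed
  let ?W = "circ ` {p. snd p \<notin> fst p}"
  have "circ p $ snd p = 1" if "snd p \<notin> fst p" for p
    using that by (simp add: circ_def split_beta)
  then have "circ p \<noteq> 0" if "snd p \<notin> fst p" for p using that by fastforce
  then have "0 \<notin> ?W" by fastforce
  then obtain c where "c \<in> U" "\<forall>w\<in>?W. w \<bullet> c \<noteq> 0"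
    using exists_off_hyperplanes[of ?W U] assms by auto
  then have "reduced_cost \<Phi> (($) c) \<sigma> i \<noteq> 0" if "i \<notin> \<sigma>" for \<sigma> i
    using that circ[of \<sigma> i c] by (metis (mono_tags, lifting) fst_conv imageI mem_Collect_eq snd_conv)
  then show ?thesis using \<open>c \<in> U\<close> by (auto simp: generic_cost_def)
qed

text \<open>
The value of \<open>XX\<close> at a point with negative coordinates \<open>J\<close>, with a vector \<open>u\<close> in place of the tope
and for a subfamily \<open>S\<close>, so that vectors can be deleted one at a time.
\<close>

definition signed_count ::
    "('n::finite \<Rightarrow> 'f::euclidean_space) \<Rightarrow> 'f \<Rightarrow> 'n set \<Rightarrow> 'n set \<Rightarrow> real" where
  "signed_count \<Phi> u S J =
     (-1) ^ DIM('f) * (\<Sum>I | J \<subseteq> I \<and> I \<subseteq> S \<and> u \<in> gen_cone \<Phi> I. (-1) ^ card I)"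

text \<open>
Inserting a fixed element of \<open>B - A\<close> pairs the terms with opposite signs.
\<close>

lemma alternating_sum_interval:
  fixes B :: "'a set"
  assumes "finite B"
  shows "(\<Sum>I | A \<subseteq> I \<and> I \<subseteq> B. (-1) ^ card I) = (if A = B then (-1) ^ card B else (0::real))"
proof (cases "A \<subseteq> B \<and> A \<noteq> B")
  case False
  then have "{I. A \<subseteq> I \<and> I \<subseteq> B} = (if A = B then {B} else {})" by auto
  then show ?thesis by simp
next
  case True
  then obtain x where x: "x \<in> B" "x \<notin> A" by blast
  let ?D = "{I. A \<subseteq> I \<and> I \<subseteq> B - {x}}"
  have fin: "finite ?D" using assms by (auto intro: finite_subset[of _ "Pow B"])
  have split: "{I. A \<subseteq> I \<and> I \<subseteq> B} = ?D \<union> insert x ` ?D"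
  proof (intro equalityI subsetI)
    fix I assume I: "I \<in> {I. A \<subseteq> I \<and> I \<subseteq> B}"
    show "I \<in> ?D \<union> insert x ` ?D"
    proof (cases "x \<in> I")
      case True
      then have "I = insert x (I - {x})" "I - {x} \<in> ?D" using I x by auto
      then show ?thesis by blast
    qed (use I in auto)
  qed (use x in auto)
  have inj: "inj_on (insert x) ?D" by (rule inj_onI) auto
  have disj: "?D \<inter> insert x ` ?D = {}" by auto
  have card: "card (insert x I) = Suc (card I)" if "I \<in> ?D" for I
    using that assms by (intro card_insert_disjoint) (auto intro: finite_subset)
  have "(\<Sum>I\<in>insert x ` ?D. (-1) ^ card I) = (\<Sum>I\<in>?D. - ((-1) ^ card I) :: real)"
    unfolding sum.reindex[OF inj] using card by (intro sum.cong) auto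
  then have "(\<Sum>I | A \<subseteq> I \<and> I \<subseteq> B. (-1) ^ card I) = (0::real)"
    unfolding split by (subst sum.union_disjoint) (use fin disj in \<open>auto simp: sum_negf\<close>)
  then show ?thesis using True by simp
qed

text \<open>
The sets \<open>I\<close> with optimal basis \<open>\<sigma>\<close> form the interval from \<open>\<sigma>\<close> to the union of \<open>\<sigma>\<close> with the
indices of positive reduced cost. Its part between \<open>J\<close> and \<open>S\<close> contributes only if it is a
single set.
\<close>

lemma signed_count_polarized:
  fixes \<Phi> :: "'n::finite \<Rightarrow> 'f::euclidean_space"
  assumes reg: "regular \<Phi> u" and pt: "pointed \<Phi>" and gen: "generic_cost \<Phi> c"
  shows "signed_count \<Phi> u S J = (-1) ^ DIM('f) * (\<Sum>\<sigma>\<in>vertex_bases \<Phi> u.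
    if J \<union> \<sigma> = S \<inter> (\<sigma> \<union> {i. 0 < reduced_cost \<Phi> c \<sigma> i}) then (-1) ^ card (J \<union> \<sigma>) else 0)"
proof -
  define M where "M I \<sigma> \<longleftrightarrow> \<sigma> \<subseteq> I \<and> (\<forall>i\<in>I - \<sigma>. 0 < reduced_cost \<Phi> c \<sigma> i)" for I \<sigma>
  have one: "of_bool (u \<in> gen_cone \<Phi> I) = (\<Sum>\<sigma>\<in>vertex_bases \<Phi> u. of_bool (M I \<sigma>) :: real)" for I
  proof (cases "u \<in> gen_cone \<Phi> I")
    case True
    obtain \<sigma> where \<sigma>: "\<sigma> \<in> vertex_bases \<Phi> u" "M I \<sigma>"
      using optimal_basis_exists[OF reg pt gen True] unfolding M_def by blast
    have "M I \<rho> \<longleftrightarrow> \<rho> = \<sigma>" if "\<rho> \<in> vertex_bases \<Phi> u" for \<rho>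
      using optimal_basis_unique[OF reg, of \<sigma> I c \<rho>] \<sigma> that unfolding M_def by blast
    then have "(\<Sum>\<rho>\<in>vertex_bases \<Phi> u. of_bool (M I \<rho>) :: real) = (\<Sum>\<rho>\<in>vertex_bases \<Phi> u. of_bool (\<rho> = \<sigma>))"
      by (intro sum.cong) auto
    then show ?thesis using True \<sigma> by (simp add: of_bool_def)
  next
    case False
    then have "\<not> M I \<sigma>" if "\<sigma> \<in> vertex_bases \<Phi> u" for \<sigma>
      using that gen_cone_mono[of \<sigma> I \<Phi>] by (auto simp: vertex_bases_def M_def)
    then show ?thesis using False by simp
  qed
  let ?R = "\<lambda>\<sigma>. S \<inter> (\<sigma> \<union> {i. 0 < reduced_cost \<Phi> c \<sigma> i})"
  have "(\<Sum>I | J \<subseteq> I \<and> I \<subseteq> S \<and> u \<in> gen_cone \<Phi> I. (-1) ^ card I)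
      = (\<Sum>I | J \<subseteq> I \<and> I \<subseteq> S. of_bool (u \<in> gen_cone \<Phi> I) * (-1) ^ card I :: real)"
    by (intro sum.mono_neutral_cong_left) auto
  also have "\<dots> = (\<Sum>\<sigma>\<in>vertex_bases \<Phi> u. \<Sum>I | J \<subseteq> I \<and> I \<subseteq> S. of_bool (M I \<sigma>) * (-1) ^ card I)"
    unfolding one sum_distrib_right by (rule sum.swap)
  also have "\<dots> = (\<Sum>\<sigma>\<in>vertex_bases \<Phi> u. \<Sum>I | J \<union> \<sigma> \<subseteq> I \<and> I \<subseteq> ?R \<sigma>. (-1) ^ card I)"
    by (intro sum.cong refl sum.mono_neutral_cong_right) (auto simp: M_def)
  also have "\<dots> = (\<Sum>\<sigma>\<in>vertex_bases \<Phi> u. if J \<union> \<sigma> = ?R \<sigma> then (-1) ^ card (J \<union> \<sigma>) else 0)"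
    by (intro sum.cong refl) (subst alternating_sum_interval, auto)
  finally show ?thesis by (simp add: signed_count_def)
qed

text \<open>
Only the basis without positive reduced costs survives, and it is the optimal basis for the
opposite cost.
\<close>

lemma signed_count_cone:
  fixes \<Phi> :: "'n::finite \<Rightarrow> 'f::euclidean_space"
  assumes reg: "regular \<Phi> u" and pt: "pointed \<Phi>" and u: "u \<in> gen_cone \<Phi> UNIV"
  shows "signed_count \<Phi> u UNIV {} = 1"
proof -
  obtain c0 :: "real ^ 'n" where "generic_cost \<Phi> (($) c0)"
    using generic_cost_dense[of UNIV \<Phi>] by auto
  then obtain c where gen: "generic_cost \<Phi> c" by blast
  have neg: "reduced_cost \<Phi> (\<lambda>i. - c i) \<sigma> i = - reduced_cost \<Phi> c \<sigma> i" for \<sigma> i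
    by (simp add: reduced_cost_def sum_negf)
  have gen': "generic_cost \<Phi> (\<lambda>i. - c i)" using gen by (simp add: generic_cost_def neg)
  obtain \<sigma> where \<sigma>: "\<sigma> \<in> vertex_bases \<Phi> u" "\<forall>i\<in>UNIV - \<sigma>. 0 < reduced_cost \<Phi> (\<lambda>i. - c i) \<sigma> i"
    using optimal_basis_exists[OF reg pt gen' u] by blast
  have iff: "{} \<union> \<rho> = UNIV \<inter> (\<rho> \<union> {i. 0 < reduced_cost \<Phi> c \<rho> i}) \<longleftrightarrow> \<rho> = \<sigma>"
    if \<rho>: "\<rho> \<in> vertex_bases \<Phi> u" for \<rho>
  proof
    assume eq: "{} \<union> \<rho> = UNIV \<inter> (\<rho> \<union> {i. 0 < reduced_cost \<Phi> c \<rho> i})"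
    have "0 < reduced_cost \<Phi> (\<lambda>i. - c i) \<rho> i" if "i \<in> UNIV - \<rho>" for i
    proof -
      have "\<not> 0 < reduced_cost \<Phi> c \<rho> i" using eq that by blast
      moreover have "reduced_cost \<Phi> c \<rho> i \<noteq> 0"
        using gen \<rho> that by (auto simp: generic_cost_def vertex_bases_def)
      ultimately show ?thesis by (simp add: neg)
    qed
    then show "\<rho> = \<sigma>" using optimal_basis_unique[OF reg \<rho> _ _ \<sigma>(1) _ \<sigma>(2)] by blast
  next
    assume "\<rho> = \<sigma>"
    moreover have "reduced_cost \<Phi> c \<sigma> i < 0" if "i \<notin> \<sigma>" for i using \<sigma>(2) that by (simp add: neg)
    ultimately show "{} \<union> \<rho> = UNIV \<inter> (\<rho> \<union> {i. 0 < reduced_cost \<Phi> c \<rho> i})"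
      by (auto dest: less_asym)
  qed
  have "(\<Sum>\<rho>\<in>vertex_bases \<Phi> u. if {} \<union> \<rho> = UNIV \<inter> (\<rho> \<union> {i. 0 < reduced_cost \<Phi> c \<rho> i})
      then (-1) ^ card ({} \<union> \<rho>) else 0) = (\<Sum>\<rho>\<in>vertex_bases \<Phi> u. if \<rho> = \<sigma> then (-1) ^ card \<rho> else (0::real))"
    using iff by (intro sum.cong refl) simp
  also have "\<dots> = (-1) ^ DIM('f)" using \<sigma> ibasis_card[of \<Phi> \<sigma>] by (simp add: vertex_bases_def)
  finally show ?thesis
    unfolding signed_count_polarized[OF reg pt gen] by (simp add: power_add[symmetric])
qed

text \<open>
A basis that survives in \<open>signed_count_polarized\<close> has positive reduced costs on \<open>J - \<sigma>\<close>
and nonpositive ones on the rest of \<open>S\<close>, so all terms of \<open>sum_reduced_cost\<close> are nonpositive. If the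
inequality failed at some cost for all \<open>\<sigma>\<close>, it would fail at a nearby generic cost.
\<close>

lemma signed_count_separation:
  fixes \<Phi> :: "'n::finite \<Rightarrow> 'f::euclidean_space"
  assumes reg: "regular \<Phi> u" and pt: "pointed \<Phi>" and nz: "signed_count \<Phi> u S J \<noteq> 0"
    and neg: "\<And>i. i \<in> S \<Longrightarrow> i \<in> J \<Longrightarrow> x i \<le> 0" and nonneg: "\<And>i. i \<in> S \<Longrightarrow> i \<notin> J \<Longrightarrow> 0 \<le> x i"
  shows "\<exists>\<sigma>\<in>vertex_bases \<Phi> u. (\<Sum>i\<in>S. c i * x i) \<le> basic_cost \<Phi> c \<sigma> (\<Sum>i\<in>S. x i *\<^sub>R \<Phi> i)"
proof (rule ccontr)
  assume contra: "\<not> ?thesis"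
  let ?v = "\<Sum>i\<in>S. x i *\<^sub>R \<Phi> i"
  let ?H = "\<lambda>\<sigma>. {c :: real ^ 'n. basic_cost \<Phi> (($) c) \<sigma> ?v < (\<Sum>i\<in>S. c $ i * x i)}"
  let ?U = "\<Inter>\<sigma>\<in>vertex_bases \<Phi> u. ?H \<sigma>"
  have "open ?U"
    by (intro open_INT ballI) (auto simp: basic_cost_def intro!: open_Collect_less continuous_intros)
  moreover have "(\<chi> i. c i) \<in> ?U" using contra by (auto simp: not_le basic_cost_def)
  ultimately obtain c' where c': "c' \<in> ?U" "generic_cost \<Phi> (($) c')"
    using generic_cost_dense[of ?U \<Phi>] by blast
  obtain \<sigma> where \<sigma>: "\<sigma> \<in> vertex_bases \<Phi> u"
    "J \<union> \<sigma> = S \<inter> (\<sigma> \<union> {i. 0 < reduced_cost \<Phi> (($) c') \<sigma> i})"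
  proof -
    have "\<exists>\<sigma>\<in>vertex_bases \<Phi> u. J \<union> \<sigma> = S \<inter> (\<sigma> \<union> {i. 0 < reduced_cost \<Phi> (($) c') \<sigma> i})"
    proof (rule ccontr)
      assume "\<not> ?thesis"
      then have "signed_count \<Phi> u S J = 0"
        unfolding signed_count_polarized[OF reg pt c'(2)] by simp
      with nz show False by simp
    qed
    then show thesis using that by blast
  qed
  have b: "ibasis \<Phi> \<sigma>" using \<sigma> by (simp add: vertex_bases_def)
  have "x i * reduced_cost \<Phi> (($) c') \<sigma> i \<le> 0" if i: "i \<in> S" for i
  proof -
    consider "i \<in> \<sigma>" | "i \<notin> \<sigma>" "i \<in> J" | "i \<notin> \<sigma>" "i \<notin> J" by blast
    then show ?thesis
    proof cases
      case 1
      then show ?thesis by (simp add: reduced_cost_basic[OF b])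
    next
      case 2
      then have "0 < reduced_cost \<Phi> (($) c') \<sigma> i" using \<sigma>(2) by blast
      then show ?thesis using neg[OF i] 2 by (simp add: mult_nonpos_nonneg)
    next
      case 3
      then have "\<not> 0 < reduced_cost \<Phi> (($) c') \<sigma> i" using \<sigma>(2) i by blast
      then show ?thesis using nonneg[OF i] 3 by (simp add: mult_nonneg_nonpos)
    qed
  qed
  then have "(\<Sum>i\<in>S. x i * reduced_cost \<Phi> (($) c') \<sigma> i) \<le> 0" by (intro sum_nonpos)
  then have "(\<Sum>i\<in>S. c' $ i * x i) \<le> basic_cost \<Phi> (($) c') \<sigma> ?v" by (simp add: sum_reduced_cost)
  then show False using c'(1) \<sigma>(1) by fastforce
qed

text \<open>
The linear form \<open>- x j\<close> is positive at \<open>x\<close> and nonpositive at all basic solutions for the same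
vector, contrary to \<open>signed_count_separation\<close>.
\<close>

lemma signed_count_eq_0:
  fixes \<Phi> :: "'n::finite \<Rightarrow> 'f::euclidean_space"
  assumes reg: "regular \<Phi> u" and pt: "pointed \<Phi>" 
    and neg: "\<And>i. i \<in> J \<Longrightarrow> x i \<le> 0" and nonneg: "\<And>i. i \<notin> J \<Longrightarrow> 0 \<le> x i"
    and j: "x j < 0"
    and v: "\<And>\<sigma> k. \<sigma> \<in> vertex_bases \<Phi> u \<Longrightarrow> k \<in> \<sigma> \<Longrightarrow> 0 \<le> dual \<Phi> \<sigma> k \<bullet> (\<Sum>i\<in>UNIV. x i *\<^sub>R \<Phi> i)"
  shows "signed_count \<Phi> u UNIV J = 0"
proof (rule ccontr)
  assume "signed_count \<Phi> u UNIV J \<noteq> 0"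
  then obtain \<sigma> where \<sigma>: "\<sigma> \<in> vertex_bases \<Phi> u" "(\<Sum>i\<in>UNIV. - of_bool (i = j) * x i)
      \<le> basic_cost \<Phi> (\<lambda>i. - of_bool (i = j)) \<sigma> (\<Sum>i\<in>UNIV. x i *\<^sub>R \<Phi> i)"
    using signed_count_separation[OF reg pt, of UNIV J x "\<lambda>i. - of_bool (i = j)"] neg nonneg by auto
  have "basic_cost \<Phi> (\<lambda>i. - of_bool (i = j)) \<sigma> (\<Sum>i\<in>UNIV. x i *\<^sub>R \<Phi> i) \<le> 0"
    unfolding basic_cost_def using v[OF \<sigma>(1)] by (intro sum_nonpos) auto
  moreover have "(\<Sum>i\<in>UNIV. - of_bool (i = j) * x i) = - x j" by (simp add: sum_negf)
  ultimately show False using \<sigma>(2) j by linarith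
qed

text \<open>
Apply \<open>signed_count_separation\<close> to the two costs \<open>x i\<close> and \<open>- x i\<close>.
\<close>

lemma signed_count_bounded:
  fixes \<Phi> :: "'n::finite \<Rightarrow> 'f::euclidean_space"
  assumes reg: "regular \<Phi> u" and pt: "pointed \<Phi>"
  shows "\<exists>C\<ge>0. \<forall>S J x. signed_count \<Phi> u S J \<noteq> 0 \<longrightarrow>
    (\<forall>i\<in>S. if i \<in> J then x i \<le> 0 else 0 \<le> x i) \<longrightarrow>
    (\<forall>i\<in>S. \<bar>x i\<bar> \<le> C * norm (\<Sum>i\<in>S. x i *\<^sub>R \<Phi> i))"
proof -
  define C where "C = (\<Sum>\<sigma>\<in>UNIV. \<Sum>k\<in>UNIV. norm (dual \<Phi> \<sigma> k))"
  have Cge: "norm (dual \<Phi> \<sigma> k) \<le> C" for \<sigma> k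
  proof -
    have "norm (dual \<Phi> \<sigma> k) \<le> (\<Sum>k\<in>UNIV. norm (dual \<Phi> \<sigma> k))" by (rule member_le_sum) auto
    also have "\<dots> \<le> C" unfolding C_def by (rule member_le_sum) (auto intro: sum_nonneg)
    finally show ?thesis .
  qed
  have C0: "0 \<le> C" unfolding C_def by (intro sum_nonneg) auto
  have "\<bar>x i\<bar> \<le> C * norm (\<Sum>i\<in>S. x i *\<^sub>R \<Phi> i)" if nz: "signed_count \<Phi> u S J \<noteq> 0"
    and neg: "\<And>i. i \<in> S \<Longrightarrow> i \<in> J \<Longrightarrow> x i \<le> 0" and nonneg: "\<And>i. i \<in> S \<Longrightarrow> i \<notin> J \<Longrightarrow> 0 \<le> x i"
    and i: "i \<in> S" for S J and x :: "'n \<Rightarrow> real" and i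
  proof -
    let ?v = "\<Sum>i\<in>S. x i *\<^sub>R \<Phi> i"
    have "s * x i \<le> C * norm ?v" if s: "\<bar>s\<bar> = 1" for s
    proof -
      obtain \<sigma> where \<sigma>: "(\<Sum>k\<in>S. (s * of_bool (k = i)) * x k) \<le> basic_cost \<Phi> (\<lambda>k. s * of_bool (k = i)) \<sigma> ?v"
        using signed_count_separation[OF reg pt nz, of x "\<lambda>k. s * of_bool (k = i)"] neg nonneg by blast
      have "(\<Sum>k\<in>S. (s * of_bool (k = i)) * x k) = (\<Sum>k\<in>S. if k = i then s * x i else 0)"
        by (intro sum.cong) auto
      also have "\<dots> = s * x i" using i by simp
      finally have "s * x i \<le> basic_cost \<Phi> (\<lambda>k. s * of_bool (k = i)) \<sigma> ?v" using \<sigma> by simp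
      also have "\<dots> = (\<Sum>k\<in>\<sigma>. if k = i then s * (dual \<Phi> \<sigma> i \<bullet> ?v) else 0)"
        unfolding basic_cost_def by (intro sum.cong) auto
      also have "\<dots> \<le> \<bar>dual \<Phi> \<sigma> i \<bullet> ?v\<bar>"
        using s abs_ge_self[of "s * (dual \<Phi> \<sigma> i \<bullet> ?v)"] by (auto simp: abs_mult)
      also have "\<dots> \<le> norm (dual \<Phi> \<sigma> i) * norm ?v" by (rule Cauchy_Schwarz_ineq2)
      also have "\<dots> \<le> C * norm ?v" using Cge by (intro mult_right_mono) auto
      finally show ?thesis .
    qed
    from this[of 1] this[of "-1"] show ?thesis by simp
  qed
  with C0 show ?thesis by (intro exI[of _ C] conjI allI impI ballI) (auto split: if_splits)
qed

text \<open>
This recursion is what makes differences of the integrals and sums simpler than the functions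
themselves.
\<close>

lemma signed_count_delete:
  fixes \<Phi> :: "'n::finite \<Rightarrow> 'f::euclidean_space"
  assumes "j \<in> S" "j \<notin> J"
  shows "signed_count \<Phi> u S J = signed_count \<Phi> u S (insert j J) + signed_count \<Phi> u (S - {j}) J"
proof -
  have "{I. J \<subseteq> I \<and> I \<subseteq> S \<and> u \<in> gen_cone \<Phi> I}
      = {I. insert j J \<subseteq> I \<and> I \<subseteq> S \<and> u \<in> gen_cone \<Phi> I}
        \<union> {I. J \<subseteq> I \<and> I \<subseteq> S - {j} \<and> u \<in> gen_cone \<Phi> I}" using assms by auto
  then have "(\<Sum>I | J \<subseteq> I \<and> I \<subseteq> S \<and> u \<in> gen_cone \<Phi> I. (-1) ^ card I :: real)
      = (\<Sum>I | insert j J \<subseteq> I \<and> I \<subseteq> S \<and> u \<in> gen_cone \<Phi> I. (-1) ^ card I)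
        + (\<Sum>I | J \<subseteq> I \<and> I \<subseteq> S - {j} \<and> u \<in> gen_cone \<Phi> I. (-1) ^ card I)"
    by (simp only:) (rule sum.union_disjoint, auto)
  then show ?thesis by (simp add: signed_count_def distrib_left)
qed

lemma signed_count_nonspanning:
  assumes "regular \<Phi> u" "span (\<Phi> ` S) \<noteq> UNIV"
  shows "signed_count \<Phi> u S J = 0"
proof -
  have "u \<notin> gen_cone \<Phi> I" if "I \<subseteq> S" for I
  proof
    assume "u \<in> gen_cone \<Phi> I"
    then have "u \<in> span (\<Phi> ` S)"
      using gen_cone_mono[OF that, of \<Phi>] gen_cone_subset_span[of \<Phi> S] by blast
    then show False using assms by (simp add: regular_def)
  qed
  then have "{I. J \<subseteq> I \<and> I \<subseteq> S \<and> u \<in> gen_cone \<Phi> I} = {}" by blast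
  then show ?thesis by (simp only: signed_count_def sum.empty mult_zero_right)
qed

section \<open>Topes and walls\<close>

text \<open>
A nonnegative relation in which \<open>\<Phi> j\<close> occurs puts \<open>- \<Phi> j\<close>, and with it the line through
\<open>\<Phi> j\<close>, into the cone.
\<close>

lemma pointed_of_salient:
  fixes \<Phi> :: "'n::finite \<Rightarrow> 'f::euclidean_space"
  assumes nz: "\<And>i. \<Phi> i \<noteq> 0" and sal: "salient (gen_cone \<Phi> UNIV)"
  shows "pointed \<Phi>"
  unfolding pointed_def
proof (intro allI impI, rule ccontr)
  fix w :: "'n \<Rightarrow> real" and j
  assume w: "\<forall>i. 0 \<le> w i" "(\<Sum>i\<in>UNIV. w i *\<^sub>R \<Phi> i) = 0" and "w j \<noteq> 0"
  then have wj: "0 < w j" by (metis less_eq_real_def)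
  have "0 + t *\<^sub>R \<Phi> j \<in> gen_cone \<Phi> UNIV" for t
  proof -
    define s where "s i = \<bar>t\<bar> / w j * w i + t * of_bool (i = j)" for i
    have "(\<Sum>i\<in>UNIV. s i *\<^sub>R \<Phi> i)
        = (\<bar>t\<bar> / w j) *\<^sub>R (\<Sum>i\<in>UNIV. w i *\<^sub>R \<Phi> i) + (\<Sum>i\<in>UNIV. (t * of_bool (i = j)) *\<^sub>R \<Phi> i)"
      unfolding s_def scaleR_add_left sum.distrib by (simp add: scaleR_sum_right)
    also have "(\<Sum>i\<in>UNIV. (t * of_bool (i = j)) *\<^sub>R \<Phi> i) = (\<Sum>i\<in>UNIV. if i = j then t *\<^sub>R \<Phi> j else 0)"
      by (intro sum.cong) auto
    finally have "(\<Sum>i\<in>UNIV. s i *\<^sub>R \<Phi> i) = 0 + t *\<^sub>R \<Phi> j" using w(2) by simp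
    moreover have "0 \<le> s i" for i using w(1) wj by (cases "i = j") (auto simp: s_def)
    ultimately show ?thesis by (metis sum_in_gen_cone)
  qed
  then show False using sal nz[of j] unfolding salient_def by blast
qed

lemma wall_hyperplane:
  fixes \<Phi> :: "'n::finite \<Rightarrow> 'f::euclidean_space"
  assumes "wall \<Phi> H" obtains a where "a \<noteq> 0" "H = {x. a \<bullet> x = 0}"
proof -
  obtain B where B: "independent B" "card B = DIM('f) - 1" "H = span B"
    using assms by (auto simp: wall_def)
  have d: "dim B = DIM('f) - 1" using B dim_eq_card_independent by metis
  then have "dim B < DIM('f)" using DIM_positive[where 'a = 'f] by linarith
  then obtain a where a: "a \<noteq> 0" "span B \<subseteq> {x. a \<bullet> x = 0}"
    using lowdim_subset_hyperplane[of B] by blast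
  have "span B = {x. a \<bullet> x = 0}"
    using a d by (intro subspace_dim_equal) (auto simp: subspace_hyperplane dim_hyperplane)
  with a(1) B(3) that show thesis by blast
qed

lemma hyperplane_wall:
  fixes \<Phi> :: "'n::finite \<Rightarrow> 'f::euclidean_space"
  assumes "a \<noteq> 0" "{x. a \<bullet> x = 0} = span (\<Phi> ` I)"
  shows "wall \<Phi> {x. a \<bullet> x = 0}"
proof -
  obtain B where B: "B \<subseteq> \<Phi> ` I" "independent B" "\<Phi> ` I \<subseteq> span B" "card B = dim (\<Phi> ` I)"
    using basis_exists[of "\<Phi> ` I"] by blast
  have "span B = span (\<Phi> ` I)" using B by (meson span_eq span_superset subset_trans)
  moreover have "card B = DIM('f) - 1"
    using B(4) assms dim_span[of "\<Phi> ` I"] dim_hyperplane[OF assms(1)] by simp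
  ultimately show ?thesis unfolding wall_def using B assms(2) by blast
qed

lemma extend_to_wall:
  fixes \<Phi> :: "'n::finite \<Rightarrow> 'f::euclidean_space"
  assumes gen: "span (range \<Phi>) = UNIV" and I: "span (\<Phi> ` I) \<noteq> UNIV"
  obtains H where "wall \<Phi> H" "span (\<Phi> ` I) \<subseteq> H"
proof -
  obtain B where B: "B \<subseteq> \<Phi> ` I" "independent B" "\<Phi> ` I \<subseteq> span B" "card B = dim (\<Phi> ` I)"
    using basis_exists[of "\<Phi> ` I"] by blast
  have sp: "span B = span (\<Phi> ` I)" using B by (meson span_eq span_superset subset_trans)
  obtain D where D: "B \<subseteq> D" "D \<subseteq> range \<Phi>" "independent D" "range \<Phi> \<subseteq> span D"
    using maximal_independent_subset_extend[of B "range \<Phi>"] B by blast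
  have "span D = UNIV" using D(4) gen by (metis span_mono span_span top.extremum_uniqueI)
  then have cD: "card D = DIM('f)" using basis_card_eq_dim[of D UNIV] D(3) by auto
  have fin: "finite D" by (rule finite_subset[OF D(2)]) simp
  have "dim (\<Phi> ` I) < DIM('f)"
    using I dim_eq_full[of "\<Phi> ` I"] dim_subset_UNIV[of "\<Phi> ` I"] by linarith
  then have "card B \<le> DIM('f) - 1" "DIM('f) - 1 \<le> card D" using B(4) cD by auto
  then obtain E where E: "B \<subseteq> E" "E \<subseteq> D" "card E = DIM('f) - 1"
    using exists_subset_between[of B "DIM('f) - 1" D] D(1) fin by blast
  have "wall \<Phi> (span E)"
    unfolding wall_def using E D by (metis independent_mono subset_trans)
  moreover have "span (\<Phi> ` I) \<subseteq> span E" using sp E(1) span_mono by metis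
  ultimately show thesis using that by blast
qed

lemma regular_off_walls:
  assumes "span (range \<Phi>) = UNIV" "\<And>H. wall \<Phi> H \<Longrightarrow> u \<notin> H"
  shows "regular \<Phi> u"
  unfolding regular_def using extend_to_wall[OF assms(1)] assms(2) by (metis subsetD)

text \<open>
If the span were smaller, then even together with a vector off \<open>H\<close> it would be contained in a wall,
a second one through \<open>u\<close>.
\<close>

lemma on_single_wall:
  fixes \<Phi> :: "'n::finite \<Rightarrow> 'f::euclidean_space"
  assumes gen: "span (range \<Phi>) = UNIV" and H: "wall \<Phi> H"
    and only: "\<And>H'. wall \<Phi> H' \<Longrightarrow> u \<in> H' \<Longrightarrow> H' = H" and u: "u \<in> span (\<Phi> ` I)"
  shows "span (\<Phi> ` I) = UNIV \<or> span (\<Phi> ` I) = H"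
proof (rule ccontr)
  assume contra: "\<not> ?thesis"
  obtain a where a: "a \<noteq> 0" "H = {x. a \<bullet> x = 0}" by (rule wall_hyperplane[OF H])
  obtain H' where "wall \<Phi> H'" "span (\<Phi> ` I) \<subseteq> H'" using extend_to_wall[OF gen] contra by metis
  then have sub: "span (\<Phi> ` I) \<subseteq> H" using only u by blast
  have "dim (\<Phi> ` I) < DIM('f) - 1"
  proof (rule ccontr)
    assume "\<not> ?thesis"
    then have "span (\<Phi> ` I) = H"
      unfolding a(2) by (intro subspace_dim_equal)
        (use sub a in \<open>auto simp: subspace_hyperplane dim_hyperplane\<close>)
    with contra show False by simp
  qed
  obtain i where i: "\<Phi> i \<notin> H"
  proof -
    have "\<not> range \<Phi> \<subseteq> H"
    proof
      assume "range \<Phi> \<subseteq> H"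
      then have "span (range \<Phi>) \<subseteq> H" unfolding a(2) by (intro span_minimal subspace_hyperplane)
      then have "a \<in> H" using gen by blast
      then show False using a by simp
    qed
    then show thesis using that by blast
  qed
  have "dim (\<Phi> ` insert i I) < DIM('f)"
    using \<open>dim (\<Phi> ` I) < DIM('f) - 1\<close> by (simp add: dim_insert) linarith
  then have "span (\<Phi> ` insert i I) \<noteq> UNIV" using dim_eq_full[of "\<Phi> ` insert i I"] by simp
  then obtain H'' where H'': "wall \<Phi> H''" "span (\<Phi> ` insert i I) \<subseteq> H''"
    by (rule extend_to_wall[OF gen])
  have "u \<in> H''" using u H''(2) span_mono[of "\<Phi> ` I" "\<Phi> ` insert i I"] by blast
  then have "H'' = H" using only H''(1) by blast
  moreover have "\<Phi> i \<in> H''" using H''(2) span_base[of "\<Phi> i" "\<Phi> ` insert i I"] by blast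
  ultimately show False using i by simp
qed

text \<open>
The vector \<open>v\<close> lies strictly on the same side as \<open>u\<close> of each hyperplane spanned by members of
\<open>\<Phi>\<close>, unless \<open>u\<close> lies on that hyperplane. This holds for \<open>v\<close> in a tope and \<open>u\<close> in its closure,
and like \<open>regular\<close> it is unaffected by sign changes of the vectors.
\<close>

definition refines_signs :: "('n::finite \<Rightarrow> 'f::euclidean_space) \<Rightarrow> 'f \<Rightarrow> 'f \<Rightarrow> bool" where
  "refines_signs \<Phi> u v \<longleftrightarrow> (\<forall>I a. a \<noteq> 0 \<longrightarrow> {x. a \<bullet> x = 0} = span (\<Phi> ` I) \<longrightarrow> 0 < a \<bullet> u \<longrightarrow> 0 < a \<bullet> v)"

lemma refines_signs_dual_pos:
  assumes "refines_signs \<Phi> u v" "ibasis \<Phi> \<sigma>" "k \<in> \<sigma>" "0 < dual \<Phi> \<sigma> k \<bullet> u"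
  shows "0 < dual \<Phi> \<sigma> k \<bullet> v"
  using assms span_facet[OF assms(2,3)] dual_nonzero[OF assms(2,3)] unfolding refines_signs_def by metis

lemma refines_signs_dual_nonneg:
  assumes "refines_signs \<Phi> u v" "ibasis \<Phi> \<sigma>" "k \<in> \<sigma>" "0 < dual \<Phi> \<sigma> k \<bullet> v"
  shows "0 \<le> dual \<Phi> \<sigma> k \<bullet> u"
proof (rule ccontr)
  let ?a = "- dual \<Phi> \<sigma> k"
  assume "\<not> ?thesis"
  then have "0 < ?a \<bullet> u" by simp
  moreover have "{x. ?a \<bullet> x = 0} = span (\<Phi> ` (\<sigma> - {k}))" using span_facet[OF assms(2,3)] by simp
  moreover have "?a \<noteq> 0" using dual_nonzero[OF assms(2,3)] by simp
  ultimately have "0 < ?a \<bullet> v" using assms(1) unfolding refines_signs_def by metis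
  then show False using assms(4) by simp
qed

lemma tope_subset: "tope \<Phi> \<tau> \<Longrightarrow> wall \<Phi> H \<Longrightarrow> \<tau> \<inter> H = {}"
  unfolding tope_def using in_components_subset by blast

lemma tope_nonempty: "tope \<Phi> \<tau> \<Longrightarrow> \<tau> \<noteq> {}"
  unfolding tope_def using in_components_nonempty by blast

lemma tope_regular:
  assumes "span (range \<Phi>) = UNIV" "tope \<Phi> \<tau>" "u \<in> \<tau>" shows "regular \<Phi> u"
  using regular_off_walls[OF assms(1)] tope_subset[OF assms(2)] assms(3) by blast

lemma finite_walls: "finite {H. wall \<Phi> H}"
proof -
  have "{H. wall \<Phi> H} \<subseteq> span ` Pow (range \<Phi>)" by (auto simp: wall_def)
  then show ?thesis by (rule finite_subset) simp
qed

lemma tope_open: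
  assumes "tope \<Phi> \<tau>" shows "open \<tau>"
proof -
  have "closed H" if "wall \<Phi> H" for H
    using wall_hyperplane[OF that] closed_hyperplane by metis
  then have "open (- \<Union>{H. wall \<Phi> H})" using finite_walls by (intro open_Compl closed_Union) auto
  then show ?thesis using assms open_components unfolding tope_def by blast
qed

lemma tope_closure_sign:
  assumes t: "tope \<Phi> \<tau>" and w: "wall \<Phi> {x. a \<bullet> x = 0}"
    and u: "u \<in> closure \<tau>" "0 < a \<bullet> u" and v: "v \<in> \<tau>"
  shows "0 < a \<bullet> v"
proof (rule ccontr)
  assume "\<not> 0 < a \<bullet> v"
  have "u \<in> {x. 0 < a \<bullet> x} \<inter> closure \<tau>" using u by simp
  then obtain u' where u': "u' \<in> \<tau>" "0 < a \<bullet> u'"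
    using open_Int_closure_eq_empty[of "{x. 0 < a \<bullet> x}" \<tau>] open_halfspace_gt[of 0 a] by blast
  have "connected \<tau>" using t in_components_connected unfolding tope_def by blast
  then obtain z where "z \<in> \<tau>" "a \<bullet> z = 0"
    using connected_ivt_hyperplane[of \<tau> v u' a 0] v u' \<open>\<not> 0 < a \<bullet> v\<close> by auto
  then show False using tope_subset[OF t w] by blast
qed

lemma tope_closure_refines_signs:
  assumes "tope \<Phi> \<tau>" "u \<in> closure \<tau>" "v \<in> \<tau>" shows "refines_signs \<Phi> u v"
  unfolding refines_signs_def using tope_closure_sign[OF assms(1)] hyperplane_wall assms(2,3) by metis

text \<open>
No wall meets the segment from \<open>u\<close> to \<open>v\<close>.
\<close>

lemma same_signs_same_tope:
  assumes t: "tope \<Phi> \<tau>" and u: "u \<in> \<tau>"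
    and v: "\<And>a. a \<noteq> 0 \<Longrightarrow> wall \<Phi> {x. a \<bullet> x = 0} \<Longrightarrow> 0 < a \<bullet> u \<Longrightarrow> 0 < a \<bullet> v"
  shows "v \<in> \<tau>"
proof -
  have "closed_segment u v \<subseteq> - \<Union>{H. wall \<Phi> H}"
  proof
    fix y assume y: "y \<in> closed_segment u v"
    have "y \<notin> H" if H: "wall \<Phi> H" for H
    proof
      assume yH: "y \<in> H"
      obtain a where a: "a \<noteq> 0" "H = {x. a \<bullet> x = 0}" by (rule wall_hyperplane[OF H])
      have "a \<bullet> u \<noteq> 0" using tope_subset[OF t H] u a by auto
      define b where "b = (if a \<bullet> u > 0 then a else - a)"
      have b: "b \<noteq> 0" "H = {x. b \<bullet> x = 0}" "0 < b \<bullet> u"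
        using a \<open>a \<bullet> u \<noteq> 0\<close> by (auto simp: b_def)
      have bv: "0 < b \<bullet> v" using v[OF b(1) _ b(3)] H b(2) by simp
      obtain s where s: "0 \<le> s" "s \<le> 1" "y = (1 - s) *\<^sub>R u + s *\<^sub>R v"
        using y by (auto simp: in_segment)
      have "b \<bullet> y = (1 - s) * (b \<bullet> u) + s * (b \<bullet> v)" by (simp add: s(3) inner_add_right)
      moreover have "0 < (1 - s) * (b \<bullet> u) + s * (b \<bullet> v)"
      proof (cases "s = 1")
        case False
        then have "0 < (1 - s) * (b \<bullet> u)" using s b(3) by simp
        moreover have "0 \<le> s * (b \<bullet> v)" using s bv by simp
        ultimately show ?thesis by linarith
      qed (use bv in simp)
      ultimately show False using yH b(2) by simp
    qed
    then show "y \<in> - \<Union>{H. wall \<Phi> H}" by blast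
  qed
  then have "closed_segment u v \<subseteq> \<tau>"
    using components_maximal[of \<tau> "- \<Union>{H. wall \<Phi> H}" "closed_segment u v"] t u
    unfolding tope_def by auto
  then show ?thesis by auto
qed

lemma refines_signs_cone:
  assumes "regular \<Phi> u" "ibasis \<Phi> \<sigma>" "u \<in> gen_cone \<Phi> \<sigma>" "refines_signs \<Phi> u v"
  shows "v \<in> gen_cone \<Phi> \<sigma>"
  unfolding ibasis_gen_cone_iff[OF assms(2)]
  using refines_signs_dual_pos[OF assms(4,2)] regular_dual_pos[OF assms(1-3)] less_imp_le by blast

text \<open>
A basis whose cone contains one vector of the tope has a cone containing the whole tope, because no
coordinate changes its sign on the tope.
\<close>

lemma generating_sets_eq:
  assumes gen: "span (range \<Phi>) = UNIV" and t: "tope \<Phi> \<tau>" and u: "u \<in> \<tau>"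
  shows "generating_sets \<Phi> \<tau> = {I. u \<in> gen_cone \<Phi> I}"
proof
  show "generating_sets \<Phi> \<tau> \<subseteq> {I. u \<in> gen_cone \<Phi> I}" using u by (auto simp: generating_sets_def)
  show "{I. u \<in> gen_cone \<Phi> I} \<subseteq> generating_sets \<Phi> \<tau>"
  proof
    fix I assume "I \<in> {I. u \<in> gen_cone \<Phi> I}"
    then have I: "u \<in> gen_cone \<Phi> I" by simp
    have reg: "regular \<Phi> u" by (rule tope_regular[OF gen t u])
    obtain \<sigma> where \<sigma>: "\<sigma> \<subseteq> I" "ibasis \<Phi> \<sigma>" "u \<in> gen_cone \<Phi> \<sigma>" by (rule regular_caratheodory[OF reg I])
    have "refines_signs \<Phi> u v" if "v \<in> \<tau>" for v
      using tope_closure_refines_signs[OF t _ that] u closure_subset by blast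
    then have "\<tau> \<subseteq> gen_cone \<Phi> \<sigma>" using refines_signs_cone[OF reg \<sigma>(2,3)] by blast
    then have "\<tau> \<subseteq> gen_cone \<Phi> I" using gen_cone_mono[OF \<sigma>(1)] by blast
    moreover have "span (\<Phi> ` I) = UNIV"
      using reg I gen_cone_subset_span unfolding regular_def by blast
    ultimately show "I \<in> generating_sets \<Phi> \<tau>" by (simp add: generating_sets_def)
  qed
qed

lemma XX_eq_signed_count:
  fixes \<Phi> :: "'n::finite \<Rightarrow> 'f::euclidean_space"
  assumes gen: "span (range \<Phi>) = UNIV" and t: "tope \<Phi> \<tau>" and u: "u \<in> \<tau>"
  shows "XX \<Phi> \<tau> x = signed_count \<Phi> u UNIV {i. x $ i < 0}"
proof -
  have sign: "(-1) ^ (card I - DIM('f)) = ((-1) ^ DIM('f) * (-1) ^ card I :: real)"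
    if I: "u \<in> gen_cone \<Phi> I" for I
  proof -
    obtain \<sigma> where \<sigma>: "\<sigma> \<subseteq> I" "ibasis \<Phi> \<sigma>"
      by (rule regular_caratheodory[OF tope_regular[OF gen t u] I])
    then have "DIM('f) \<le> card I" using card_mono[OF _ \<sigma>(1)] ibasis_card[OF \<sigma>(2)] by simp
    then obtain m where "card I = DIM('f) + m" using le_Suc_ex by blast
    then show ?thesis by (simp add: power_add power_mult_distrib[symmetric] mult.assoc[symmetric])
  qed
  have prod: "(\<Prod>i\<in>-I. of_bool (0 \<le> x $ i)) = (of_bool ({i. x $ i < 0} \<subseteq> I) :: real)" for I
  proof -
    have "{i. x $ i < 0} \<subseteq> I \<longleftrightarrow> (\<forall>i\<in>-I. 0 \<le> x $ i)" by (auto simp: not_less[symmetric])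
    then show ?thesis by (auto simp: prod_zero_iff)
  qed
  have "XX \<Phi> \<tau> x = (\<Sum>I | u \<in> gen_cone \<Phi> I.
      (-1) ^ DIM('f) * ((-1) ^ card I * of_bool ({i. x $ i < 0} \<subseteq> I)))"
    unfolding XX_def generating_sets_eq[OF gen t u] prod by (rule sum.cong[OF refl]) (use sign in simp)
  also have "\<dots> = (-1) ^ DIM('f) * (\<Sum>I | u \<in> gen_cone \<Phi> I. (-1) ^ card I * of_bool ({i. x $ i < 0} \<subseteq> I))"
    by (rule sum_distrib_left[symmetric])
  also have "(\<Sum>I | u \<in> gen_cone \<Phi> I. (-1) ^ card I * of_bool ({i. x $ i < 0} \<subseteq> I))
      = (\<Sum>I | {i. x $ i < 0} \<subseteq> I \<and> I \<subseteq> UNIV \<and> u \<in> gen_cone \<Phi> I. (-1) ^ card I :: real)"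
    by (intro sum.mono_neutral_cong_right) auto
  finally show ?thesis by (simp add: signed_count_def)
qed

lemma signed_count_value:
  fixes \<Phi> :: "'n::finite \<Rightarrow> 'f::euclidean_space"
  assumes reg: "regular \<Phi> u" and pt: "pointed \<Phi>" and u: "u = (\<Sum>i\<in>UNIV. x i *\<^sub>R \<Phi> i)"
  shows "signed_count \<Phi> u UNIV {i. x i < 0} = of_bool (\<forall>i. 0 \<le> x i)"
proof (cases "\<forall>i. 0 \<le> x i")
  case True
  then have "{i. x i < 0} = {}" by (auto simp: not_less)
  moreover have "u \<in> gen_cone \<Phi> UNIV" unfolding u using True by (intro sum_in_gen_cone) auto
  ultimately show ?thesis using signed_count_cone[OF reg pt] True by simp
next
  case False
  then obtain j where "x j < 0" by (auto simp: not_le)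
  then have "signed_count \<Phi> u UNIV {i. x i < 0} = 0"
    using regular_dual_pos[OF reg]
    by (intro signed_count_eq_0[OF reg pt, of _ x j])
       (auto simp: vertex_bases_def u[symmetric] intro: less_imp_le)
  with False show ?thesis by simp
qed

text \<open>
On the closure of the tope the coordinates with respect to the relevant bases remain nonnegative,
so a point with a negative coordinate can be separated as in \<open>signed_count_eq_0\<close>.
\<close>

lemma XX_on_closure:
  fixes \<Phi> :: "'n::finite \<Rightarrow> 'f::euclidean_space"
  assumes gen: "span (range \<Phi>) = UNIV" and pt: "pointed \<Phi>" and t: "tope \<Phi> \<tau>"
    and cone: "\<tau> \<subseteq> gen_cone \<Phi> UNIV" and \<nu>: "\<nu> \<in> closure \<tau>" and x: "x \<in> fiber \<Phi> \<nu>"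
  shows "XX \<Phi> \<tau> x = of_bool (\<forall>i. 0 \<le> x $ i)"
proof -
  obtain u where u: "u \<in> \<tau>" using tope_nonempty[OF t] by blast
  have reg: "regular \<Phi> u" by (rule tope_regular[OF gen t u])
  show ?thesis
  proof (cases "\<forall>i. 0 \<le> x $ i")
    case True
    then have "{i. x $ i < 0} = {}" by (auto simp: not_less)
    then show ?thesis using XX_eq_signed_count[OF gen t u] signed_count_cone[OF reg pt] cone u True by auto
  next
    case False
    then obtain j where "x $ j < 0" by (auto simp: not_le)
    moreover have "0 \<le> dual \<Phi> \<sigma> k \<bullet> \<nu>" if "\<sigma> \<in> vertex_bases \<Phi> u" "k \<in> \<sigma>" for \<sigma> k
      using that refines_signs_dual_nonneg[OF tope_closure_refines_signs[OF t \<nu> u]] regular_dual_pos[OF reg]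
      by (auto simp: vertex_bases_def)
    ultimately have "signed_count \<Phi> u UNIV {i. x $ i < 0} = 0"
      using x by (intro signed_count_eq_0[OF reg pt, of _ "($) x" j]) (auto simp: fiber_def)
    with False show ?thesis using XX_eq_signed_count[OF gen t u] by simp
  qed
qed

text \<open>
Adding coefficients from \<open>[0, 1]\<close> to an integral point does not change its signs in the weak sense,
as a negative integer is at most \<open>- 1\<close>. So \<open>x\<close> can be moved to the fibre over the vector \<open>u\<close> of
the tope.
\<close>

lemma XX_on_zonotope_shift:
  fixes \<Phi> :: "'n::finite \<Rightarrow> 'f::euclidean_space"
  assumes gen: "span (range \<Phi>) = UNIV" and pt: "pointed \<Phi>" and t: "tope \<Phi> \<tau>"
    and cone: "\<tau> \<subseteq> gen_cone \<Phi> UNIV" and u: "u \<in> \<tau>" and v: "v \<in> zonotope \<Phi>"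
    and x: "x \<in> fiber \<Phi> (u - v)" "x \<in> integer_points"
  shows "XX \<Phi> \<tau> x = of_bool (\<forall>i. 0 \<le> x $ i)"
proof (cases "\<forall>i. 0 \<le> x $ i")
  case True
  then have "{i. x $ i < 0} = {}" by (auto simp: not_less)
  moreover have "regular \<Phi> u" by (rule tope_regular[OF gen t u])
  ultimately show ?thesis using XX_eq_signed_count[OF gen t u] signed_count_cone[OF _ pt] cone u True by auto
next
  case False
  then obtain j where j: "x $ j < 0" by (auto simp: not_le)
  obtain s where s: "\<forall>i. 0 \<le> s i \<and> s i \<le> 1" "v = (\<Sum>i\<in>UNIV. s i *\<^sub>R \<Phi> i)"
    using v by (auto simp: zonotope_def)
  have le: "x $ i \<le> - 1" if "x $ i < 0" for i
  proof -
    obtain m where "x $ i = of_int m" using x(2) by (auto simp: integer_points_def Ints_def)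
    with that show ?thesis by simp
  qed
  (* Coordinates below 0 may become 0 after the shift; a small step against \<Phi> j, which stays
     inside the open tope, makes coordinate j strictly negative again. *)
  have "((\<lambda>e. u - e *\<^sub>R \<Phi> j) \<longlongrightarrow> u - 0 *\<^sub>R \<Phi> j) (at_right 0)" by (intro tendsto_intros)
  then have "\<forall>\<^sub>F e in at_right 0. u - e *\<^sub>R \<Phi> j \<in> \<tau>"
    using tope_open[OF t] u by (intro topological_tendstoD) auto
  then have "\<forall>\<^sub>F e in at_right (0::real). u - e *\<^sub>R \<Phi> j \<in> \<tau> \<and> 0 < e"
    by (intro eventually_conj eventually_at_right_less)
  then obtain e where e: "u - e *\<^sub>R \<Phi> j \<in> \<tau>" "0 < e"
    using eventually_happens trivial_limit_at_right_real by blast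
  define y where "y i = x $ i + s i - e * of_bool (i = j)" for i
  let ?u = "u - e *\<^sub>R \<Phi> j"
  have reg: "regular \<Phi> ?u" by (rule tope_regular[OF gen t e(1)])
  have "(\<Sum>i\<in>UNIV. y i *\<^sub>R \<Phi> i) = (\<Sum>i\<in>UNIV. x $ i *\<^sub>R \<Phi> i) + v - (\<Sum>i\<in>UNIV. (e * of_bool (i = j)) *\<^sub>R \<Phi> i)"
    by (simp add: y_def s(2) scaleR_add_left scaleR_diff_left sum.distrib sum_subtractf)
  also have "(\<Sum>i\<in>UNIV. (e * of_bool (i = j)) *\<^sub>R \<Phi> i) = (\<Sum>i\<in>UNIV. if i = j then e *\<^sub>R \<Phi> j else 0)"
    by (intro sum.cong) auto
  finally have ysum: "(\<Sum>i\<in>UNIV. y i *\<^sub>R \<Phi> i) = ?u" using x(1) by (simp add: fiber_def)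
  have "signed_count \<Phi> ?u UNIV {i. x $ i < 0} = 0"
  proof (rule signed_count_eq_0[OF reg pt, of _ y j])
    fix i assume "i \<in> {i. x $ i < 0}"
    then have "x $ i \<le> -1" "s i \<le> 1" "0 \<le> e * of_bool (i = j)" using le s e by auto
    then show "y i \<le> 0" unfolding y_def by linarith
  next
    fix i assume "i \<notin> {i. x $ i < 0}"
    then show "0 \<le> y i" using s j by (auto simp: y_def)
  next
    show "y j < 0" using le[OF j] s(1)[THEN spec, of j] e(2) by (simp add: y_def)
  next
    fix \<sigma> k assume "\<sigma> \<in> vertex_bases \<Phi> ?u" "k \<in> \<sigma>"
    then show "0 \<le> dual \<Phi> \<sigma> k \<bullet> (\<Sum>i\<in>UNIV. y i *\<^sub>R \<Phi> i)"
      unfolding ysum using regular_dual_pos[OF reg] by (auto simp: vertex_bases_def less_imp_le)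
  qed
  with False show ?thesis using XX_eq_signed_count[OF gen t e(1)] by simp
qed

section \<open>Crossing a wall\<close>

text \<open>
Here \<open>u0\<close> lies on the single wall \<open>{x. a \<bullet> x = 0}\<close>. If \<open>u0\<close> is in the cone of \<open>I\<close> but not in that
of the vectors of \<open>I\<close> on the wall, it is an interior point of the former. If it is in the latter, it
is a relatively interior point of it, and the nearby vector \<open>v\<close> is in the cone of \<open>I\<close> exactly if \<open>I\<close>
has a vector on the side of \<open>v\<close>.
\<close>

lemma refines_signs_cone_iff:
  fixes \<Phi> :: "'n::finite \<Rightarrow> 'f::euclidean_space"
  defines "K \<equiv> \<lambda>a. {i. a \<bullet> \<Phi> i = 0}"
  assumes a: "a \<noteq> 0" "a \<bullet> u0 = 0"
    and only: "\<And>I. u0 \<in> span (\<Phi> ` I) \<Longrightarrow> span (\<Phi> ` I) = UNIV \<or> span (\<Phi> ` I) = {x. a \<bullet> x = 0}"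
    and reg: "regular \<Phi> v" and near: "refines_signs \<Phi> u0 v" and av: "0 < a \<bullet> v"
  shows "v \<in> gen_cone \<Phi> I \<longleftrightarrow>
    (u0 \<in> gen_cone \<Phi> I \<and> u0 \<notin> gen_cone \<Phi> (I \<inter> K a)) \<or>
    (u0 \<in> gen_cone \<Phi> (I \<inter> K a) \<and> (\<exists>i\<in>I. 0 < a \<bullet> \<Phi> i))"
proof
  assume v: "v \<in> gen_cone \<Phi> I"
  obtain \<sigma> where \<sigma>: "\<sigma> \<subseteq> I" "ibasis \<Phi> \<sigma>" "v \<in> gen_cone \<Phi> \<sigma>" by (rule regular_caratheodory[OF reg v])
  have "u0 \<in> gen_cone \<Phi> \<sigma>"
    unfolding ibasis_gen_cone_iff[OF \<sigma>(2)]
    using refines_signs_dual_nonneg[OF near \<sigma>(2)] regular_dual_pos[OF reg \<sigma>(2,3)] by blast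
  then have u0: "u0 \<in> gen_cone \<Phi> I" using gen_cone_mono[OF \<sigma>(1)] by blast
  have "\<exists>i\<in>I. 0 < a \<bullet> \<Phi> i"
  proof (rule ccontr)
    assume none: "\<not> ?thesis"
    obtain t where t: "\<forall>i\<in>I. 0 \<le> t i" "v = (\<Sum>i\<in>I. t i *\<^sub>R \<Phi> i)" using v by (auto simp: gen_cone_def)
    have "a \<bullet> v = (\<Sum>i\<in>I. t i * (a \<bullet> \<Phi> i))" by (simp add: t(2) inner_sum_right)
    also have "\<dots> \<le> 0" using t(1) none by (intro sum_nonpos mult_nonneg_nonpos) (auto simp: not_less)
    finally show False using av by simp
  qed
  then show "(u0 \<in> gen_cone \<Phi> I \<and> u0 \<notin> gen_cone \<Phi> (I \<inter> K a)) \<or>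
    (u0 \<in> gen_cone \<Phi> (I \<inter> K a) \<and> (\<exists>i\<in>I. 0 < a \<bullet> \<Phi> i))" using u0 by blast
next
  have in_cone: "v \<in> gen_cone \<Phi> I" if "\<sigma> \<subseteq> I" "ibasis \<Phi> \<sigma>" "\<And>k. k \<in> \<sigma> \<Longrightarrow> 0 < dual \<Phi> \<sigma> k \<bullet> v" for \<sigma>
    using that gen_cone_mono[OF that(1), of \<Phi>] ibasis_gen_cone_iff[OF that(2)] less_imp_le by blast
  assume "(u0 \<in> gen_cone \<Phi> I \<and> u0 \<notin> gen_cone \<Phi> (I \<inter> K a)) \<or>
    (u0 \<in> gen_cone \<Phi> (I \<inter> K a) \<and> (\<exists>i\<in>I. 0 < a \<bullet> \<Phi> i))"
  then show "v \<in> gen_cone \<Phi> I"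
  proof (elim disjE conjE)
    assume u0: "u0 \<in> gen_cone \<Phi> I" "u0 \<notin> gen_cone \<Phi> (I \<inter> K a)"
    obtain \<sigma> t where \<sigma>: "\<sigma> \<subseteq> I" "inj_on \<Phi> \<sigma>" "independent (\<Phi> ` \<sigma>)"
      "\<And>k. k \<in> \<sigma> \<Longrightarrow> t k > (0::real)" "u0 = (\<Sum>k\<in>\<sigma>. t k *\<^sub>R \<Phi> k)"
      by (rule gen_cone_caratheodory[OF u0(1)]) blast
    have c: "u0 \<in> gen_cone \<Phi> \<sigma>" unfolding \<sigma>(5) by (intro sum_in_gen_cone less_imp_le \<sigma>(4))
    have "span (\<Phi> ` \<sigma>) \<noteq> {x. a \<bullet> x = 0}"
    proof
      assume "span (\<Phi> ` \<sigma>) = {x. a \<bullet> x = 0}"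
      then have "a \<bullet> \<Phi> k = 0" if "k \<in> \<sigma>" for k using that span_base[of "\<Phi> k" "\<Phi> ` \<sigma>"] by auto
      then have "\<sigma> \<subseteq> I \<inter> K a" using \<sigma>(1) by (auto simp: K_def)
      then show False using gen_cone_mono[of \<sigma> "I \<inter> K a" \<Phi>] c u0(2) by blast
    qed
    then have "span (\<Phi> ` \<sigma>) = UNIV" using only[of \<sigma>] c gen_cone_subset_span[of \<Phi> \<sigma>] by blast
    then have b: "ibasis \<Phi> \<sigma>" using \<sigma> by (simp add: ibasis_def)
    show ?thesis
    proof (rule in_cone[OF \<sigma>(1) b])
      fix k assume k: "k \<in> \<sigma>"
      have "0 < dual \<Phi> \<sigma> k \<bullet> u0" unfolding \<sigma>(5) dual_combination[OF b k] by (rule \<sigma>(4)[OF k])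
      then show "0 < dual \<Phi> \<sigma> k \<bullet> v" by (rule refines_signs_dual_pos[OF near b k])
    qed
  next
    assume u0: "u0 \<in> gen_cone \<Phi> (I \<inter> K a)" and "\<exists>i\<in>I. 0 < a \<bullet> \<Phi> i"
    then obtain i where i: "i \<in> I" "0 < a \<bullet> \<Phi> i" by blast
    obtain \<rho> t where \<rho>: "\<rho> \<subseteq> I \<inter> K a" "inj_on \<Phi> \<rho>" "independent (\<Phi> ` \<rho>)"
      "\<And>k. k \<in> \<rho> \<Longrightarrow> t k > (0::real)" "u0 = (\<Sum>k\<in>\<rho>. t k *\<^sub>R \<Phi> k)"
      by (rule gen_cone_caratheodory[OF u0]) blast
    have c: "u0 \<in> gen_cone \<Phi> \<rho>" unfolding \<rho>(5) by (intro sum_in_gen_cone less_imp_le \<rho>(4))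
    have sub: "span (\<Phi> ` \<rho>) \<subseteq> {x. a \<bullet> x = 0}"
      using \<rho>(1) by (intro span_minimal subspace_hyperplane) (auto simp: K_def)
    have "a \<notin> {x. a \<bullet> x = 0}" using a by simp
    then have sp: "span (\<Phi> ` \<rho>) = {x. a \<bullet> x = 0}"
      using only[of \<rho>] c gen_cone_subset_span[of \<Phi> \<rho>] sub by blast
    have i_out: "\<Phi> i \<notin> span (\<Phi> ` \<rho>)" using i(2) sp by simp
    have ni: "i \<notin> \<rho>" using i_out span_base[of "\<Phi> i" "\<Phi> ` \<rho>"] by blast
    let ?\<sigma> = "insert i \<rho>"
    have "dim (\<Phi> ` \<rho>) = DIM('f) - 1" using sp dim_span[of "\<Phi> ` \<rho>"] dim_hyperplane[OF a(1)] by simp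
    then have "dim (\<Phi> ` ?\<sigma>) = DIM('f)"
      using i_out DIM_positive[where 'a = 'f] by (simp add: dim_insert)
    then have "span (\<Phi> ` ?\<sigma>) = UNIV" by (simp only: dim_eq_full)
    moreover have "inj_on \<Phi> ?\<sigma>" using \<rho>(2) i_out span_base[of "\<Phi> i" "\<Phi> ` \<rho>"] ni by auto
    moreover have "independent (\<Phi> ` ?\<sigma>)" using independent_insertI[OF i_out \<rho>(3)] by simp
    ultimately have b: "ibasis \<Phi> ?\<sigma>" by (simp add: ibasis_def)
    have a_eq: "a \<bullet> x = (dual \<Phi> ?\<sigma> i \<bullet> x) * (a \<bullet> \<Phi> i)" for x
    proof -
      have "a \<bullet> x = (\<Sum>k\<in>?\<sigma>. (dual \<Phi> ?\<sigma> k \<bullet> x) * (a \<bullet> \<Phi> k))"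
        by (subst dual_expansion[OF b, of x, symmetric]) (simp only: inner_sum_right inner_scaleR_right)
      also have "\<dots> = (dual \<Phi> ?\<sigma> i \<bullet> x) * (a \<bullet> \<Phi> i) + (\<Sum>k\<in>\<rho>. (dual \<Phi> ?\<sigma> k \<bullet> x) * (a \<bullet> \<Phi> k))"
        using ni by simp
      also have "(\<Sum>k\<in>\<rho>. (dual \<Phi> ?\<sigma> k \<bullet> x) * (a \<bullet> \<Phi> k)) = 0"
        using \<rho>(1) by (intro sum.neutral) (auto simp: K_def)
      finally show ?thesis by simp
    qed
    show ?thesis
    proof (rule in_cone[OF _ b])
      show "?\<sigma> \<subseteq> I" using i \<rho> by blast
    next
      fix k assume k: "k \<in> ?\<sigma>"
      show "0 < dual \<Phi> ?\<sigma> k \<bullet> v"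
      proof (cases "k = i")
        case True
        then show ?thesis using a_eq[of v] av i(2) by (simp add: zero_less_mult_iff)
      next
        case False
        then have k\<rho>: "k \<in> \<rho>" using k by blast
        have "u0 = (\<Sum>j\<in>?\<sigma>. (if j = i then 0 else t j) *\<^sub>R \<Phi> j)"
          using ni unfolding \<rho>(5) by (auto intro!: sum.cong)
        then have "dual \<Phi> ?\<sigma> k \<bullet> u0 = t k" using dual_combination[OF b k] False by simp
        then show ?thesis using refines_signs_dual_pos[OF near b k] \<rho>(4)[OF k\<rho>] by simp
      qed
    qed
  qed
qed

lemma split_signed_sum:
  fixes f g :: "'n::finite set \<Rightarrow> real"
  shows "(\<Sum>I | J \<subseteq> I. f (I \<inter> K) * g (I - K) * (-1) ^ card I)
    = (\<Sum>I | J \<inter> K \<subseteq> I \<and> I \<subseteq> K. f I * (-1) ^ card I) * (\<Sum>I | J - K \<subseteq> I \<and> I \<subseteq> -K. g I * (-1) ^ card I)"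
proof -
  have "(\<Sum>I | J \<subseteq> I. f (I \<inter> K) * g (I - K) * (-1) ^ card I)
    = (\<Sum>p\<in>{I. J \<inter> K \<subseteq> I \<and> I \<subseteq> K} \<times> {I. J - K \<subseteq> I \<and> I \<subseteq> -K}.
        (f (fst p) * (-1) ^ card (fst p)) * (g (snd p) * (-1) ^ card (snd p)))"
  proof (rule sum.reindex_bij_witness[of _ "\<lambda>p. fst p \<union> snd p" "\<lambda>I. (I \<inter> K, I - K)"])
    fix I
    have "card I = card (I \<inter> K) + card (I - K)"
      using card_Un_disjoint[of "I \<inter> K" "I - K"] by (simp add: Int_Diff_Un Int_Diff_disjoint)
    then show "(f (fst (I \<inter> K, I - K)) * (-1) ^ card (fst (I \<inter> K, I - K)))
        * (g (snd (I \<inter> K, I - K)) * (-1) ^ card (snd (I \<inter> K, I - K)))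
      = f (I \<inter> K) * g (I - K) * (-1) ^ card I"
      by (simp add: power_add)
  qed (auto, blast)
  also have "\<dots> = (\<Sum>I | J \<inter> K \<subseteq> I \<and> I \<subseteq> K. f I * (-1) ^ card I)
      * (\<Sum>I | J - K \<subseteq> I \<and> I \<subseteq> -K. g I * (-1) ^ card I)"
    by (simp add: sum_product sum.cartesian_product split_beta)
  finally show ?thesis .
qed

lemma signed_count_UNIV:
  "signed_count \<Phi> u UNIV J
     = (-1) ^ DIM('f) * (\<Sum>I | J \<subseteq> I. of_bool (u \<in> gen_cone \<Phi> I) * (-1) ^ card I)"
  for \<Phi> :: "'n::finite \<Rightarrow> 'f::euclidean_space"
  unfolding signed_count_def
  by (rule arg_cong[where f = "\<lambda>s. _ * s"], rule sum.mono_neutral_cong_left) auto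

text \<open>
Reversing the vectors of \<open>A\<close> and the corresponding coordinates does not move the point that the
coordinates represent. It turns the negativity conditions of \<open>flipped_polytope\<close> into positivity.
\<close>

definition flip :: "'n set \<Rightarrow> ('n \<Rightarrow> 'f::real_vector) \<Rightarrow> 'n \<Rightarrow> 'f" where
  "flip A \<Phi> i = (if i \<in> A then - \<Phi> i else \<Phi> i)"

lemma span_flip: "span (flip A \<Phi> ` I) = span (\<Phi> ` I)"
proof -
  have "span (flip A \<Psi> ` I) \<subseteq> span (\<Psi> ` I)" for \<Psi> :: "'b \<Rightarrow> 'a"
    by (rule span_minimal) (auto simp: flip_def intro: span_neg span_base)
  moreover have "flip A (flip A \<Phi>) = \<Phi>" by (auto simp: flip_def)
  ultimately show ?thesis by (metis subset_antisym)
qed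

text \<open>
Let \<open>K\<close> index the vectors on the wall and \<open>B\<close> those on the side of \<open>u2\<close>. By \<open>refines_signs_cone_iff\<close> the
counts at \<open>u1\<close> and \<open>u2\<close> differ by \<open>Y\<close>, a count inside the wall, times an alternating sum that
vanishes unless the negative coordinates off the wall are exactly \<open>A\<close> or exactly \<open>B\<close>. In the second
case \<open>a \<bullet> u2\<close> would be nonnegative. In the first case, reversing the vectors of \<open>A\<close> puts the whole
family on the side of \<open>u2\<close>; the count of the reversed family at \<open>u2\<close> is \<open>- Y\<close> by
\<open>refines_signs_cone_iff\<close>, and it is known from \<open>signed_count_value\<close>.
\<close>

lemma wall_crossing:
  fixes \<Phi> :: "'n::finite \<Rightarrow> 'f::euclidean_space"
  assumes pt: "pointed \<Phi>" and a: "a \<noteq> 0" "a \<bullet> u0 = 0"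
    and only: "\<And>I. u0 \<in> span (\<Phi> ` I) \<Longrightarrow> span (\<Phi> ` I) = UNIV \<or> span (\<Phi> ` I) = {x. a \<bullet> x = 0}"
    and u1: "regular \<Phi> u1" "refines_signs \<Phi> u0 u1" "0 < a \<bullet> u1"
    and u2: "regular \<Phi> u2" "refines_signs \<Phi> u0 u2" "a \<bullet> u2 < 0"
    and A: "A = {i. 0 < a \<bullet> \<Phi> i}" "A \<noteq> {}"
    and x: "(\<Sum>i\<in>UNIV. x i *\<^sub>R \<Phi> i) = u2"
  shows "signed_count \<Phi> u1 UNIV {i. x i < 0} = of_bool (\<forall>i. 0 \<le> x i)
     - (-1) ^ card A * of_bool ((\<forall>i\<in>A. x i < 0) \<and> (\<forall>i. i \<notin> A \<longrightarrow> 0 \<le> x i))"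
proof -
  define J where "J = {i. x i < 0}"
  define K where "K = {i. a \<bullet> \<Phi> i = 0}"
  define B where "B = {i. a \<bullet> \<Phi> i < 0}"
  define Y where "Y = (\<Sum>I | J \<inter> K \<subseteq> I \<and> I \<subseteq> K. of_bool (u0 \<in> gen_cone \<Phi> I) * (-1) ^ card I :: real)"
  have only': "u0 \<in> span (\<Phi> ` I) \<Longrightarrow> span (\<Phi> ` I) = UNIV \<or> span (\<Phi> ` I) = {x. (- a) \<bullet> x = 0}" for I
    using only[of I] by simp
  have iff1: "u1 \<in> gen_cone \<Phi> I \<longleftrightarrow> (u0 \<in> gen_cone \<Phi> I \<and> u0 \<notin> gen_cone \<Phi> (I \<inter> K)) \<or>
      (u0 \<in> gen_cone \<Phi> (I \<inter> K) \<and> \<not> I - K \<subseteq> B)" for I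
  proof -
    have "(\<exists>i\<in>I. 0 < a \<bullet> \<Phi> i) \<longleftrightarrow> \<not> I - K \<subseteq> B" by (force simp: K_def B_def not_less less_le)
    then show ?thesis using refines_signs_cone_iff[OF a only u1, of I] by (simp add: K_def)
  qed
  have iff2: "u2 \<in> gen_cone \<Phi> I \<longleftrightarrow> (u0 \<in> gen_cone \<Phi> I \<and> u0 \<notin> gen_cone \<Phi> (I \<inter> K)) \<or>
      (u0 \<in> gen_cone \<Phi> (I \<inter> K) \<and> \<not> I - K \<subseteq> A)" for I
  proof -
    have "(\<exists>i\<in>I. 0 < (- a) \<bullet> \<Phi> i) \<longleftrightarrow> \<not> I - K \<subseteq> A" by (force simp: K_def A not_less less_le)
    moreover have "{i. (- a) \<bullet> \<Phi> i = 0} = K" by (simp add: K_def)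
    ultimately show ?thesis using refines_signs_cone_iff[of "- a", OF _ _ only' u2(1,2), of I] a u2(3) by simp
  qed
  have sub: "A \<subseteq> - K" "B \<subseteq> - K" "A \<inter> B = {}" by (auto simp: A K_def B_def)
  have diff: "of_bool (u1 \<in> gen_cone \<Phi> I) - of_bool (u2 \<in> gen_cone \<Phi> I)
      = (of_bool (u0 \<in> gen_cone \<Phi> (I \<inter> K)) * (of_bool (I - K \<subseteq> A) - of_bool (I - K \<subseteq> B)) :: real)" for I
    unfolding iff1 iff2 using gen_cone_mono[of "I \<inter> K" I \<Phi>] by auto
  have alt: "(\<Sum>I | J - K \<subseteq> I \<and> I \<subseteq> -K. of_bool (I \<subseteq> C) * (-1) ^ card I)
      = (if J - K = C then (-1) ^ card C else (0::real))" if "C \<subseteq> - K" for C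
  proof -
    have "(\<Sum>I | J - K \<subseteq> I \<and> I \<subseteq> -K. of_bool (I \<subseteq> C) * (-1) ^ card I)
        = (\<Sum>I | J - K \<subseteq> I \<and> I \<subseteq> C. (-1) ^ card I :: real)"
      using that by (intro sum.mono_neutral_cong_right) auto
    then show ?thesis by (simp only: alternating_sum_interval finite)
  qed
  have "signed_count \<Phi> u1 UNIV J - signed_count \<Phi> u2 UNIV J = (-1) ^ DIM('f) *
      (\<Sum>I | J \<subseteq> I. of_bool (u0 \<in> gen_cone \<Phi> (I \<inter> K)) * (of_bool (I - K \<subseteq> A) - of_bool (I - K \<subseteq> B)) * (-1) ^ card I)"
    unfolding signed_count_UNIV right_diff_distrib[symmetric] sum_subtractf[symmetric]
      left_diff_distrib[symmetric] diff ..
  also have "\<dots> = (-1) ^ DIM('f) * (Y * (\<Sum>I | J - K \<subseteq> I \<and> I \<subseteq> -K.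
      (of_bool (I \<subseteq> A) - of_bool (I \<subseteq> B)) * (-1) ^ card I))"
    unfolding Y_def split_signed_sum[of "\<lambda>I. of_bool (u0 \<in> gen_cone \<Phi> I)" K
      "\<lambda>I. of_bool (I \<subseteq> A) - of_bool (I \<subseteq> B)" J] ..
  also have "\<dots> = (-1) ^ DIM('f) * Y * ((if J - K = A then (-1) ^ card A else 0)
      - (if J - K = B then (-1) ^ card B else 0))"
    by (simp only: left_diff_distrib sum_subtractf alt[OF sub(1)] alt[OF sub(2)] mult.assoc)
  finally have crossing: "signed_count \<Phi> u1 UNIV J - signed_count \<Phi> u2 UNIV J = (-1) ^ DIM('f) * Y *
      ((if J - K = A then (-1) ^ card A else 0) - (if J - K = B then (-1) ^ card B else 0))" .
  have value2: "signed_count \<Phi> u2 UNIV J = of_bool (\<forall>i. 0 \<le> x i)"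
    unfolding J_def by (rule signed_count_value[OF u2(1) pt x[symmetric]])
  (* Otherwise every term of a \<bullet> u2, expanded in the coordinates x, would be nonnegative. *)
  have notB: "J - K \<noteq> B"
  proof
    assume eq: "J - K = B"
    have "0 \<le> x i * (a \<bullet> \<Phi> i)" for i
    proof -
      consider "a \<bullet> \<Phi> i = 0" | "a \<bullet> \<Phi> i < 0" | "a \<bullet> \<Phi> i > 0" by linarith
      then show ?thesis
      proof cases
        case 2
        then have "x i < 0" using eq by (auto simp: B_def J_def)
        then show ?thesis using 2 by (simp add: mult_nonpos_nonpos)
      next
        case 3
        have "i \<notin> J - K" unfolding eq using 3 by (simp add: B_def)
        then have "\<not> x i < 0" using 3 by (simp add: J_def K_def)
        then show ?thesis using 3 by simp
      qed simp
    qed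
    then have "0 \<le> (\<Sum>i\<in>UNIV. x i * (a \<bullet> \<Phi> i))" by (intro sum_nonneg) auto
    also have "\<dots> = a \<bullet> u2" by (simp add: x[symmetric] inner_sum_right)
    finally show False using u2(3) by simp
  qed
  show ?thesis
  proof (cases "J - K = A")
    case False
    then have "\<not> ((\<forall>i\<in>A. x i < 0) \<and> (\<forall>i. i \<notin> A \<longrightarrow> 0 \<le> x i))"
      using sub by (force simp: J_def)
    then show ?thesis using crossing value2 notB False by (simp add: J_def)
  next
    case True
    let ?\<Psi> = "flip A \<Phi>" and ?y = "flip A x"
    have ysum: "(\<Sum>i\<in>UNIV. ?y i *\<^sub>R ?\<Psi> i) = u2"
      unfolding x[symmetric] by (intro sum.cong) (auto simp: flip_def)
    have \<Psi>neg: "a \<bullet> ?\<Psi> i \<le> 0" "a \<bullet> ?\<Psi> i = 0 \<longleftrightarrow> i \<in> K" for i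
      by (auto simp: flip_def A K_def)
    have pt\<Psi>: "pointed ?\<Psi>"
      unfolding pointed_def
    proof (intro allI impI)
      fix w i assume w: "\<forall>i. 0 \<le> w i" "(\<Sum>i\<in>UNIV. w i *\<^sub>R ?\<Psi> i) = 0"
      have "(\<Sum>i\<in>UNIV. - (w i * (a \<bullet> ?\<Psi> i))) = - (a \<bullet> (\<Sum>i\<in>UNIV. w i *\<^sub>R ?\<Psi> i))"
        by (simp add: inner_sum_right sum_negf)
      then have "(\<Sum>i\<in>UNIV. - (w i * (a \<bullet> ?\<Psi> i))) = 0" using w(2) by simp
      moreover have "0 \<le> - (w i * (a \<bullet> ?\<Psi> i))" for i
        using w(1) \<Psi>neg(1)[of i] by (simp add: mult_nonneg_nonpos)
      ultimately have "\<forall>i. w i * (a \<bullet> ?\<Psi> i) = 0"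
        using sum_nonneg_eq_0_iff[of UNIV "\<lambda>i. - (w i * (a \<bullet> ?\<Psi> i))"] by simp
      then have w0: "w i = 0" if "i \<notin> K" for i using \<Psi>neg(2)[of i] that by (metis mult_eq_0_iff)
      have "(\<Sum>i\<in>UNIV. w i *\<^sub>R \<Phi> i) = (\<Sum>i\<in>UNIV. w i *\<^sub>R ?\<Psi> i)"
        using w0 sub by (intro sum.cong) (auto simp: flip_def)
      then show "w i = 0" using pt w by (simp add: pointed_def)
    qed
    have reg\<Psi>: "regular ?\<Psi> u2" using u2(1) by (simp add: regular_def span_flip)
    have near\<Psi>: "refines_signs ?\<Psi> u0 u2" using u2(2) by (simp add: refines_signs_def span_flip)
    have cong: "gen_cone ?\<Psi> I = gen_cone \<Phi> I" if "I \<subseteq> K" for I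
    proof -
      have "(\<Sum>i\<in>I. t i *\<^sub>R ?\<Psi> i) = (\<Sum>i\<in>I. t i *\<^sub>R \<Phi> i)" for t
        using that sub by (intro sum.cong) (auto simp: flip_def)
      then show ?thesis by (simp add: gen_cone_def)
    qed
    have only\<Psi>: "u0 \<in> span (?\<Psi> ` I) \<Longrightarrow> span (?\<Psi> ` I) = UNIV \<or> span (?\<Psi> ` I) = {x. (- a) \<bullet> x = 0}" for I
      unfolding span_flip by (rule only')
    (* The reversed family lies on one side of the wall, so only its members on the wall can
       contribute to u0. *)
    have face: "u0 \<in> gen_cone ?\<Psi> (I \<inter> K)" if u0I: "u0 \<in> gen_cone ?\<Psi> I" for I
    proof -
      obtain t where t: "\<forall>i\<in>I. 0 \<le> t i" "u0 = (\<Sum>i\<in>I. t i *\<^sub>R ?\<Psi> i)" using u0I by (auto simp: gen_cone_def)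
      have "(\<Sum>i\<in>I. - (t i * (a \<bullet> ?\<Psi> i))) = - (a \<bullet> u0)" by (simp add: t(2) inner_sum_right sum_negf)
      moreover have "0 \<le> - (t i * (a \<bullet> ?\<Psi> i))" if "i \<in> I" for i
        using t(1) that \<Psi>neg(1)[of i] by (simp add: mult_nonneg_nonpos)
      ultimately have "\<forall>i\<in>I. t i * (a \<bullet> ?\<Psi> i) = 0"
        using sum_nonneg_eq_0_iff[of I "\<lambda>i. - (t i * (a \<bullet> ?\<Psi> i))"] a(2) by simp
      then have "t i = 0" if "i \<in> I" "i \<notin> K" for i using \<Psi>neg(2)[of i] that by (metis mult_eq_0_iff)
      then have "u0 = (\<Sum>i\<in>I \<inter> K. t i *\<^sub>R ?\<Psi> i)"
        unfolding t(2) by (intro sum.mono_neutral_right) auto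
      then show ?thesis using t(1) sum_in_gen_cone[of "I \<inter> K" t ?\<Psi>] by simp
    qed
    have iff\<Psi>: "u2 \<in> gen_cone ?\<Psi> I \<longleftrightarrow> u0 \<in> gen_cone \<Phi> (I \<inter> K) \<and> I - K \<noteq> {}" for I
    proof -
      have "(\<exists>i\<in>I. 0 < (- a) \<bullet> ?\<Psi> i) \<longleftrightarrow> I - K \<noteq> {}" using \<Psi>neg by (force simp: less_le)
      moreover have "{i. (- a) \<bullet> ?\<Psi> i = 0} = K" using \<Psi>neg(2) by auto
      ultimately show ?thesis
        using refines_signs_cone_iff[of "- a", OF _ _ only\<Psi> reg\<Psi> near\<Psi>, of I] a u2(3) face[of I] cong[of "I \<inter> K"]
        by auto
    qed
    have "of_bool (u2 \<in> gen_cone ?\<Psi> I)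
        = (of_bool (u0 \<in> gen_cone \<Phi> (I \<inter> K)) * (1 - of_bool (I - K = {})) :: real)" for I
      unfolding iff\<Psi> by auto
    then have "signed_count ?\<Psi> u2 UNIV (J \<inter> K) = (-1) ^ DIM('f) *
      (\<Sum>I | J \<inter> K \<subseteq> I. of_bool (u0 \<in> gen_cone \<Phi> (I \<inter> K)) * (1 - of_bool (I - K = {})) * (-1) ^ card I)"
      unfolding signed_count_UNIV by simp
    also have "\<dots> = (-1) ^ DIM('f) * (Y * (\<Sum>I | {} \<subseteq> I \<and> I \<subseteq> -K. (1 - of_bool (I = {})) * (-1) ^ card I))"
    proof -
      have e: "J \<inter> K \<inter> K = J \<inter> K" "J \<inter> K - K = {}" by auto
      show ?thesis
        unfolding Y_def split_signed_sum[of "\<lambda>I. of_bool (u0 \<in> gen_cone \<Phi> I)" K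
          "\<lambda>I. 1 - of_bool (I = {})" "J \<inter> K"] e ..
    qed
    also have "(\<Sum>I | {} \<subseteq> I \<and> I \<subseteq> -K. (1 - of_bool (I = {})) * (-1) ^ card I) = (-1 :: real)"
    proof -
      have "(\<Sum>I | {} \<subseteq> I \<and> I \<subseteq> -K. (1 - of_bool (I = {})) * (-1) ^ card I)
          = (\<Sum>I | {} \<subseteq> I \<and> I \<subseteq> -K. (-1) ^ card I :: real)
            - (\<Sum>I | {} \<subseteq> I \<and> I \<subseteq> -K. of_bool (I = {}) * (-1) ^ card I)"
        by (simp only: left_diff_distrib sum_subtractf mult_1)
      also have "(\<Sum>I | {} \<subseteq> I \<and> I \<subseteq> -K. (-1) ^ card I :: real) = 0"
        using sub A(2) by (subst alternating_sum_interval) auto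
      also have "(\<Sum>I | {} \<subseteq> I \<and> I \<subseteq> -K. of_bool (I = {}) * (-1) ^ card I)
          = (\<Sum>I\<in>{{} :: 'n set}. of_bool (I = {}) * (-1) ^ card I :: real)"
        by (intro sum.mono_neutral_right) auto
      finally show ?thesis by simp
    qed
    finally have flipped: "signed_count ?\<Psi> u2 UNIV (J \<inter> K) = - ((-1) ^ DIM('f) * Y)" by simp
    have neg: "{i. ?y i < 0} = J \<inter> K"
    proof (intro set_eqI iffI)
      fix i assume "i \<in> {i. ?y i < 0}"
      then show "i \<in> J \<inter> K" using True by (auto simp: flip_def J_def split: if_splits)
    next
      fix i assume "i \<in> J \<inter> K"
      then show "i \<in> {i. ?y i < 0}" using sub by (auto simp: flip_def J_def)
    qed
    have "signed_count ?\<Psi> u2 UNIV (J \<inter> K) = of_bool (\<forall>i. 0 \<le> ?y i)"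
      using signed_count_value[OF reg\<Psi> pt\<Psi> ysum[symmetric]] neg by simp
    then have Y: "(-1) ^ DIM('f) * Y = - of_bool (\<forall>i. 0 \<le> ?y i)" using flipped by simp
    have "(\<forall>i. 0 \<le> ?y i) \<longleftrightarrow> J \<inter> K = {}" unfolding neg[symmetric] by (auto simp: not_less)
    also have "\<dots> \<longleftrightarrow> J = A" using True sub by blast
    also have "\<dots> \<longleftrightarrow> (\<forall>i\<in>A. x i < 0) \<and> (\<forall>i. i \<notin> A \<longrightarrow> 0 \<le> x i)"
      by (force simp: J_def)
    finally have Yiff: "(\<forall>i. 0 \<le> ?y i) \<longleftrightarrow> (\<forall>i\<in>A. x i < 0) \<and> (\<forall>i. i \<notin> A \<longrightarrow> 0 \<le> x i)" .
    have "A \<noteq> B" using sub A by blast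
    define p q where "p = (of_bool (\<forall>i. 0 \<le> x i) :: real)"
      and "q = (of_bool ((\<forall>i\<in>A. x i < 0) \<and> (\<forall>i. i \<notin> A \<longrightarrow> 0 \<le> x i)) :: real)"
    have "signed_count \<Phi> u1 UNIV J - p = ((-1) ^ DIM('f) * Y) * (-1) ^ card A"
      using crossing value2 True \<open>A \<noteq> B\<close> by (simp only: p_def simp_thms if_True if_False diff_0_right)
    also have "(-1) ^ DIM('f) * Y = - q" unfolding q_def Y Yiff ..
    finally have "signed_count \<Phi> u1 UNIV J = p - (-1) ^ card A * q" by (simp add: algebra_simps)
    then show ?thesis unfolding p_def q_def J_def .
  qed
qed

lemma same_open_side:
  assumes "{x. a \<bullet> x = 0} = {x. b \<bullet> x = 0}" "0 < a \<bullet> y" "0 < b \<bullet> y" "0 < a \<bullet> z"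
  shows "0 < b \<bullet> (z :: 'f::euclidean_space)"
proof -
  let ?w = "(a \<bullet> z) *\<^sub>R y - (a \<bullet> y) *\<^sub>R z"
  have "a \<bullet> ?w = 0" by (simp add: inner_diff_right)
  then have "b \<bullet> ?w = 0" using assms(1) by blast
  then have "(a \<bullet> z) * (b \<bullet> y) = (a \<bullet> y) * (b \<bullet> z)" by (simp add: inner_diff_right)
  moreover have "0 < (a \<bullet> z) * (b \<bullet> y)" using assms by simp
  ultimately show ?thesis using assms(2) by (simp add: zero_less_mult_iff)
qed

text \<open>
For each wall other than \<open>H\<close> choose a point off it in the intersection of the closures, and let
\<open>u0\<close> be the sum. All these points lie weakly on the same side of each such wall, so the sum is off
all of them.
\<close>

lemma adjacent_topes_witness:
  fixes \<Phi> :: "'n::finite \<Rightarrow> 'f::euclidean_space"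
  assumes gen: "span (range \<Phi>) = UNIV" and adj: "adjacent_topes \<Phi> \<tau>1 \<tau>2 H"
  obtains a u0 where "a \<noteq> 0" "H = {x. a \<bullet> x = 0}" "a \<bullet> u0 = 0"
    "\<And>I. u0 \<in> span (\<Phi> ` I) \<Longrightarrow> span (\<Phi> ` I) = UNIV \<or> span (\<Phi> ` I) = {x. a \<bullet> x = 0}"
    "\<And>v. v \<in> \<tau>1 \<Longrightarrow> refines_signs \<Phi> u0 v \<and> 0 < a \<bullet> v" "\<And>v. v \<in> \<tau>2 \<Longrightarrow> refines_signs \<Phi> u0 v \<and> a \<bullet> v < 0"
proof -
  let ?C = "closure \<tau>1 \<inter> closure \<tau>2"
  have t1: "tope \<Phi> \<tau>1" and t2: "tope \<Phi> \<tau>2" and H: "wall \<Phi> H" and sub: "?C \<subseteq> H" and sp: "span ?C = H"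
    using adj by (auto simp: adjacent_topes_def)
  obtain v1 v2 where v1: "v1 \<in> \<tau>1" and v2: "v2 \<in> \<tau>2" using tope_nonempty t1 t2 by blast
  have closure_nonneg: "0 \<le> b \<bullet> c" if "wall \<Phi> {x. b \<bullet> x = 0}" "tope \<Phi> \<tau>" "v \<in> \<tau>" "0 < b \<bullet> v" "c \<in> closure \<tau>"
    for b c v \<tau>
  proof (rule ccontr)
    assume "\<not> 0 \<le> b \<bullet> c"
    then have "0 < (- b) \<bullet> v"
      using tope_closure_sign[OF that(2), of "- b" c v] that by simp
    with that show False by simp
  qed
  have pick: "\<exists>c\<in>?C. c \<notin> H'" if H': "wall \<Phi> H'" "H' \<noteq> H" for H'
  proof (rule ccontr)
    assume "\<not> ?thesis"
    then have "?C \<subseteq> H'" by blast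
    moreover obtain a' where a': "a' \<noteq> 0" "H' = {x. a' \<bullet> x = 0}" by (rule wall_hyperplane[OF H'(1)])
    ultimately have "H \<subseteq> H'" using sp span_minimal[of ?C H'] subspace_hyperplane[of a'] by blast
    moreover obtain a where a: "a \<noteq> 0" "H = {x. a \<bullet> x = 0}" by (rule wall_hyperplane[OF H])
    ultimately have "H = H'"
      using a' by (intro subspace_dim_equal) (auto simp: subspace_hyperplane dim_hyperplane)
    with H' show False by simp
  qed
  let ?W = "{H'. wall \<Phi> H' \<and> H' \<noteq> H}"
  have finW: "finite ?W" by (rule finite_subset[OF _ finite_walls[of \<Phi>]]) auto
  have "\<forall>H'\<in>?W. \<exists>c. c \<in> ?C \<and> c \<notin> H'" using pick by blast
  then obtain c where "\<forall>H'\<in>?W. c H' \<in> ?C \<and> c H' \<notin> H'" by (rule bchoice[THEN exE])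
  then have c: "\<And>H'. H' \<in> ?W \<Longrightarrow> c H' \<in> ?C \<and> c H' \<notin> H'" by blast
  define u0 where "u0 = sum c ?W"
  have "u0 \<in> span ?C"
    unfolding u0_def by (rule span_sum, rule span_base) (use c in blast)
  then have u0H: "u0 \<in> H" unfolding sp .
  have strict: "0 < b \<bullet> u0" if b: "wall \<Phi> {x. b \<bullet> x = 0}" "{x. b \<bullet> x = 0} \<noteq> H"
    and \<tau>: "\<tau> = \<tau>1 \<or> \<tau> = \<tau>2" "v \<in> \<tau>" "0 < b \<bullet> v" for b v \<tau>
  proof -
    let ?H' = "{x. b \<bullet> x = 0}"
    have mem: "?H' \<in> ?W" using b by simp
    have nn: "0 \<le> b \<bullet> c H'" if "H' \<in> ?W" for H'
      using closure_nonneg[OF b(1), of \<tau> v "c H'"] \<tau> t1 t2 c[OF that] by blast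
    have "b \<bullet> c ?H' \<noteq> 0" using c[OF mem] by simp
    then have "0 < b \<bullet> c ?H'" using nn[OF mem] by simp
    also have "\<dots> \<le> (\<Sum>H'\<in>?W. b \<bullet> c H')" using mem nn finW by (intro member_le_sum) auto
    finally show ?thesis by (simp add: u0_def inner_sum_right)
  qed
  have nearu: "refines_signs \<Phi> u0 v" if \<tau>: "\<tau> = \<tau>1 \<or> \<tau> = \<tau>2" "v \<in> \<tau>" for v \<tau>
    unfolding refines_signs_def
  proof (intro allI impI)
    fix I b assume b: "b \<noteq> 0" "{x. b \<bullet> x = 0} = span (\<Phi> ` I)" "0 < b \<bullet> u0"
    have w: "wall \<Phi> {x. b \<bullet> x = 0}" by (rule hyperplane_wall[OF b(1,2)])
    have ne: "{x. b \<bullet> x = 0} \<noteq> H" using u0H b(3) by auto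
    have "b \<bullet> v \<noteq> 0" using tope_subset[OF _ w, of \<tau>] \<tau> t1 t2 by auto
    moreover have "\<not> 0 < (- b) \<bullet> v" using strict[of "- b" \<tau> v] w ne \<tau> b(3) by auto
    ultimately show "0 < b \<bullet> v" by simp
  qed
  obtain a' where a': "a' \<noteq> 0" "H = {x. a' \<bullet> x = 0}" by (rule wall_hyperplane[OF H])
  define a where "a = (if 0 < a' \<bullet> v1 then a' else - a')"
  have "a' \<bullet> v1 \<noteq> 0" using tope_subset[OF t1 H] v1 a'(2) by blast
  then have a: "a \<noteq> 0" "H = {x. a \<bullet> x = 0}" "0 < a \<bullet> v1" using a' by (auto simp: a_def)
  have Ha: "wall \<Phi> {x. a \<bullet> x = 0}" using H a(2) by simp
  have "H' = H" if H': "wall \<Phi> H'" "u0 \<in> H'" for H'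
  proof (rule ccontr)
    assume ne: "H' \<noteq> H"
    obtain b where b: "b \<noteq> 0" "H' = {x. b \<bullet> x = 0}" by (rule wall_hyperplane[OF H'(1)])
    have "b \<bullet> v1 \<noteq> 0" using tope_subset[OF t1 H'(1)] v1 b by auto
    then consider "0 < b \<bullet> v1" | "0 < (- b) \<bullet> v1" by (auto simp: neq_iff)
    then show False
      using strict[of b \<tau>1 v1] strict[of "- b" \<tau>1 v1] H' b ne v1 by cases auto
  qed
  then have only: "u0 \<in> span (\<Phi> ` I) \<Longrightarrow> span (\<Phi> ` I) = UNIV \<or> span (\<Phi> ` I) = H" for I
    using on_single_wall[OF gen H] by blast
  have pos: "0 < a \<bullet> v" if "v \<in> \<tau>1" for v
    using tope_closure_sign[OF t1 Ha _ a(3) that] v1 closure_subset by blast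
  have neg: "a \<bullet> v < 0" if v: "v \<in> \<tau>2" for v
  proof (rule ccontr)
    assume "\<not> a \<bullet> v < 0"
    moreover have vH: "v \<notin> H" using tope_subset[OF t2 H] v by blast
    ultimately have av: "0 < a \<bullet> v" using a(2) by auto
    have "v \<in> \<tau>1"
    proof (rule same_signs_same_tope[OF t1 v1])
      fix b assume b: "b \<noteq> 0" "wall \<Phi> {x. b \<bullet> x = 0}" "0 < b \<bullet> v1"
      show "0 < b \<bullet> v"
      proof (cases "{x. b \<bullet> x = 0} = H")
        case True
        then show ?thesis using same_open_side[of a b v1 v] a b av by auto
      next
        case False
        then have "0 < b \<bullet> u0" using strict[OF b(2) False _ v1 b(3)] by blast
        moreover have "0 \<le> b \<bullet> v"
        proof (rule ccontr)
          assume "\<not> ?thesis"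
          then have "0 < (- b) \<bullet> u0" using strict[of "- b" \<tau>2 v] b(2) False v by auto
          then show False using \<open>0 < b \<bullet> u0\<close> by simp
        qed
        moreover have "b \<bullet> v \<noteq> 0" using tope_subset[OF t2 b(2)] v by auto
        ultimately show ?thesis by simp
      qed
    qed
    then show False using v vH sub closure_subset by blast
  qed
  show thesis
    using that[OF a(1,2), of u0] a(2) u0H only nearu pos neg by auto
qed

lemma side_indices_eq:
  assumes a: "a \<noteq> 0" "H = {x. a \<bullet> x = 0}" and \<tau>: "\<tau> \<noteq> {}" "\<And>v. v \<in> \<tau> \<Longrightarrow> 0 < a \<bullet> v"
  shows "side_indices \<Phi> H \<tau> = {i. 0 < a \<bullet> \<Phi> i}"
proof (intro set_eqI iffI)
  fix i assume "i \<in> side_indices \<Phi> H \<tau>"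
  then obtain b where b: "H = {x. b \<bullet> x = 0}" "\<tau> \<subseteq> {x. 0 < b \<bullet> x}" "0 < b \<bullet> \<Phi> i"
    by (auto simp: side_indices_def open_side_def)
  obtain v where "v \<in> \<tau>" using \<tau>(1) by blast
  then have "0 < a \<bullet> \<Phi> i" using same_open_side[of b a v "\<Phi> i"] a(2) b \<tau>(2) by auto
  then show "i \<in> {i. 0 < a \<bullet> \<Phi> i}" by simp
next
  fix i assume "i \<in> {i. 0 < a \<bullet> \<Phi> i}"
  then show "i \<in> side_indices \<Phi> H \<tau>"
    unfolding side_indices_def open_side_def using a \<tau>(2)
    by (intro CollectI exI[of _ "{x. a \<bullet> x > 0}"] conjI exI[of _ a]) auto
qed

lemma XX_across_wall:
  fixes \<Phi> :: "'n::finite \<Rightarrow> 'f::euclidean_space"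
  assumes gen: "span (range \<Phi>) = UNIV" and pt: "pointed \<Phi>" and adj: "adjacent_topes \<Phi> \<tau>1 \<tau>2 H"
    and cone: "\<tau>1 \<subseteq> gen_cone \<Phi> UNIV" and A: "A = side_indices \<Phi> H \<tau>1" and \<nu>: "\<nu> \<in> \<tau>2"
  shows "A \<noteq> {} \<and> (\<forall>x\<in>fiber \<Phi> \<nu>. XX \<Phi> \<tau>1 x = of_bool (\<forall>i. 0 \<le> x $ i)
    - (-1) ^ card A * of_bool ((\<forall>i\<in>A. x $ i < 0) \<and> (\<forall>i. i \<notin> A \<longrightarrow> 0 \<le> x $ i)))"
proof -
  have t1: "tope \<Phi> \<tau>1" and t2: "tope \<Phi> \<tau>2" using adj by (auto simp: adjacent_topes_def)
  obtain a u0 where a: "a \<noteq> 0" "H = {x. a \<bullet> x = 0}" "a \<bullet> u0 = 0"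
    "\<And>I. u0 \<in> span (\<Phi> ` I) \<Longrightarrow> span (\<Phi> ` I) = UNIV \<or> span (\<Phi> ` I) = {x. a \<bullet> x = 0}"
    "\<And>v. v \<in> \<tau>1 \<Longrightarrow> refines_signs \<Phi> u0 v \<and> 0 < a \<bullet> v" "\<And>v. v \<in> \<tau>2 \<Longrightarrow> refines_signs \<Phi> u0 v \<and> a \<bullet> v < 0"
    by (rule adjacent_topes_witness[OF gen adj]) blast
  obtain u where u: "u \<in> \<tau>1" using tope_nonempty[OF t1] by blast
  have Aeq: "A = {i. 0 < a \<bullet> \<Phi> i}"
    unfolding A using u a(5) by (intro side_indices_eq a(1,2)) auto
  have "A \<noteq> {}"
  proof
    assume "A = {}"
    then have np: "a \<bullet> \<Phi> i \<le> 0" for i using Aeq by (auto simp: not_less[symmetric])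
    obtain t where t: "\<forall>i. 0 \<le> t i" "u = (\<Sum>i\<in>UNIV. t i *\<^sub>R \<Phi> i)" using cone u by (auto simp: gen_cone_def)
    have "a \<bullet> u = (\<Sum>i\<in>UNIV. t i * (a \<bullet> \<Phi> i))" by (simp add: t(2) inner_sum_right)
    also have "\<dots> \<le> 0" using t(1) np by (intro sum_nonpos mult_nonneg_nonpos) auto
    finally show False using a(5)[OF u] by simp
  qed
  moreover have "XX \<Phi> \<tau>1 x = of_bool (\<forall>i. 0 \<le> x $ i)
      - (-1) ^ card A * of_bool ((\<forall>i\<in>A. x $ i < 0) \<and> (\<forall>i. i \<notin> A \<longrightarrow> 0 \<le> x $ i))"
    if x: "x \<in> fiber \<Phi> \<nu>" for x
    unfolding XX_eq_signed_count[OF gen t1 u]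
    using wall_crossing[OF pt a(1,3,4) tope_regular[OF gen t1 u] _ _ tope_regular[OF gen t2 \<nu>] _ _ Aeq
        calculation, of "($) x"] a(5)[OF u] a(6)[OF \<nu>] x by (simp add: fiber_def)
  ultimately show ?thesis by blast
qed

section \<open>Functions annihilated by iterated differences\<close>

definition shift_diff :: "'v::real_vector \<Rightarrow> ('v \<Rightarrow> real) \<Rightarrow> 'v \<Rightarrow> real" where
  "shift_diff v f = (\<lambda>x. f (x + v) - f x)"

text \<open>
The function is annihilated by any \<open>m\<close> differences with steps in \<open>E\<close>: the behaviour of a
polynomial of degree less than \<open>m\<close>, required in directions from \<open>E\<close> only.
\<close>

fun diff_nilpotent :: "'v::real_vector set \<Rightarrow> nat \<Rightarrow> ('v \<Rightarrow> real) \<Rightarrow> bool" where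
  "diff_nilpotent E 0 f \<longleftrightarrow> (\<forall>x. f x = 0)"
| "diff_nilpotent E (Suc m) f \<longleftrightarrow> (\<forall>v\<in>E. diff_nilpotent E m (shift_diff v f))"

lemma diff_nilpotent_zero: "diff_nilpotent E m (\<lambda>_. 0)"
  by (induction m) (simp_all add: shift_diff_def)

lemma diff_nilpotent_add:
  "diff_nilpotent E m f \<Longrightarrow> diff_nilpotent E m g \<Longrightarrow> diff_nilpotent E m (\<lambda>x. f x + g x)"
proof (induction m arbitrary: f g)
  case (Suc m)
  have "shift_diff v (\<lambda>x. f x + g x) = (\<lambda>x. shift_diff v f x + shift_diff v g x)" for v
    by (auto simp: shift_diff_def)
  then show ?case using Suc by simp
qed simp

lemma diff_nilpotent_translate:
  "diff_nilpotent E m f \<Longrightarrow> diff_nilpotent E m (\<lambda>x. f (x + w))"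
proof (induction m arbitrary: f)
  case (Suc m)
  have "shift_diff v (\<lambda>x. f (x + w)) = (\<lambda>x. shift_diff v f (x + w))" for v
    by (auto simp: shift_diff_def algebra_simps)
  then show ?case using Suc by simp
qed simp

lemma diff_nilpotent_Suc: "diff_nilpotent E m f \<Longrightarrow> diff_nilpotent E (Suc m) f"
proof (induction m arbitrary: f)
  case 0
  then show ?case by (simp add: shift_diff_def)
qed simp

lemma diff_nilpotent_mono: "diff_nilpotent E m f \<Longrightarrow> m \<le> n \<Longrightarrow> diff_nilpotent E n f"
  by (induction n) (auto simp: le_Suc_eq diff_nilpotent_Suc simp del: diff_nilpotent.simps(2))

lemma diff_nilpotent_mult:
  "diff_nilpotent E m f \<Longrightarrow> diff_nilpotent E n g \<Longrightarrow> diff_nilpotent E (m + n) (\<lambda>x. f x * g x)"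
proof (induction "m + n" arbitrary: m n f g rule: less_induct)
  case less
  show ?case
  proof (cases m)
    case 0
    then have "(\<lambda>x. f x * g x) = (\<lambda>_. 0)" using less.prems by auto
    then show ?thesis by (simp add: diff_nilpotent_zero)
  next
    case m: (Suc m')
    show ?thesis
    proof (cases n)
      case 0
      then have "(\<lambda>x. f x * g x) = (\<lambda>_. 0)" using less.prems by auto
      then show ?thesis by (simp add: diff_nilpotent_zero)
    next
      case n: (Suc n')
      have "diff_nilpotent E (m + n') (shift_diff v (\<lambda>x. f x * g x))" if v: "v \<in> E" for v
      proof -
        have "diff_nilpotent E (m' + n) (\<lambda>x. shift_diff v f x * g (x + v))"
          using less.prems v m by (intro less.hyps diff_nilpotent_translate) auto
        moreover have "diff_nilpotent E (m + n') (\<lambda>x. f x * shift_diff v g x)"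
          using less.prems v n by (intro less.hyps) auto
        moreover have "shift_diff v (\<lambda>x. f x * g x)
            = (\<lambda>x. shift_diff v f x * g (x + v) + f x * shift_diff v g x)"
          by (auto simp: shift_diff_def algebra_simps)
        ultimately show ?thesis using m n diff_nilpotent_add[of E "m + n'"]
          by (simp del: diff_nilpotent.simps)
      qed
      then show ?thesis using n by simp
    qed
  qed
qed

lemma polynomial_diff_nilpotent:
  assumes "real_polynomial_function h"
  shows "\<exists>n. diff_nilpotent UNIV n h"
  using assms
proof (induction rule: real_polynomial_function.induct)
  case (linear f)
  then have "shift_diff w (shift_diff v f) = (\<lambda>_. 0)" for v w
    by (auto simp: shift_diff_def linear_add[OF bounded_linear.linear])
  then have "diff_nilpotent UNIV (Suc (Suc 0)) f" by (simp del: diff_nilpotent.simps(1) add: diff_nilpotent_zero)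
  then show ?case by blast
next
  case (const c)
  have "diff_nilpotent UNIV (Suc 0) (\<lambda>_. c)" by (simp add: shift_diff_def)
  then show ?case by blast
next
  case (add f g)
  then obtain m n where "diff_nilpotent UNIV m f" "diff_nilpotent UNIV n g" by blast
  then have "diff_nilpotent UNIV (m + n) (\<lambda>x. f x + g x)"
    using diff_nilpotent_add diff_nilpotent_mono le_add1 le_add2 by metis
  then show ?case by blast
next
  case (mult f g)
  then show ?case using diff_nilpotent_mult by blast
qed

lemma diff_nilpotent_step_add:
  assumes "diff_nilpotent E m (shift_diff v f)" "diff_nilpotent E m (shift_diff w f)"
  shows "diff_nilpotent E m (shift_diff (v + w) f)"
proof -
  have "shift_diff (v + w) f = (\<lambda>x. shift_diff v f (x + w) + shift_diff w f x)"
    by (auto simp: shift_diff_def algebra_simps)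
  then show ?thesis using assms by (simp add: diff_nilpotent_add diff_nilpotent_translate)
qed

lemma diff_nilpotent_step_sum:
  assumes "finite S" "\<And>k. k \<in> S \<Longrightarrow> diff_nilpotent E m (shift_diff (g k) f)"
  shows "diff_nilpotent E m (shift_diff (\<Sum>k\<in>S. g k) f)"
  using assms
proof (induction S rule: finite_induct)
  case empty
  have "shift_diff 0 f = (\<lambda>_. 0)" by (auto simp: shift_diff_def)
  then show ?case by (simp add: diff_nilpotent_zero)
next
  case (insert k S)
  then show ?case by (simp add: diff_nilpotent_step_add)
qed

lemma shift_diff_commute: "shift_diff v (shift_diff w f) = shift_diff w (shift_diff v f)"
  by (auto simp: shift_diff_def algebra_simps)

lemma shift_diff_funpow_commute:
  "(shift_diff v ^^ i) (shift_diff w f) = shift_diff w ((shift_diff v ^^ i) f)"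
  by (induction i) (simp_all add: shift_diff_commute)

text \<open>
Newton's forward interpolation of \<open>f\<close> along the line through \<open>x\<close> in direction \<open>b\<close>.
\<close>

definition newton_expansion :: "nat \<Rightarrow> 'v::real_vector \<Rightarrow> ('v \<Rightarrow> real) \<Rightarrow> 'v \<Rightarrow> real \<Rightarrow> real" where
  "newton_expansion m b f x s = (\<Sum>i<m. (s gchoose i) * (shift_diff b ^^ i) f x)"

lemma newton_expansion_step:
  "newton_expansion (Suc m) b f x (s + 1)
     = newton_expansion (Suc m) b f x s + newton_expansion m b (shift_diff b f) x s"
proof -
  have "newton_expansion (Suc m) b f x t = f x + (\<Sum>i<m. (t gchoose Suc i) * (shift_diff b ^^ i) (shift_diff b f) x)"
    for t
    unfolding newton_expansion_def sum.lessThan_Suc_shift by (simp add: funpow_swap1)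
  then show ?thesis
    by (simp add: newton_expansion_def gbinomial_Suc_Suc distrib_right sum.distrib)
qed

text \<open>
Both sides agree at \<open>n = 0\<close> and, by induction on \<open>m\<close>, have the same differences in \<open>n\<close>.
\<close>

lemma newton_expansion_int:
  assumes "diff_nilpotent E m f" "b \<in> E"
  shows "f (x + of_int n *\<^sub>R b) = newton_expansion m b f x (of_int n)"
  using assms
proof (induction m arbitrary: f n)
  case 0
  then show ?case by (simp add: newton_expansion_def)
next
  case (Suc m)
  have IH: "shift_diff b f (x + of_int n *\<^sub>R b) = newton_expansion m b (shift_diff b f) x (of_int n)" for n
    using Suc by simp
  define d where "d n = f (x + of_int n *\<^sub>R b) - newton_expansion (Suc m) b f x (of_int n)" for n :: int
  have step: "d (n + 1) = d n" for n
    using IH[of n] newton_expansion_step[of m b f x "of_int n"]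
    by (simp add: d_def shift_diff_def algebra_simps)
  have "d n = d 0"
  proof (induction n rule: int_induct[of _ 0])
    case (step2 i)
    then show ?case using step[of "i - 1"] by simp
  qed (use step in auto)
  also have "d 0 = 0"
    unfolding d_def newton_expansion_def sum.lessThan_Suc_shift by simp
  finally show ?case by (simp add: d_def)
qed

lemma gbinomial_poly: "\<exists>p :: real poly. \<forall>s. poly p s = s gchoose i"
proof -
  have "poly (smult (1 / fact i) (\<Prod>j\<in>{0..<i}. [:- of_nat j, 1:])) s = s gchoose i" for s :: real
    by (simp add: poly_prod gbinomial_prod_rev)
  then show ?thesis by blast
qed

text \<open>
Interpolation with step \<open>1 / q\<close> gives a polynomial that agrees with \<open>f\<close> at the fractions with
denominator \<open>q\<close>. All these polynomials agree at the integers and hence coincide, so a single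
polynomial describes \<open>f\<close> at all rational parameters, and by continuity from the right at all real
ones.
\<close>

lemma newton_expansion_real:
  fixes f :: "'v::real_normed_vector \<Rightarrow> real"
  assumes nil: "diff_nilpotent UNIV m f"
    and rc: "\<And>x. ((\<lambda>t. f (x + t *\<^sub>R b)) \<longlongrightarrow> f x) (at_right 0)"
  shows "f (x + s *\<^sub>R b) = newton_expansion m b f x s"
proof -
  obtain P :: "nat \<Rightarrow> real poly" where P: "\<And>i s. poly (P i) s = s gchoose i"
    using gbinomial_poly by metis
  define Q where "Q q = (\<Sum>i<m. smult ((shift_diff ((1 / real q) *\<^sub>R b) ^^ i) f x) (pcompose (P i) [:0, real q:]))"
    for q :: nat
  have polyQ: "poly (Q q) t = newton_expansion m ((1 / real q) *\<^sub>R b) f x (t * real q)" for q t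
    unfolding Q_def newton_expansion_def by (simp add: poly_sum poly_pcompose P mult.commute)
  have frac: "poly (Q q) (of_int n / real q) = f (x + (of_int n / real q) *\<^sub>R b)" if "0 < q" for q n
    using newton_expansion_int[OF nil, of "(1 / real q) *\<^sub>R b" x n] that by (simp add: polyQ)
  have Q1: "Q q = Q 1" if q: "0 < q" for q
  proof (rule ccontr)
    assume "Q q \<noteq> Q 1"
    then have "finite {t. poly (Q q - Q 1) t = 0}" by (intro poly_roots_finite) simp
    moreover have "range (of_int :: int \<Rightarrow> real) \<subseteq> {t. poly (Q q - Q 1) t = 0}"
    proof clarify
      fix n :: int
      have "poly (Q q) (of_int (n * int q) / real q) = f (x + of_int n *\<^sub>R b)"
        unfolding frac[OF q] using q by simp
      then show "poly (Q q - Q 1) (of_int n) = 0" using frac[of 1 n] q by simp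
    qed
    ultimately have "finite (range (of_int :: int \<Rightarrow> real))" by (rule rev_finite_subset)
    then show False using finite_imageD[of "of_int :: int \<Rightarrow> real" UNIV] infinite_UNIV_int
      by (auto simp: inj_on_def)
  qed
  (* Rational parameters that tend to s strictly from above. *)
  define r where "r k = (of_int \<lfloor>s * real (Suc k)\<rfloor> + 1) / real (Suc k)" for k :: nat
  have r_gt: "s < r k" for k
    unfolding r_def by (simp add: pos_less_divide_eq del: of_nat_Suc)
  have r_le: "r k \<le> s + 1 / real (Suc k)" for k
  proof -
    have "of_int \<lfloor>s * real (Suc k)\<rfloor> + 1 \<le> s * real (Suc k) + 1" by simp
    then have "r k \<le> (s * real (Suc k) + 1) / real (Suc k)"
      unfolding r_def by (intro divide_right_mono) auto
    then show ?thesis by (simp add: add_divide_distrib del: of_nat_Suc)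
  qed
  have lim: "r \<longlonglongrightarrow> s"
  proof (rule tendsto_sandwich)
    show "\<forall>\<^sub>F k in sequentially. s \<le> r k" using r_gt by (simp add: less_imp_le)
    show "\<forall>\<^sub>F k in sequentially. r k \<le> s + 1 / real (Suc k)" using r_le by simp
    have "(\<lambda>k. s + 1 / real (Suc k)) \<longlonglongrightarrow> s + 0"
      by (intro tendsto_add tendsto_const) (use LIMSEQ_inverse_real_of_nat in \<open>simp add: inverse_eq_divide\<close>)
    then show "(\<lambda>k. s + 1 / real (Suc k)) \<longlonglongrightarrow> s" by simp
  qed simp
  have "(\<lambda>k. r k - s) \<longlonglongrightarrow> s - s" by (intro tendsto_intros lim)
  then have "filterlim (\<lambda>k. r k - s) (at_right 0) sequentially"
    using r_gt by (auto simp: filterlim_at less_imp_neq[THEN not_sym])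
  then have "(\<lambda>k. f ((x + s *\<^sub>R b) + (r k - s) *\<^sub>R b)) \<longlonglongrightarrow> f (x + s *\<^sub>R b)"
    by (rule filterlim_compose[OF rc])
  moreover have "f ((x + s *\<^sub>R b) + (r k - s) *\<^sub>R b) = poly (Q 1) (r k)" for k
    using frac[of "Suc k" "\<lfloor>s * real (Suc k)\<rfloor> + 1"] Q1[of "Suc k"]
    by (simp add: r_def algebra_simps del: of_nat_Suc)
  moreover have "(\<lambda>k. poly (Q 1) (r k)) \<longlonglongrightarrow> poly (Q 1) s"
    by (rule tendsto_compose[OF _ lim]) (simp add: isCont_def[symmetric])
  ultimately have "f (x + s *\<^sub>R b) = poly (Q 1) s" using LIMSEQ_unique by auto
  then show ?thesis by (simp add: polyQ)
qed

lemma newton_expansion_shift_diff: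
  assumes "\<And>x. f (x + s *\<^sub>R b) = newton_expansion m b f x s"
  shows "shift_diff v f (x + s *\<^sub>R b) = newton_expansion m b (shift_diff v f) x s"
proof -
  have "newton_expansion m b (shift_diff v f) x s
      = newton_expansion m b f (x + v) s - newton_expansion m b f x s"
    unfolding newton_expansion_def shift_diff_funpow_commute
    by (simp add: shift_diff_def right_diff_distrib sum_subtractf)
  then show ?thesis using assms[of x] assms[of "x + v"] by (simp add: shift_diff_def algebra_simps)
qed

lemma real_polynomial_function_poly_inner:
  "real_polynomial_function (\<lambda>v. poly p (d \<bullet> v))" for d :: "'f::euclidean_space"
  unfolding poly_altdef
  by (intro real_polynomial_function_sum real_polynomial_function.intros(4) real_polynomial_function_power
      real_polynomial_function.intros(1,2) bounded_linear_inner_right) auto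

text \<open>
Expand one coordinate at a time. The Newton coefficients in one direction are iterated differences of
\<open>f\<close> and inherit the Newton expansions in the other directions.
\<close>

lemma polynomial_along_basis:
  fixes f :: "'f::euclidean_space \<Rightarrow> real"
  assumes B: "independent B"
    and newton: "\<And>x b s. b \<in> B \<Longrightarrow> s \<in> T \<Longrightarrow> f (x + s *\<^sub>R b) = newton_expansion m b f x s"
  shows "\<exists>p. real_polynomial_function p \<and>
    (\<forall>s. (\<forall>b\<in>B. s b \<in> T) \<longrightarrow> f (x + (\<Sum>b\<in>B. s b *\<^sub>R b)) = p (\<Sum>b\<in>B. s b *\<^sub>R b))"
proof -
  have finB: "finite B" using B by (rule independent_imp_finite)
  obtain d where d: "\<And>b b'. b' \<in> B \<Longrightarrow> d b \<bullet> b' = of_bool (b' = b)"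
    using dual_vectors_exist[OF B] by blast
  have coord: "d b \<bullet> (\<Sum>b'\<in>B. s b' *\<^sub>R b') = s b" if "b \<in> B" for b and s :: "'f \<Rightarrow> real"
    using that finB by (simp add: inner_sum_right d)
  obtain P :: "nat \<Rightarrow> real poly" where P: "\<And>i s. poly (P i) s = s gchoose i"
    using gbinomial_poly by metis
  have "\<exists>p. real_polynomial_function p \<and>
    (\<forall>s. (\<forall>b\<in>B. s b \<in> T) \<longrightarrow> f (x + (\<Sum>b\<in>C. s b *\<^sub>R b)) = p (\<Sum>b\<in>B. s b *\<^sub>R b))"
    if "finite C" "C \<subseteq> B"
      "\<And>x b s. b \<in> B \<Longrightarrow> s \<in> T \<Longrightarrow> f (x + s *\<^sub>R b) = newton_expansion m b f x s" for C f
    using that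
  proof (induction C arbitrary: f rule: finite_induct)
    case empty
    then show ?case by (intro exI[of _ "\<lambda>_. f x"]) (auto intro: real_polynomial_function.intros(2))
  next
    case (insert b C)
    have "\<forall>i. \<exists>p. real_polynomial_function p \<and> (\<forall>s. (\<forall>b\<in>B. s b \<in> T) \<longrightarrow>
        (shift_diff b ^^ i) f (x + (\<Sum>b\<in>C. s b *\<^sub>R b)) = p (\<Sum>b\<in>B. s b *\<^sub>R b))"
    proof
      fix i
      have "(shift_diff b ^^ i) f (y + s *\<^sub>R b') = newton_expansion m b' ((shift_diff b ^^ i) f) y s"
        if "b' \<in> B" "s \<in> T" for y s b'
      proof (induction i arbitrary: y)
        case 0
        then show ?case using insert.prems(2) that by simp
      next
        case (Suc i)
        then show ?case by (simp add: newton_expansion_shift_diff)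
      qed
      then show "\<exists>p. real_polynomial_function p \<and> (\<forall>s. (\<forall>b\<in>B. s b \<in> T) \<longrightarrow>
        (shift_diff b ^^ i) f (x + (\<Sum>b\<in>C. s b *\<^sub>R b)) = p (\<Sum>b\<in>B. s b *\<^sub>R b))"
        using insert.prems by (intro insert.IH) auto
    qed
    then obtain p where p: "\<And>i. real_polynomial_function (p i)"
      "\<And>i s. (\<forall>b\<in>B. s b \<in> T) \<Longrightarrow>
        (shift_diff b ^^ i) f (x + (\<Sum>b\<in>C. s b *\<^sub>R b)) = p i (\<Sum>b\<in>B. s b *\<^sub>R b)"
      by metis
    define q where "q v = (\<Sum>i<m. poly (P i) (d b \<bullet> v) * p i v)" for v
    have "real_polynomial_function q"
      unfolding q_def by (intro real_polynomial_function_sum real_polynomial_function.intros(4)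
          real_polynomial_function_poly_inner p(1)) auto
    moreover have "f (x + (\<Sum>b\<in>insert b C. s b *\<^sub>R b)) = q (\<Sum>b\<in>B. s b *\<^sub>R b)"
      if s: "\<forall>b\<in>B. s b \<in> T" for s
    proof -
      have b: "b \<in> B" using insert.prems by blast
      have "f (x + (\<Sum>b\<in>insert b C. s b *\<^sub>R b)) = f ((x + (\<Sum>b\<in>C. s b *\<^sub>R b)) + s b *\<^sub>R b)"
        using insert.hyps by (simp add: algebra_simps)
      also have "\<dots> = newton_expansion m b f (x + (\<Sum>b\<in>C. s b *\<^sub>R b)) (s b)"
        using insert.prems(2) b s by blast
      also have "\<dots> = q (\<Sum>b\<in>B. s b *\<^sub>R b)"
        unfolding newton_expansion_def q_def P coord[OF b] p(2)[OF s] ..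
      finally show ?thesis .
    qed
    ultimately show ?case by blast
  qed
  from this[OF finB order_refl newton] show ?thesis .
qed

section \<open>Operators equivariant under translation\<close>

text \<open>
The functions that can be integrated and summed over the fibres, with bounds that are locally
uniform in the base point.
\<close>

definition proper_on_fibers :: "('n::finite \<Rightarrow> 'f::euclidean_space) \<Rightarrow> (real ^ 'n \<Rightarrow> real) \<Rightarrow> bool" where
  "proper_on_fibers \<Phi> F \<longleftrightarrow> F \<in> borel_measurable borel \<and>
     (\<forall>R. \<exists>M. \<forall>x. norm (\<Sum>i\<in>UNIV. x $ i *\<^sub>R \<Phi> i) \<le> R \<longrightarrow> F x \<noteq> 0 \<longrightarrow> norm x \<le> M) \<and>
     (\<forall>M. \<exists>C. \<forall>x. norm x \<le> M \<longrightarrow> \<bar>F x\<bar> \<le> C)"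

definition count_at :: "('n::finite \<Rightarrow> 'f::euclidean_space) \<Rightarrow> 'f \<Rightarrow> 'n set \<Rightarrow> real ^ 'n \<Rightarrow> real" where
  "count_at \<Phi> u S x = signed_count \<Phi> u S {i \<in> S. x $ i < 0}"

text \<open>
A factor that confines the coordinates of deleted vectors. Deleting a vector from the family leaves
its coordinate in place, restricted to a bounded strip, so that all integrals and sums are taken over
the fibres of one and the same family.
\<close>

definition cutoff :: "'n::finite set \<Rightarrow> (real ^ 'n \<Rightarrow> real) \<Rightarrow> bool" where
  "cutoff S \<beta> \<longleftrightarrow> \<beta> \<in> borel_measurable borel \<and> (\<exists>C. \<forall>x. \<bar>\<beta> x\<bar> \<le> C) \<and>
     (\<forall>j\<in>S. \<forall>x t. \<beta> (x + axis j t) = \<beta> x) \<and> (\<exists>M. \<forall>x. \<beta> x \<noteq> 0 \<longrightarrow> (\<forall>i. i \<notin> S \<longrightarrow> \<bar>x $ i\<bar> \<le> M))"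

lemma cutoffD:
  assumes "cutoff S \<beta>"
  shows "\<exists>C. \<forall>x. \<bar>\<beta> x\<bar> \<le> C" "\<exists>M. \<forall>x. \<beta> x \<noteq> 0 \<longrightarrow> (\<forall>i. i \<notin> S \<longrightarrow> \<bar>x $ i\<bar> \<le> M)"
  using assms by (simp_all add: cutoff_def)

lemma proper_on_fibersD:
  assumes "proper_on_fibers \<Phi> F"
  shows "F \<in> borel_measurable borel"
    "\<exists>M. \<forall>x. norm (\<Sum>i\<in>UNIV. x $ i *\<^sub>R \<Phi> i) \<le> R \<longrightarrow> F x \<noteq> 0 \<longrightarrow> norm x \<le> M"
    "\<exists>C. \<forall>x. norm x \<le> M \<longrightarrow> \<bar>F x\<bar> \<le> C"
  using assms by (simp_all add: proper_on_fibers_def)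

text \<open>
The count changes only if the coordinate \<open>j\<close> changes its sign, and then \<open>signed_count_delete\<close>
gives the difference.
\<close>

lemma count_at_shift:
  assumes "j \<in> S"
  shows "count_at \<Phi> u S (x + axis j t) - count_at \<Phi> u S x
    = (of_bool (0 \<le> x $ j + t) - of_bool (0 \<le> x $ j)) * count_at \<Phi> u (S - {j}) x"
proof -
  let ?J = "{i \<in> S - {j}. x $ i < 0}"
  have J: "{i \<in> S. y $ i < 0} = (if 0 \<le> y $ j then ?J else insert j ?J)"
    if y: "\<And>i. i \<noteq> j \<Longrightarrow> y $ i = x $ i" for y
  proof (intro set_eqI)
    fix i
    show "i \<in> {i \<in> S. y $ i < 0} \<longleftrightarrow> i \<in> (if 0 \<le> y $ j then ?J else insert j ?J)"
      using assms y[of i] by (cases "i = j") auto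
  qed
  have 1: "{i \<in> S. (x + axis j t) $ i < 0} = (if 0 \<le> x $ j + t then ?J else insert j ?J)"
    by (subst J) (auto simp: axis_def)
  have 2: "{i \<in> S. x $ i < 0} = (if 0 \<le> x $ j then ?J else insert j ?J)"
    by (subst J) auto
  have "signed_count \<Phi> u S ?J = signed_count \<Phi> u S (insert j ?J) + signed_count \<Phi> u (S - {j}) ?J"
    by (rule signed_count_delete[OF assms]) auto
  then show ?thesis unfolding count_at_def 1 2 by auto
qed

lemma count_at_measurable: "count_at \<Phi> u S \<in> borel_measurable borel"
proof -
  have eq: "count_at \<Phi> u S x = (-1) ^ DIM('b) *
      (\<Sum>I | I \<subseteq> S \<and> u \<in> gen_cone \<Phi> I. (-1) ^ card I * (\<Prod>i\<in>S - I. if 0 \<le> x $ i then 1 else 0))"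
    for x
  proof -
    have "(\<Prod>i\<in>S - I. if 0 \<le> x $ i then 1 else 0) = (of_bool ({i \<in> S. x $ i < 0} \<subseteq> I) :: real)"
      if "I \<subseteq> S" for I
    proof (cases "{i \<in> S. x $ i < 0} \<subseteq> I")
      case True
      then have "(\<Prod>i\<in>S - I. if 0 \<le> x $ i then 1 else 0) = (\<Prod>i\<in>S - I. 1 :: real)"
        by (intro prod.cong) (auto simp: subset_iff not_less)
      then show ?thesis using True by simp
    next
      case False
      then obtain i where "i \<in> S" "x $ i < 0" "i \<notin> I" by blast
      then have "i \<in> S - I" "\<not> 0 \<le> x $ i" by auto
      then have "(\<Prod>i\<in>S - I. if 0 \<le> x $ i then 1 else 0) = (0 :: real)"
        by (intro prod_zero) auto
      then show ?thesis using False by simp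
    qed
    then have "(\<Sum>I | I \<subseteq> S \<and> u \<in> gen_cone \<Phi> I. (-1) ^ card I * (\<Prod>i\<in>S - I. if 0 \<le> x $ i then 1 else 0))
        = (\<Sum>I | {i \<in> S. x $ i < 0} \<subseteq> I \<and> I \<subseteq> S \<and> u \<in> gen_cone \<Phi> I. (-1) ^ card I :: real)"
      by (intro sum.mono_neutral_cong_right) auto
    then show ?thesis by (simp add: count_at_def signed_count_def)
  qed
  have m: "(\<lambda>x. x $ i) \<in> borel_measurable (borel :: (real ^ 'a) measure)" for i :: 'a
    by (intro borel_measurable_continuous_onI continuous_intros)
  show ?thesis unfolding eq using m by measurable
qed

lemma count_at_bounded: "\<exists>C. \<forall>x. \<bar>count_at \<Phi> u S x\<bar> \<le> C"
proof (intro exI allI)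
  fix x
  show "\<bar>count_at \<Phi> u S x\<bar> \<le> (\<Sum>J\<in>UNIV. \<bar>signed_count \<Phi> u S J\<bar>)"
    unfolding count_at_def by (rule member_le_sum[of _ _ "\<lambda>J. \<bar>signed_count \<Phi> u S J\<bar>"]) auto
qed

text \<open>
The factor \<open>\<beta>\<close> bounds the coordinates outside \<open>S\<close>; where the count is nonzero,
\<open>signed_count_bounded\<close> bounds the others.
\<close>

lemma proper_count_at:
  fixes \<Phi> :: "'n::finite \<Rightarrow> 'f::euclidean_space"
  assumes reg: "regular \<Phi> u" and pt: "pointed \<Phi>" and \<beta>: "cutoff S \<beta>" and h: "continuous_on UNIV h"
  shows "proper_on_fibers \<Phi> (\<lambda>x. count_at \<Phi> u S x * \<beta> x * h x)"
  unfolding proper_on_fibers_def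
proof (intro conjI allI)
  show "(\<lambda>x. count_at \<Phi> u S x * \<beta> x * h x) \<in> borel_measurable borel"
    using count_at_measurable \<beta> borel_measurable_continuous_onI[OF h]
    by (intro borel_measurable_times) (auto simp: cutoff_def)
next
  fix R :: real
  obtain C where C: "0 \<le> C" "\<forall>S J x. signed_count \<Phi> u S J \<noteq> 0 \<longrightarrow>
      (\<forall>i\<in>S. if i \<in> J then x i \<le> 0 else 0 \<le> x i) \<longrightarrow>
      (\<forall>i\<in>S. \<bar>x i\<bar> \<le> C * norm (\<Sum>i\<in>S. x i *\<^sub>R \<Phi> i))"
    using signed_count_bounded[OF reg pt] by blast
  obtain M where M: "\<And>x i. \<beta> x \<noteq> 0 \<Longrightarrow> i \<notin> S \<Longrightarrow> \<bar>x $ i\<bar> \<le> M"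
    using cutoffD(2)[OF \<beta>] by blast
  define D where "D = C * (R + (\<Sum>i\<in>-S. M * norm (\<Phi> i)))"
  show "\<exists>M. \<forall>x. norm (\<Sum>i\<in>UNIV. x $ i *\<^sub>R \<Phi> i) \<le> R \<longrightarrow> count_at \<Phi> u S x * \<beta> x * h x \<noteq> 0 \<longrightarrow> norm x \<le> M"
  proof (intro exI allI impI)
    fix x assume R: "norm (\<Sum>i\<in>UNIV. x $ i *\<^sub>R \<Phi> i) \<le> R" and nz: "count_at \<Phi> u S x * \<beta> x * h x \<noteq> 0"
    have out: "\<bar>x $ i\<bar> \<le> M" if "i \<notin> S" for i using M nz that by auto
    have "(\<Sum>i\<in>UNIV. x $ i *\<^sub>R \<Phi> i) = (\<Sum>i\<in>S. x $ i *\<^sub>R \<Phi> i) + (\<Sum>i\<in>-S. x $ i *\<^sub>R \<Phi> i)"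
      using sum.union_disjoint[of S "-S" "\<lambda>i. x $ i *\<^sub>R \<Phi> i"] by simp
    then have "norm (\<Sum>i\<in>S. x $ i *\<^sub>R \<Phi> i) \<le> R + norm (\<Sum>i\<in>-S. x $ i *\<^sub>R \<Phi> i)"
      using norm_triangle_ineq4[of "\<Sum>i\<in>UNIV. x $ i *\<^sub>R \<Phi> i" "\<Sum>i\<in>-S. x $ i *\<^sub>R \<Phi> i"] R by simp
    also have "norm (\<Sum>i\<in>-S. x $ i *\<^sub>R \<Phi> i) \<le> (\<Sum>i\<in>-S. M * norm (\<Phi> i))"
      using out by (intro sum_norm_le) (auto intro!: mult_right_mono)
    finally have S_le: "C * norm (\<Sum>i\<in>S. x $ i *\<^sub>R \<Phi> i) \<le> D"
      unfolding D_def using C(1) by (simp add: mult_left_mono)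
    have inS: "\<bar>x $ i\<bar> \<le> D" if "i \<in> S" for i
    proof -
      have "\<bar>x $ i\<bar> \<le> C * norm (\<Sum>i\<in>S. x $ i *\<^sub>R \<Phi> i)"
        using C(2)[rule_format, of S "{i \<in> S. x $ i < 0}" "($) x" i] nz that
        by (auto simp: count_at_def)
      with S_le show ?thesis by linarith
    qed
    have "norm x \<le> (\<Sum>i\<in>UNIV. \<bar>x $ i\<bar>)" by (rule norm_le_l1_cart)
    also have "\<dots> \<le> (\<Sum>i\<in>(UNIV :: 'n set). \<bar>D\<bar> + \<bar>M\<bar>)"
    proof (rule sum_mono)
      fix i show "\<bar>x $ i\<bar> \<le> \<bar>D\<bar> + \<bar>M\<bar>" using inS[of i] out[of i] by (cases "i \<in> S") linarith+
    qed
    finally show "norm x \<le> (\<Sum>i\<in>(UNIV :: 'n set). \<bar>D\<bar> + \<bar>M\<bar>)" .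
  qed
next
  fix M :: real
  obtain C1 where C1: "\<And>x. \<bar>count_at \<Phi> u S x\<bar> \<le> C1" using count_at_bounded by blast
  obtain C2 where C2: "\<And>x. \<bar>\<beta> x\<bar> \<le> C2" using cutoffD(1)[OF \<beta>] by blast
  have "compact (h ` cball 0 M)"
    by (intro compact_continuous_image continuous_on_subset[OF h]) auto
  then obtain C3 where C3: "\<And>x. norm x \<le> M \<Longrightarrow> \<bar>h x\<bar> \<le> C3"
    using compact_imp_bounded[of "h ` cball 0 M"] unfolding bounded_iff by force
  have "\<bar>count_at \<Phi> u S x * \<beta> x * h x\<bar> \<le> C1 * C2 * C3" if "norm x \<le> M" for x
    unfolding abs_mult using C1[of x] C2[of x] C3[OF that]
    by (intro mult_mono) (auto intro: order_trans[OF abs_ge_zero])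
  then show "\<exists>C. \<forall>x. norm x \<le> M \<longrightarrow> \<bar>count_at \<Phi> u S x * \<beta> x * h x\<bar> \<le> C" by blast
qed

lemma proper_add:
  assumes "proper_on_fibers \<Phi> F" "proper_on_fibers \<Phi> G"
  shows "proper_on_fibers \<Phi> (\<lambda>x. F x + G x)"
  unfolding proper_on_fibers_def
proof (intro conjI allI)
  show "(\<lambda>x. F x + G x) \<in> borel_measurable borel"
    using assms by (intro borel_measurable_add) (auto simp: proper_on_fibers_def)
next
  fix R :: real
  obtain M N where M: "\<And>x. norm (\<Sum>i\<in>UNIV. x $ i *\<^sub>R \<Phi> i) \<le> R \<Longrightarrow> F x \<noteq> 0 \<Longrightarrow> norm x \<le> M"
    and N: "\<And>x. norm (\<Sum>i\<in>UNIV. x $ i *\<^sub>R \<Phi> i) \<le> R \<Longrightarrow> G x \<noteq> 0 \<Longrightarrow> norm x \<le> N"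
    using proper_on_fibersD(2)[OF assms(1), of R] proper_on_fibersD(2)[OF assms(2), of R] by blast
  show "\<exists>M. \<forall>x. norm (\<Sum>i\<in>UNIV. x $ i *\<^sub>R \<Phi> i) \<le> R \<longrightarrow> F x + G x \<noteq> 0 \<longrightarrow> norm x \<le> M"
  proof (intro exI allI impI)
    fix x assume "norm (\<Sum>i\<in>UNIV. x $ i *\<^sub>R \<Phi> i) \<le> R" "F x + G x \<noteq> 0"
    then show "norm x \<le> max M N" using M[of x] N[of x] by (cases "F x = 0") auto
  qed
next
  fix M :: real
  obtain C D where C: "\<And>x. norm x \<le> M \<Longrightarrow> \<bar>F x\<bar> \<le> C" and D: "\<And>x. norm x \<le> M \<Longrightarrow> \<bar>G x\<bar> \<le> D"
    using proper_on_fibersD(3)[OF assms(1), of M] proper_on_fibersD(3)[OF assms(2), of M] by blast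
  have "\<bar>F x + G x\<bar> \<le> C + D" if "norm x \<le> M" for x
    using C[OF that] D[OF that] abs_triangle_ineq[of "F x" "G x"] by linarith
  then show "\<exists>C. \<forall>x. norm x \<le> M \<longrightarrow> \<bar>F x + G x\<bar> \<le> C" by blast
qed

lemma cutoff_strip:
  assumes \<beta>: "cutoff S \<beta>" and j: "j \<in> S"
  shows "cutoff (S - {j}) (\<lambda>x. \<beta> x * (of_bool (0 \<le> x $ j + t) - of_bool (0 \<le> x $ j)))"
  unfolding cutoff_def
proof (intro conjI ballI allI)
  have m [measurable]: "(\<lambda>x. x $ j) \<in> borel_measurable (borel :: (real ^ 'a) measure)"
    by (intro borel_measurable_continuous_onI continuous_intros)
  have [measurable]: "\<beta> \<in> borel_measurable borel" using \<beta> by (simp add: cutoff_def)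
  show "(\<lambda>x. \<beta> x * (of_bool (0 \<le> x $ j + t) - of_bool (0 \<le> x $ j))) \<in> borel_measurable borel"
    unfolding of_bool_def by measurable
next
  obtain C where "\<And>x. \<bar>\<beta> x\<bar> \<le> C" using cutoffD(1)[OF \<beta>] by blast
  then have "\<bar>\<beta> x * (of_bool (0 \<le> x $ j + t) - of_bool (0 \<le> x $ j))\<bar> \<le> C" for x
    using order_trans[OF abs_ge_zero] by (auto simp: abs_mult)
  then show "\<exists>C. \<forall>x. \<bar>\<beta> x * (of_bool (0 \<le> x $ j + t) - of_bool (0 \<le> x $ j))\<bar> \<le> C" by blast
next
  fix k x s assume "k \<in> S - {j}"
  then show "\<beta> (x + axis k s) * (of_bool (0 \<le> (x + axis k s) $ j + t) - of_bool (0 \<le> (x + axis k s) $ j))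
      = \<beta> x * (of_bool (0 \<le> x $ j + t) - of_bool (0 \<le> x $ j))"
    using \<beta> by (auto simp: cutoff_def axis_def)
next
  obtain M where M: "\<And>x i. \<beta> x \<noteq> 0 \<Longrightarrow> i \<notin> S \<Longrightarrow> \<bar>x $ i\<bar> \<le> M"
    using cutoffD(2)[OF \<beta>] by blast
  show "\<exists>M. \<forall>x. \<beta> x * (of_bool (0 \<le> x $ j + t) - of_bool (0 \<le> x $ j)) \<noteq> 0 \<longrightarrow>
      (\<forall>i. i \<notin> S - {j} \<longrightarrow> \<bar>x $ i\<bar> \<le> M)"
  proof (intro exI allI impI)
    fix x i
    assume nz: "\<beta> x * (of_bool (0 \<le> x $ j + t) - of_bool (0 \<le> x $ j)) \<noteq> 0" and i: "i \<notin> S - {j}"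
    have "\<bar>x $ j\<bar> \<le> \<bar>t\<bar>" using nz by (auto simp: of_bool_def split: if_splits)
    then show "\<bar>x $ i\<bar> \<le> \<bar>M\<bar> + \<bar>t\<bar>" using i M[of x i] nz by (cases "i = j") auto
  qed
qed

text \<open>
The operator \<open>L\<close> stands for integration over fibres, with \<open>T = UNIV\<close>, or for summation over their
lattice points, with \<open>T = \<int>\<close>. If \<open>S\<close> spans, every step in \<open>E\<close> is a sum of steps \<open>t *\<^sub>R \<Phi> k\<close> with
\<open>k \<in> S\<close>. The difference for such a step splits into a term with \<open>h\<close> differenced, which lowers \<open>n\<close>,
and a term in which \<open>k\<close> is deleted from \<open>S\<close>. If \<open>S\<close> does not span, the count vanishes.
\<close>

lemma operator_diff_nilpotent:
  fixes \<Phi> :: "'n::finite \<Rightarrow> 'f::euclidean_space" and L :: "(real ^ 'n \<Rightarrow> real) \<Rightarrow> 'f \<Rightarrow> real"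
  assumes reg: "regular \<Phi> u" and pt: "pointed \<Phi>"
    and L_zero: "\<And>\<nu>. L (\<lambda>_. 0) \<nu> = 0"
    and L_add: "\<And>F G \<nu>. proper_on_fibers \<Phi> F \<Longrightarrow> proper_on_fibers \<Phi> G \<Longrightarrow>
      L (\<lambda>x. F x + G x) \<nu> = L F \<nu> + L G \<nu>"
    and L_shift: "\<And>F j t \<nu>. proper_on_fibers \<Phi> F \<Longrightarrow> t \<in> T \<Longrightarrow>
      L (\<lambda>x. F (x + axis j t)) \<nu> = L F (\<nu> + t *\<^sub>R \<Phi> j)"
    and E: "\<And>S v. span (\<Phi> ` S) = UNIV \<Longrightarrow> v \<in> E \<Longrightarrow> \<exists>t. (\<forall>k\<in>S. t k \<in> T) \<and> v = (\<Sum>k\<in>S. t k *\<^sub>R \<Phi> k)"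
    and "cutoff S \<beta>" "continuous_on UNIV h" "diff_nilpotent UNIV n h"
  shows "diff_nilpotent E (card S + n) (L (\<lambda>x. count_at \<Phi> u S x * \<beta> x * h x))"
  using assms(7-9)
proof (induction "card S + n" arbitrary: S n \<beta> h rule: less_induct)
  case less
  have zero: ?case if "(\<lambda>x. count_at \<Phi> u S x * \<beta> x * h x) = (\<lambda>_. 0)"
  proof -
    have "L (\<lambda>_. 0) = (\<lambda>_. 0)" using L_zero by blast
    then show ?thesis unfolding that by (simp add: diff_nilpotent_zero)
  qed
  show ?case
  proof (cases "span (\<Phi> ` S) = UNIV")
    case False
    then have "count_at \<Phi> u S x = 0" for x
      unfolding count_at_def by (rule signed_count_nonspanning[OF reg])
    then show ?thesis by (intro zero) simp
  next
    case span: True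
    show ?thesis
    proof (cases n)
      case 0
      then show ?thesis using less.prems(3) by (intro zero) simp
    next
      case n: (Suc n')
      let ?F = "\<lambda>x. count_at \<Phi> u S x * \<beta> x * h x"
      have F: "proper_on_fibers \<Phi> ?F" by (rule proper_count_at[OF reg pt less.prems(1,2)])
      have step: "diff_nilpotent E (card S + n') (shift_diff (t *\<^sub>R \<Phi> k) (L ?F))"
        if k: "k \<in> S" and t: "t \<in> T" for k t
      proof -
        define dh where "dh = shift_diff (axis k t) h"
        define h' where "h' = (\<lambda>x. h (x + axis k t))"
        define \<beta>' where "\<beta>' = (\<lambda>x. \<beta> x * (of_bool (0 \<le> x $ k + t) - of_bool (0 \<le> x $ k)))"
        let ?G = "\<lambda>x. count_at \<Phi> u S x * \<beta> x * dh x"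
        let ?K = "\<lambda>x. count_at \<Phi> u (S - {k}) x * \<beta>' x * h' x"
        have h': "continuous_on UNIV h'"
          unfolding h'_def by (intro continuous_on_compose2[OF less.prems(2)] continuous_intros) auto
        have dh: "continuous_on UNIV dh"
          using h' less.prems(2) unfolding dh_def shift_diff_def h'_def by (intro continuous_intros)
        have \<beta>': "cutoff (S - {k}) \<beta>'" unfolding \<beta>'_def by (rule cutoff_strip[OF less.prems(1) k])
        have G: "proper_on_fibers \<Phi> ?G" by (rule proper_count_at[OF reg pt less.prems(1) dh])
        have K: "proper_on_fibers \<Phi> ?K" by (rule proper_count_at[OF reg pt \<beta>' h'])
        have card: "Suc (card (S - {k})) = card S" using k by (intro card_Suc_Diff1) auto
        have "?F (x + axis k t) = ?F x + (?G x + ?K x)" for x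
        proof -
          have "\<beta> (x + axis k t) = \<beta> x" using less.prems(1) k by (simp add: cutoff_def)
          moreover have "count_at \<Phi> u S (x + axis k t) = count_at \<Phi> u S x
              + (of_bool (0 \<le> x $ k + t) - of_bool (0 \<le> x $ k)) * count_at \<Phi> u (S - {k}) x"
            using count_at_shift[OF k, of \<Phi> u x t] by linarith
          ultimately show ?thesis
            by (simp only: dh_def h'_def \<beta>'_def shift_diff_def) (simp add: algebra_simps)
        qed
        then have "L ?F (\<nu> + t *\<^sub>R \<Phi> k) = L ?F \<nu> + (L ?G \<nu> + L ?K \<nu>)" for \<nu>
          using L_shift[OF F t, of k \<nu>] L_add[OF F proper_add[OF G K]] L_add[OF G K] by simp
        then have "shift_diff (t *\<^sub>R \<Phi> k) (L ?F) = (\<lambda>\<nu>. L ?G \<nu> + L ?K \<nu>)"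
          by (auto simp: shift_diff_def)
        moreover have "diff_nilpotent E (card S + n') (L ?G)"
          using less.prems n by (intro less.hyps dh) (auto simp: dh_def)
        moreover have "diff_nilpotent E (card (S - {k}) + n) (L ?K)"
          using card \<beta>' h' diff_nilpotent_translate[OF less.prems(3)]
          by (intro less.hyps) (auto simp: h'_def)
        moreover have "card (S - {k}) + n = card S + n'" using card n by simp
        ultimately show ?thesis by (simp add: diff_nilpotent_add)
      qed
      have "diff_nilpotent E (card S + n') (shift_diff v (L ?F))" if v: "v \<in> E" for v
      proof -
        obtain t where t: "\<forall>k\<in>S. t k \<in> T" "v = (\<Sum>k\<in>S. t k *\<^sub>R \<Phi> k)" using E[OF span v] by blast
        show ?thesis unfolding t(2) using t(1) step by (intro diff_nilpotent_step_sum) auto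
      qed
      then show ?thesis using n by simp
    qed
  qed
qed

lemma cutoff_UNIV: "cutoff UNIV (\<lambda>_. 1)"
  unfolding cutoff_def by (auto intro: exI[of _ 1])

lemma XX_proper:
  assumes gen: "span (range \<Phi>) = UNIV" and pt: "pointed \<Phi>" and t: "tope \<Phi> \<tau>" 
    and h: "continuous_on UNIV h"
  shows "proper_on_fibers \<Phi> (\<lambda>x. XX \<Phi> \<tau> x * h x)"
proof -
  obtain u where u: "u \<in> \<tau>" using tope_nonempty[OF t] by blast
  show ?thesis
    using proper_count_at[OF tope_regular[OF gen t u] pt cutoff_UNIV h]
    by (simp add: count_at_def XX_eq_signed_count[OF gen t u])
qed

lemma XX_operator_diff_nilpotent:
  fixes \<Phi> :: "'n::finite \<Rightarrow> 'f::euclidean_space" and L :: "(real ^ 'n \<Rightarrow> real) \<Rightarrow> 'f \<Rightarrow> real"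
  assumes gen: "span (range \<Phi>) = UNIV" and pt: "pointed \<Phi>" and t: "tope \<Phi> \<tau>"
    and h: "real_polynomial_function h"
    and L_zero: "\<And>\<nu>. L (\<lambda>_. 0) \<nu> = 0"
    and L_add: "\<And>F G \<nu>. proper_on_fibers \<Phi> F \<Longrightarrow> proper_on_fibers \<Phi> G \<Longrightarrow>
      L (\<lambda>x. F x + G x) \<nu> = L F \<nu> + L G \<nu>"
    and L_shift: "\<And>F j t \<nu>. proper_on_fibers \<Phi> F \<Longrightarrow> t \<in> T \<Longrightarrow>
      L (\<lambda>x. F (x + axis j t)) \<nu> = L F (\<nu> + t *\<^sub>R \<Phi> j)"
    and E: "\<And>S v. span (\<Phi> ` S) = UNIV \<Longrightarrow> v \<in> E \<Longrightarrow> \<exists>t. (\<forall>k\<in>S. t k \<in> T) \<and> v = (\<Sum>k\<in>S. t k *\<^sub>R \<Phi> k)"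
  shows "\<exists>m. diff_nilpotent E m (L (\<lambda>x. XX \<Phi> \<tau> x * h x))"
proof -
  obtain u where u: "u \<in> \<tau>" using tope_nonempty[OF t] by blast
  obtain n where n: "diff_nilpotent UNIV n h" using polynomial_diff_nilpotent[OF h] by blast
  have c: "continuous_on UNIV h" by (rule continuous_on_polymonial_function[OF h[unfolded real_polynomial_function_eq]])
  have "diff_nilpotent E (card (UNIV :: 'n set) + n) (L (\<lambda>x. count_at \<Phi> u UNIV x * 1 * h x))"
    by (rule operator_diff_nilpotent[where \<Phi> = \<Phi> and L = L and T = T and E = E and \<beta> = "\<lambda>_. 1",
          OF tope_regular[OF gen t u] pt L_zero L_add L_shift E cutoff_UNIV c n])
  moreover have "(\<lambda>x. count_at \<Phi> u UNIV x * 1 * h x) = (\<lambda>x. XX \<Phi> \<tau> x * h x)"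
    by (simp add: count_at_def XX_eq_signed_count[OF gen t u])
  ultimately show ?thesis by metis
qed

section \<open>Integration over fibres\<close>

lemma PiM_lborel_translate:
  fixes B :: "'i set" and s :: "'i \<Rightarrow> real"
  assumes "finite B"
  shows "distr (PiM B (\<lambda>_. lborel)) (PiM B (\<lambda>_. lborel)) (\<lambda>t. \<lambda>b\<in>B. t b + s b) = PiM B (\<lambda>_. lborel)"
    (is "distr ?P ?P ?T = ?P")
proof -
  interpret product_sigma_finite "\<lambda>_ :: 'i. lborel :: real measure" ..
  have T: "?T \<in> measurable ?P ?P" by measurable
  show ?thesis
  proof (rule PiM_eqI[OF assms])
    fix A :: "'i \<Rightarrow> real set" assume A: "\<And>b. b \<in> B \<Longrightarrow> A b \<in> sets lborel"
    have A': "(\<lambda>y. s b + y) -` A b \<in> sets lborel" if "b \<in> B" for b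
    proof -
      have "(\<lambda>y. s b + y) \<in> borel_measurable borel" by measurable
      from measurable_sets[OF this, of "A b"] show ?thesis using A[OF that] by simp
    qed
    have sets: "Pi\<^sub>E B A \<in> sets ?P" using assms A by (intro sets_PiM_I_finite) auto
    have "?T -` Pi\<^sub>E B A \<inter> space ?P = (\<Pi>\<^sub>E b\<in>B. (\<lambda>y. s b + y) -` A b)"
      by (auto simp: space_PiM PiE_iff add.commute)
    then have "emeasure (distr ?P ?P ?T) (Pi\<^sub>E B A) = (\<Prod>b\<in>B. emeasure lborel ((\<lambda>y. s b + y) -` A b))"
      using emeasure_distr[OF T sets] emeasure_PiM[OF assms A'] by simp
    also have "\<dots> = (\<Prod>b\<in>B. emeasure lborel (A b))"
    proof (rule prod.cong[OF refl])
      fix b assume "b \<in> B"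
      have "emeasure lborel (A b) = emeasure (distr lborel borel ((+) (s b))) (A b)"
        by (simp add: lborel_distr_plus)
      also have "\<dots> = emeasure lborel ((\<lambda>y. s b + y) -` A b)"
        using A[OF \<open>b \<in> B\<close>] by (subst emeasure_distr) auto
      finally show "emeasure lborel ((\<lambda>y. s b + y) -` A b) = emeasure lborel (A b)" ..
    qed
    finally show "emeasure (distr ?P ?P ?T) (Pi\<^sub>E B A) = (\<Prod>b\<in>B. emeasure lborel (A b))" .
  qed simp
qed

lemma lebesgue_measure_on_cases:
  assumes "lebesgue_measure_on V \<mu>"
  obtains B c where "finite B" "independent B" "span B = V" "0 < c"
    "(\<lambda>t. \<Sum>b\<in>B. t b *\<^sub>R b) \<in> measurable (PiM B (\<lambda>_. lborel)) (restrict_space borel V)"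
    "\<mu> = scale_measure (ennreal c) (distr (PiM B (\<lambda>_. lborel)) (restrict_space borel V) (\<lambda>t. \<Sum>b\<in>B. t b *\<^sub>R b))"
proof -
  obtain B c where B: "independent B" "span B = V" "(0::real) < c"
    "\<mu> = scale_measure (ennreal c) (distr (PiM B (\<lambda>_. lborel)) (restrict_space borel V) (\<lambda>t. \<Sum>b\<in>B. t b *\<^sub>R b))"
    using assms by (auto simp: lebesgue_measure_on_def)
  have "(\<lambda>t. \<Sum>b\<in>B. t b *\<^sub>R b) \<in> borel_measurable (PiM B (\<lambda>_. lborel))"
    by (intro borel_measurable_sum borel_measurable_scaleR) auto
  then have "(\<lambda>t. \<Sum>b\<in>B. t b *\<^sub>R b) \<in> measurable (PiM B (\<lambda>_. lborel)) (restrict_space borel V)"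
    unfolding B(2)[symmetric]
    by (intro measurable_restrict_space2 Pi_I span_sum span_scale) (auto intro: span_base)
  then show thesis using that B independent_imp_finite by blast
qed

lemma lebesgue_measure_on_sets:
  assumes "lebesgue_measure_on V \<mu>"
  shows "sets \<mu> = sets (restrict_space borel V)" "space \<mu> = V"
proof -
  obtain B c where "\<mu> = scale_measure (ennreal c) (distr (PiM B (\<lambda>_. lborel)) (restrict_space borel V) (\<lambda>t. \<Sum>b\<in>B. t b *\<^sub>R b))"
    by (rule lebesgue_measure_on_cases[OF assms])
  then show "sets \<mu> = sets (restrict_space borel V)" "space \<mu> = V"
    by (simp_all add: space_scale_measure space_restrict_space)
qed

lemma lebesgue_measure_on_translate:
  fixes V :: "'v::euclidean_space set"
  assumes leb: "lebesgue_measure_on V \<mu>" and w: "w \<in> V"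
  shows "distr \<mu> \<mu> (\<lambda>v. v + w) = \<mu>"
proof -
  obtain B c where B: "finite B" "independent B" "span B = V"
    and g: "(\<lambda>t. \<Sum>b\<in>B. t b *\<^sub>R b) \<in> measurable (PiM B (\<lambda>_. lborel)) (restrict_space borel V)"
    and \<mu>: "\<mu> = scale_measure (ennreal c) (distr (PiM B (\<lambda>_. lborel)) (restrict_space borel V) (\<lambda>t. \<Sum>b\<in>B. t b *\<^sub>R b))"
    by (rule lebesgue_measure_on_cases[OF leb])
  let ?P = "PiM B (\<lambda>_. lborel :: real measure)" and ?g = "\<lambda>t. \<Sum>b\<in>B. t b *\<^sub>R b"
  note sets = lebesgue_measure_on_sets[OF leb]
  obtain s where s: "w = (\<Sum>b\<in>B. s b *\<^sub>R b)" using w B span_finite[of B] by auto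
  have "subspace V" using B(3) subspace_span by blast
  then have meas: "(\<lambda>v. v + w) \<in> measurable (restrict_space borel V) (restrict_space borel V)"
    using w by (intro measurable_restrict_space3) (auto intro: subspace_add)
  have meas\<mu>: "(\<lambda>v. v + w) \<in> measurable \<mu> \<mu>"
    using meas measurable_cong_sets[OF sets(1) sets(1)] by blast
  let ?T = "\<lambda>t. \<lambda>b\<in>B. t b + s b"
  have T: "?T \<in> measurable ?P ?P" by measurable
  have gT: "?g (?T t) = ?g t + w" for t
    by (simp add: s scaleR_add_left sum.distrib)
  have em: "emeasure \<mu> A = ennreal c * emeasure ?P (?g -` A \<inter> space ?P)"
    if "A \<in> sets \<mu>" for A
    using that emeasure_distr[OF g, of A] sets(1) by (simp add: \<mu>)
  show ?thesis
  proof (rule measure_eqI)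
    fix A assume "A \<in> sets (distr \<mu> \<mu> (\<lambda>v. v + w))"
    then have A: "A \<in> sets \<mu>" by simp
    have gA: "?g -` A \<inter> space ?P \<in> sets ?P" using measurable_sets[OF g, of A] A sets(1) by simp
    have Aw: "(\<lambda>v. v + w) -` A \<inter> space \<mu> \<in> sets \<mu>" by (rule measurable_sets[OF meas\<mu> A])
    have gV: "?g t \<in> V" for t
      unfolding B(3)[symmetric] by (intro span_sum span_scale) (rule span_base)
    have "emeasure (distr \<mu> \<mu> (\<lambda>v. v + w)) A = emeasure \<mu> ((\<lambda>v. v + w) -` A \<inter> space \<mu>)"
      by (rule emeasure_distr[OF meas\<mu> A])
    also have "\<dots> = ennreal c * emeasure ?P (?g -` ((\<lambda>v. v + w) -` A \<inter> space \<mu>) \<inter> space ?P)"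
      by (rule em[OF Aw])
    also have "?g -` ((\<lambda>v. v + w) -` A \<inter> space \<mu>) \<inter> space ?P
        = ?T -` (?g -` A \<inter> space ?P) \<inter> space ?P"
    proof (rule set_eqI)
      fix t
      have "?T t \<in> space ?P" if "t \<in> space ?P" using measurable_space[OF T that] .
      then show "t \<in> ?g -` ((\<lambda>v. v + w) -` A \<inter> space \<mu>) \<inter> space ?P
          \<longleftrightarrow> t \<in> ?T -` (?g -` A \<inter> space ?P) \<inter> space ?P"
        using gV[of t] sets(2) by (simp only: vimage_eq Int_iff gT) blast
    qed
    also have "emeasure ?P \<dots> = emeasure (distr ?P ?P ?T) (?g -` A \<inter> space ?P)"
      by (rule emeasure_distr[OF T gA, symmetric])
    also have "\<dots> = emeasure ?P (?g -` A \<inter> space ?P)" unfolding PiM_lborel_translate[OF B(1)] ..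
    also have "ennreal c * \<dots> = emeasure \<mu> A" by (rule em[OF A, symmetric])
    finally show "emeasure (distr \<mu> \<mu> (\<lambda>v. v + w)) A = emeasure \<mu> A" .
  qed simp
qed

lemma lebesgue_measure_on_cball:
  fixes V :: "'v::euclidean_space set"
  assumes leb: "lebesgue_measure_on V \<mu>"
  shows "V \<inter> cball 0 R \<in> sets \<mu>" "emeasure \<mu> (V \<inter> cball 0 R) < \<infinity>"
proof -
  obtain B c where B: "finite B" "independent B" "span B = V"
    and g: "(\<lambda>t. \<Sum>b\<in>B. t b *\<^sub>R b) \<in> measurable (PiM B (\<lambda>_. lborel)) (restrict_space borel V)"
    and \<mu>: "\<mu> = scale_measure (ennreal c) (distr (PiM B (\<lambda>_. lborel)) (restrict_space borel V) (\<lambda>t. \<Sum>b\<in>B. t b *\<^sub>R b))"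
    by (rule lebesgue_measure_on_cases[OF leb])
  let ?P = "PiM B (\<lambda>_. lborel :: real measure)" and ?g = "\<lambda>t. \<Sum>b\<in>B. t b *\<^sub>R b"
  interpret product_sigma_finite "\<lambda>_ :: 'v. lborel :: real measure" ..
  note sets = lebesgue_measure_on_sets[OF leb]
  have "cball 0 R \<inter> V \<in> sets (restrict_space borel V)" 
    unfolding sets_restrict_space by (intro image_eqI[of _ _ "cball 0 R"]) auto
  then show S: "V \<inter> cball 0 R \<in> sets \<mu>" by (simp add: sets(1) Int_commute)
  obtain d where d: "\<And>b b'. b' \<in> B \<Longrightarrow> d b \<bullet> b' = of_bool (b' = b)"
    using dual_vectors_exist[OF B(2)] by blast
  have coord: "d b \<bullet> ?g t = t b" if "b \<in> B" for b t
    using that B(1) by (simp add: inner_sum_right d)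
  have sub: "?g -` (V \<inter> cball 0 R) \<inter> space ?P \<subseteq> (\<Pi>\<^sub>E b\<in>B. {- (norm (d b) * R)..norm (d b) * R})"
  proof
    fix t assume t: "t \<in> ?g -` (V \<inter> cball 0 R) \<inter> space ?P"
    have "\<bar>t b\<bar> \<le> norm (d b) * R" if "b \<in> B" for b
    proof -
      have "\<bar>t b\<bar> \<le> norm (d b) * norm (?g t)" unfolding coord[OF that, of t, symmetric] by (rule Cauchy_Schwarz_ineq2)
      also have "\<dots> \<le> norm (d b) * R" using t by (intro mult_left_mono) auto
      finally show ?thesis .
    qed
    then show "t \<in> (\<Pi>\<^sub>E b\<in>B. {- (norm (d b) * R)..norm (d b) * R})"
      using t by (auto simp: space_PiM PiE_iff abs_le_iff minus_le_iff)
  qed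
  have "emeasure \<mu> (V \<inter> cball 0 R) = ennreal c * emeasure ?P (?g -` (V \<inter> cball 0 R) \<inter> space ?P)"
    using emeasure_distr[OF g, of "V \<inter> cball 0 R"] S sets(1) by (simp add: \<mu>)
  also have "\<dots> \<le> ennreal c * emeasure ?P (\<Pi>\<^sub>E b\<in>B. {- (norm (d b) * R)..norm (d b) * R})"
    using B(1) by (intro mult_left_mono emeasure_mono[OF sub] sets_PiM_I_finite) auto
  also have "emeasure ?P (\<Pi>\<^sub>E b\<in>B. {- (norm (d b) * R)..norm (d b) * R})
      = (\<Prod>b\<in>B. emeasure lborel {- (norm (d b) * R)..norm (d b) * R})"
    by (rule emeasure_PiM[OF B(1)]) simp
  also have "\<dots> = (\<Prod>b\<in>B. ennreal (max 0 (2 * (norm (d b) * R))))"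
  proof (rule prod.cong[OF refl])
    have "emeasure lborel {- r..r} = ennreal (max 0 (2 * r))" for r :: real
      by (auto simp: emeasure_lborel_Icc_eq max_def ennreal_neg)
    then show "emeasure lborel {- (norm (d b) * R)..norm (d b) * R} = ennreal (max 0 (2 * (norm (d b) * R)))" for b .
  qed
  also have "\<dots> = ennreal (\<Prod>b\<in>B. max 0 (2 * (norm (d b) * R)))" by (rule prod_ennreal) simp
  also have "ennreal c * \<dots> < \<infinity>" by (simp add: ennreal_mult_less_top)
  finally show "emeasure \<mu> (V \<inter> cball 0 R) < \<infinity>" .
qed

lemma fiber_translate:
  assumes "x \<in> fiber \<Phi> \<nu>" shows "y \<in> fiber \<Phi> \<nu> \<longleftrightarrow> y - x \<in> fiber \<Phi> 0"
  using assms by (auto simp: fiber_def scaleR_diff_left sum_subtractf)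

lemma fiber_axis:
  assumes "x \<in> fiber \<Phi> \<nu>" shows "x + axis j t \<in> fiber \<Phi> (\<nu> + t *\<^sub>R \<Phi> j)"
proof -
  have "(\<Sum>i\<in>UNIV. axis j t $ i *\<^sub>R \<Phi> i) = (\<Sum>i\<in>UNIV. if i = j then t *\<^sub>R \<Phi> j else 0)"
    by (intro sum.cong) (auto simp: axis_def)
  then show ?thesis using assms by (simp add: fiber_def scaleR_add_left sum.distrib)
qed

lemma fiber_nonempty:
  fixes \<Phi> :: "'n::finite \<Rightarrow> 'f::euclidean_space"
  assumes "span (range \<Phi>) = UNIV" shows "\<exists>x. x \<in> fiber \<Phi> \<nu>"
proof -
  let ?R = "range (\<lambda>x :: real ^ 'n. \<Sum>i\<in>UNIV. x $ i *\<^sub>R \<Phi> i)"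
  have "linear (\<lambda>x :: real ^ 'n. \<Sum>i\<in>UNIV. x $ i *\<^sub>R \<Phi> i)"
    by (intro linearI) (simp_all add: scaleR_add_left sum.distrib scaleR_sum_right)
  then have "subspace ?R" by (rule linear_subspace_image) (rule subspace_UNIV)
  moreover have "range \<Phi> \<subseteq> ?R"
  proof clarify
    fix j
    have "\<Phi> j = (\<Sum>i\<in>UNIV. axis j 1 $ i *\<^sub>R \<Phi> i)"
      using fiber_axis[of 0 \<Phi> 0 j 1] by (simp add: fiber_def)
    then show "\<Phi> j \<in> ?R" by blast
  qed
  ultimately have "span (range \<Phi>) \<subseteq> ?R" by (rule span_minimal[rotated])
  then have "\<nu> \<in> ?R" using assms by blast
  then show ?thesis by (auto simp: fiber_def)
qed

lemma fiber_0_add: "v \<in> fiber \<Phi> 0 \<Longrightarrow> x \<in> fiber \<Phi> \<nu> \<Longrightarrow> x + v \<in> fiber \<Phi> \<nu>"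
  by (simp add: fiber_def scaleR_add_left sum.distrib)

context
  fixes \<Phi> :: "'n::finite \<Rightarrow> 'f::euclidean_space" and \<mu> :: "(real ^ 'n) measure"
  assumes gen: "span (range \<Phi>) = UNIV" and leb: "lebesgue_measure_on (fiber \<Phi> 0) \<mu>"
begin

lemma fiber_measure_map:
  assumes "x \<in> fiber \<Phi> \<nu>"
  shows "(\<lambda>v. x + v) \<in> measurable \<mu> (restrict_space borel (fiber \<Phi> \<nu>))"
proof -
  have "(\<lambda>v. x + v) \<in> measurable (restrict_space borel (fiber \<Phi> 0)) (restrict_space borel (fiber \<Phi> \<nu>))"
    using assms by (intro measurable_restrict_space3) (auto intro: fiber_0_add)
  then show ?thesis
    using measurable_cong_sets[OF lebesgue_measure_on_sets(1)[OF leb] refl] by blast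
qed

text \<open>
Any base point may serve, because the measure on the direction space is invariant under translation.
\<close>

lemma fiber_measure_eq:
  assumes "x \<in> fiber \<Phi> \<nu>"
  shows "fiber_measure \<Phi> \<mu> \<nu> = distr \<mu> (restrict_space borel (fiber \<Phi> \<nu>)) (\<lambda>v. x + v)"
proof -
  define s where "s = (SOME x. x \<in> fiber \<Phi> \<nu>)"
  have s: "s \<in> fiber \<Phi> \<nu>" unfolding s_def by (rule someI_ex[OF fiber_nonempty[OF gen]])
  have w: "s - x \<in> fiber \<Phi> 0" using fiber_translate[OF assms] s by blast
  have meas: "(\<lambda>v. v + (s - x)) \<in> measurable \<mu> \<mu>"
  proof -
    have "(\<lambda>v. v + (s - x)) \<in> measurable (restrict_space borel (fiber \<Phi> 0)) (restrict_space borel (fiber \<Phi> 0))"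
      using w by (intro measurable_restrict_space3) (auto intro: fiber_0_add)
    then show ?thesis
      using measurable_cong_sets[OF lebesgue_measure_on_sets(1)[OF leb] lebesgue_measure_on_sets(1)[OF leb]] by blast
  qed
  have "fiber_measure \<Phi> \<mu> \<nu> = distr \<mu> (restrict_space borel (fiber \<Phi> \<nu>)) (\<lambda>v. s + v)"
    by (simp add: fiber_measure_def s_def)
  also have "(\<lambda>v. s + v) = (\<lambda>v. x + v) \<circ> (\<lambda>v. v + (s - x))" by (auto simp: o_def)
  also have "distr \<mu> (restrict_space borel (fiber \<Phi> \<nu>)) \<dots>
      = distr (distr \<mu> \<mu> (\<lambda>v. v + (s - x))) (restrict_space borel (fiber \<Phi> \<nu>)) (\<lambda>v. x + v)"
    by (rule distr_distr[OF fiber_measure_map[OF assms] meas, symmetric])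
  finally show ?thesis by (simp add: lebesgue_measure_on_translate[OF leb w])
qed

lemma fiber_measure_sets:
  "sets (fiber_measure \<Phi> \<mu> \<nu>) = sets (restrict_space borel (fiber \<Phi> \<nu>))"
  "space (fiber_measure \<Phi> \<mu> \<nu>) = fiber \<Phi> \<nu>"
  by (simp_all add: fiber_measure_def space_restrict_space)

lemma fiber_integral:
  assumes "x \<in> fiber \<Phi> \<nu>" "F \<in> borel_measurable borel"
  shows "(LINT y|fiber_measure \<Phi> \<mu> \<nu>. F y) = (LINT v|\<mu>. F (x + v) :: real)"
  unfolding fiber_measure_eq[OF assms(1)]
  by (intro integral_distr fiber_measure_map assms(1) measurable_restrict_space1 assms(2))

lemma borel_translate_measurable:
  assumes "F \<in> borel_measurable borel" shows "(\<lambda>v. F (x + v) :: real) \<in> borel_measurable \<mu>"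
proof -
  have "(\<lambda>v. F (x + v)) \<in> borel_measurable borel" using assms by measurable
  then have "(\<lambda>v. F (x + v)) \<in> borel_measurable (restrict_space borel (fiber \<Phi> 0))"
    by (rule measurable_restrict_space1)
  then show ?thesis using measurable_cong_sets[OF lebesgue_measure_on_sets(1)[OF leb] refl] by blast
qed

text \<open>
The integrand is bounded and vanishes outside a ball, which has finite measure.
\<close>

lemma proper_integrable:
  assumes F: "proper_on_fibers \<Phi> F" shows "integrable (fiber_measure \<Phi> \<mu> \<nu>) F"
proof -
  obtain x where x: "x \<in> fiber \<Phi> \<nu>" using fiber_nonempty[OF gen] by blast
  note meas = proper_on_fibersD(1)[OF F]
  obtain M where M: "\<And>y. norm (\<Sum>i\<in>UNIV. y $ i *\<^sub>R \<Phi> i) \<le> norm \<nu> \<Longrightarrow> F y \<noteq> 0 \<Longrightarrow> norm y \<le> M"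
    using proper_on_fibersD(2)[OF F] by blast
  obtain C where C: "\<And>y. norm y \<le> M \<Longrightarrow> \<bar>F y\<bar> \<le> C" using proper_on_fibersD(3)[OF F] by blast
  have small: "norm (x + v) \<le> M" if "v \<in> fiber \<Phi> 0" "F (x + v) \<noteq> 0" for v
    using M[of "x + v"] fiber_0_add[OF that(1) x] that(2) by (simp add: fiber_def)
  have "integrable \<mu> (\<lambda>v. F (x + v))"
  proof (rule integrableI_bounded_set[where A = "fiber \<Phi> 0 \<inter> cball 0 (M + norm x)" and B = "\<bar>C\<bar>"])
    show "AE v in \<mu>. v \<in> fiber \<Phi> 0 \<inter> cball 0 (M + norm x) \<longrightarrow> norm (F (x + v)) \<le> \<bar>C\<bar>"
    proof (intro AE_I2 impI)
      fix v assume v: "v \<in> fiber \<Phi> 0 \<inter> cball 0 (M + norm x)"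
      show "norm (F (x + v)) \<le> \<bar>C\<bar>"
        using small[of v] C[of "x + v"] v by (cases "F (x + v) = 0") auto
    qed
    show "AE v in \<mu>. v \<notin> fiber \<Phi> 0 \<inter> cball 0 (M + norm x) \<longrightarrow> F (x + v) = 0"
    proof (intro AE_I2 impI, rule ccontr)
      fix v assume v: "v \<in> space \<mu>" "v \<notin> fiber \<Phi> 0 \<inter> cball 0 (M + norm x)" "F (x + v) \<noteq> 0"
      then have v0: "v \<in> fiber \<Phi> 0" using lebesgue_measure_on_sets(2)[OF leb] by simp
      have "norm v \<le> norm (x + v) + norm x" using norm_triangle_ineq4[of "x + v" x] by simp
      also have "\<dots> \<le> M + norm x" using small[OF v0 v(3)] by simp
      finally show False using v(2) v0 by simp
    qed
  qed (use lebesgue_measure_on_cball[OF leb] borel_translate_measurable[OF meas] in auto)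
  then show ?thesis
    unfolding fiber_measure_eq[OF x]
    using integrable_distr_eq[OF fiber_measure_map[OF x] measurable_restrict_space1[OF meas]] by blast
qed

lemma fiber_integral_shift:
  assumes F: "proper_on_fibers \<Phi> F"
  shows "(LINT y|fiber_measure \<Phi> \<mu> \<nu>. F (y + axis j t)) = (LINT y|fiber_measure \<Phi> \<mu> (\<nu> + t *\<^sub>R \<Phi> j). F y)"
proof -
  obtain x where x: "x \<in> fiber \<Phi> \<nu>" using fiber_nonempty[OF gen] by blast
  note meas [measurable] = proper_on_fibersD(1)[OF F]
  have "(\<lambda>y. F (y + axis j t)) \<in> borel_measurable borel" by measurable
  then have "(LINT y|fiber_measure \<Phi> \<mu> \<nu>. F (y + axis j t)) = (LINT v|\<mu>. F ((x + v) + axis j t))"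
    by (rule fiber_integral[OF x])
  also have "\<dots> = (LINT v|\<mu>. F ((x + axis j t) + v))" by (simp add: algebra_simps)
  also have "\<dots> = (LINT y|fiber_measure \<Phi> \<mu> (\<nu> + t *\<^sub>R \<Phi> j). F y)"
    by (rule fiber_integral[OF fiber_axis[OF x] meas, symmetric])
  finally show ?thesis .
qed

text \<open>
Moving \<open>\<nu>\<close> amounts to moving one coordinate. For small \<open>t\<close> the integrands are bounded and live in
a common ball, so dominated convergence applies.
\<close>

lemma fiber_integral_right_continuous:
  assumes F: "proper_on_fibers \<Phi> F"
    and rc: "\<And>y. ((\<lambda>t. F (y + axis j t)) \<longlongrightarrow> F y) (at_right 0)"
  shows "((\<lambda>t. LINT y|fiber_measure \<Phi> \<mu> (\<nu> + t *\<^sub>R \<Phi> j). F y) \<longlongrightarrow> (LINT y|fiber_measure \<Phi> \<mu> \<nu>. F y)) (at_right 0)"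
proof (rule tendsto_at_right_sequentially[of 0 1])
  fix S :: "nat \<Rightarrow> real" assume S: "\<And>n. 0 < S n" "\<And>n. S n < 1" "S \<longlonglongrightarrow> 0"
  obtain x where x: "x \<in> fiber \<Phi> \<nu>" using fiber_nonempty[OF gen] by blast
  note meas = proper_on_fibersD(1)[OF F]
  obtain M where M: "\<And>y. norm (\<Sum>i\<in>UNIV. y $ i *\<^sub>R \<Phi> i) \<le> norm \<nu> + norm (\<Phi> j) \<Longrightarrow> F y \<noteq> 0 \<Longrightarrow> norm y \<le> M"
    using proper_on_fibersD(2)[OF F] by blast
  obtain C where C: "\<And>y. norm y \<le> M \<Longrightarrow> \<bar>F y\<bar> \<le> C" using proper_on_fibersD(3)[OF F] by blast
  let ?s = "\<lambda>n v. F ((x + axis j (S n)) + v)"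
  let ?w = "\<lambda>v. \<bar>C\<bar> * indicator (fiber \<Phi> 0 \<inter> cball 0 (M + norm x + 1)) v :: real"
  have "(\<lambda>n. LINT v|\<mu>. ?s n v) \<longlonglongrightarrow> (LINT v|\<mu>. F (x + v))"
  proof (rule integral_dominated_convergence[where w = ?w])
    show "integrable \<mu> ?w" using lebesgue_measure_on_cball[OF leb] by simp
    have "filterlim S (at_right 0) sequentially"
      using S by (auto simp: filterlim_at less_imp_neq[THEN not_sym])
    then have "(\<lambda>n. F ((x + v) + axis j (S n))) \<longlonglongrightarrow> F (x + v)" for v
      by (rule filterlim_compose[OF rc])
    then show "AE v in \<mu>. (\<lambda>n. ?s n v) \<longlonglongrightarrow> F (x + v)" by (simp add: algebra_simps)
    show "AE v in \<mu>. norm (?s n v) \<le> ?w v" for n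
    proof (rule AE_I2)
      fix v assume "v \<in> space \<mu>"
      then have v: "v \<in> fiber \<Phi> 0" using lebesgue_measure_on_sets(2)[OF leb] by simp
      let ?y = "(x + axis j (S n)) + v"
      show "norm (?s n v) \<le> ?w v"
      proof (cases "F ?y = 0")
        case False
        have "(\<Sum>i\<in>UNIV. ?y $ i *\<^sub>R \<Phi> i) = \<nu> + S n *\<^sub>R \<Phi> j"
          using fiber_0_add[OF v fiber_axis[OF x]] unfolding fiber_def by blast
        moreover have "norm (\<nu> + S n *\<^sub>R \<Phi> j) \<le> norm \<nu> + norm (\<Phi> j)"
          using norm_triangle_ineq[of \<nu> "S n *\<^sub>R \<Phi> j"] S(1,2)[of n] mult_left_le_one_le[of "norm (\<Phi> j)" "S n"]
          by simp
        ultimately have y: "norm ?y \<le> M" using M[of ?y] False by metis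
        have "norm v \<le> norm ?y + norm (x + axis j (S n))" using norm_triangle_ineq4[of ?y "x + axis j (S n)"] by simp
        also have "norm (x + axis j (S n)) \<le> norm x + norm (S n)"
        proof -
          have "axis j (S n) = S n *\<^sub>R axis j 1" by (simp add: vec_eq_iff axis_def)
          then show ?thesis using norm_triangle_ineq[of x "axis j (S n)"] by simp
        qed
        finally have "norm v \<le> M + norm x + 1" using y S(1,2)[of n] by simp
        then show ?thesis using C[OF y] v by simp
      qed simp
    qed
  qed (use borel_translate_measurable[OF meas] in auto)
  then show "(\<lambda>n. LINT y|fiber_measure \<Phi> \<mu> (\<nu> + S n *\<^sub>R \<Phi> j). F y) \<longlonglongrightarrow> (LINT y|fiber_measure \<Phi> \<mu> \<nu>. F y)"
    by (simp add: fiber_integral[OF fiber_axis[OF x] meas] fiber_integral[OF x meas])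
qed simp

end

section \<open>Polynomiality of the integral\<close>

lemma span_image_combination:
  fixes \<Phi> :: "'n::finite \<Rightarrow> 'f::euclidean_space"
  assumes "v \<in> span (\<Phi> ` S)" shows "\<exists>t. v = (\<Sum>k\<in>S. t k *\<^sub>R \<Phi> k)"
proof -
  let ?f = "\<lambda>x :: real ^ 'n. \<Sum>k\<in>S. x $ k *\<^sub>R \<Phi> k"
  have "linear ?f"
    by (intro linearI) (simp_all add: scaleR_add_left sum.distrib scaleR_sum_right)
  then have "subspace (range ?f)" by (rule linear_subspace_image) (rule subspace_UNIV)
  moreover have "\<Phi> ` S \<subseteq> range ?f"
  proof clarify
    fix j assume "j \<in> S"
    then have "?f (axis j 1) = (\<Sum>k\<in>S. if k = j then \<Phi> j else 0)"
      by (intro sum.cong) (auto simp: axis_def)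
    also have "\<dots> = \<Phi> j" using \<open>j \<in> S\<close> by simp
    finally show "\<Phi> j \<in> range ?f" by (intro range_eqI[of _ _ "axis j 1"]) simp
  qed
  ultimately have "span (\<Phi> ` S) \<subseteq> range ?f" by (rule span_minimal[rotated])
  with assms show ?thesis by blast
qed

text \<open>
A sufficiently small increase of a coordinate does not change whether it is negative. A decrease
may, which is why the continuity is one-sided.
\<close>

lemma XX_right_continuous:
  fixes \<Phi> :: "'n::finite \<Rightarrow> 'f::euclidean_space"
  assumes gen: "span (range \<Phi>) = UNIV" and t: "tope \<Phi> \<tau>" and h: "continuous_on UNIV h"
  shows "((\<lambda>t. XX \<Phi> \<tau> (y + axis k t) * h (y + axis k t)) \<longlongrightarrow> XX \<Phi> \<tau> y * h y) (at_right 0)"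
proof -
  obtain u where u: "u \<in> \<tau>" using tope_nonempty[OF t] by blast
  define b where "b = (if y $ k < 0 then - y $ k else 1)"
  have "XX \<Phi> \<tau> (y + axis k t) = XX \<Phi> \<tau> y" if "t \<in> {0<..<b}" for t
  proof -
    have "(y + axis k t) $ i < 0 \<longleftrightarrow> y $ i < 0" for i
      using that by (auto simp: axis_def b_def split: if_splits)
    then show ?thesis by (simp only: XX_eq_signed_count[OF gen _ u] t)
  qed
  moreover have "\<forall>\<^sub>F t in at_right 0. t \<in> {0<..<b}" by (rule eventually_at_right_real) (simp add: b_def)
  ultimately have ev: "\<forall>\<^sub>F t in at_right 0. XX \<Phi> \<tau> (y + axis k t) = XX \<Phi> \<tau> y"
    by (auto elim: eventually_mono)
  have "((\<lambda>t. axis k t :: real ^ 'n) \<longlongrightarrow> axis k 0) (at_right 0)"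
  proof (rule vec_tendstoI)
    fix i show "((\<lambda>t. axis k t $ i :: real) \<longlongrightarrow> axis k 0 $ i) (at_right 0)"
      by (cases "i = k") (simp_all add: axis_def)
  qed
  then have "((\<lambda>t. y + axis k t) \<longlongrightarrow> y + axis k 0) (at_right 0)" by (intro tendsto_intros)
  moreover have "axis k 0 = (0 :: real ^ 'n)" by (simp add: vec_eq_iff axis_def)
  ultimately have lim: "((\<lambda>t. y + axis k t) \<longlongrightarrow> y) (at_right 0)" by simp
  have "((\<lambda>t. XX \<Phi> \<tau> y * h (y + axis k t)) \<longlongrightarrow> XX \<Phi> \<tau> y * h y) (at_right 0)"
    by (intro tendsto_mult tendsto_const continuous_on_tendsto_compose[OF h lim]) auto
  then show ?thesis by (rule Lim_transform_eventually) (use ev in \<open>auto elim!: eventually_mono\<close>)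
qed

lemma basis_among_vectors:
  fixes \<Phi> :: "'n::finite \<Rightarrow> 'f::euclidean_space"
  assumes "span (range \<Phi>) = UNIV"
  obtains B where "B \<subseteq> range \<Phi>" "independent B" "span B = UNIV"
proof -
  obtain B where B: "B \<subseteq> range \<Phi>" "independent B" "range \<Phi> \<subseteq> span B"
    using maximal_independent_subset[of "range \<Phi>"] by blast
  have "span (range \<Phi>) \<subseteq> span B" using B(3) by (rule span_minimal) (rule subspace_span)
  then show thesis using that B assms by blast
qed

context
  fixes \<Phi> :: "'n::finite \<Rightarrow> 'f::euclidean_space" and \<mu> :: "(real ^ 'n) measure"
  assumes gen: "span (range \<Phi>) = UNIV" and leb: "lebesgue_measure_on (fiber \<Phi> 0) \<mu>"
    and pt: "pointed \<Phi>"
begin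

lemma I_int_polynomial:
  assumes t: "tope \<Phi> \<tau>" and h: "real_polynomial_function h"
  shows "real_polynomial_function (I_int \<Phi> \<mu> \<tau> h)"
proof -
  let ?L = "\<lambda>F \<nu>. LINT y|fiber_measure \<Phi> \<mu> \<nu>. F y"
  have I: "I_int \<Phi> \<mu> \<tau> h = ?L (\<lambda>x. XX \<Phi> \<tau> x * h x)" by (auto simp: I_int_def)
  have c: "continuous_on UNIV h"
    by (rule continuous_on_polymonial_function[OF h[unfolded real_polynomial_function_eq]])
  have proper: "proper_on_fibers \<Phi> (\<lambda>x. XX \<Phi> \<tau> x * h x)" by (rule XX_proper[OF gen pt t c])
  have "\<exists>m. diff_nilpotent UNIV m (?L (\<lambda>x. XX \<Phi> \<tau> x * h x))"
  proof (rule XX_operator_diff_nilpotent[where L = ?L and T = UNIV and E = UNIV, OF gen pt t h])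
    show "?L (\<lambda>x. F x + G x) \<nu> = ?L F \<nu> + ?L G \<nu>"
      if "proper_on_fibers \<Phi> F" "proper_on_fibers \<Phi> G" for F G \<nu>
      by (intro Bochner_Integration.integral_add proper_integrable[OF gen leb] that)
    show "?L (\<lambda>x. F (x + axis j t)) \<nu> = ?L F (\<nu> + t *\<^sub>R \<Phi> j)"
      if "proper_on_fibers \<Phi> F" for F j t \<nu>
      by (rule fiber_integral_shift[OF gen leb that])
    show "\<exists>t. (\<forall>k\<in>S. t k \<in> UNIV) \<and> v = (\<Sum>k\<in>S. t k *\<^sub>R \<Phi> k)" if "span (\<Phi> ` S) = UNIV" for S v
      using span_image_combination[of v \<Phi> S] that by simp
  qed simp
  then obtain m where nil: "diff_nilpotent UNIV m (I_int \<Phi> \<mu> \<tau> h)" unfolding I by blast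
  obtain B where B: "B \<subseteq> range \<Phi>" "independent B" "span B = UNIV"
    by (rule basis_among_vectors[OF gen])
  have rc: "((\<lambda>t. I_int \<Phi> \<mu> \<tau> h (x + t *\<^sub>R b)) \<longlongrightarrow> I_int \<Phi> \<mu> \<tau> h x) (at_right 0)" if b: "b \<in> B" for x b
  proof -
    obtain k where "b = \<Phi> k" using B(1) b by blast
    then show ?thesis
      unfolding I using fiber_integral_right_continuous[OF gen leb proper XX_right_continuous[OF gen t c]] by blast
  qed
  have "\<exists>p. real_polynomial_function p \<and> (\<forall>s. (\<forall>b\<in>B. s b \<in> UNIV) \<longrightarrow>
      I_int \<Phi> \<mu> \<tau> h (0 + (\<Sum>b\<in>B. s b *\<^sub>R b)) = p (\<Sum>b\<in>B. s b *\<^sub>R b))"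
    by (rule polynomial_along_basis[OF B(2), where m = m]) (intro newton_expansion_real[OF nil rc])
  then obtain p where p: "real_polynomial_function p"
    "\<forall>s. (\<forall>b\<in>B. s b \<in> UNIV) \<longrightarrow>
      I_int \<Phi> \<mu> \<tau> h (0 + (\<Sum>b\<in>B. s b *\<^sub>R b)) = p (\<Sum>b\<in>B. s b *\<^sub>R b)"
    by blast
  have "I_int \<Phi> \<mu> \<tau> h \<nu> = p \<nu>" for \<nu>
  proof -
    have "\<nu> \<in> range (\<lambda>s. \<Sum>b\<in>B. s b *\<^sub>R b)"
      using span_finite[OF independent_imp_finite[OF B(2)]] B(3) by simp
    then obtain s where s: "\<nu> = (\<Sum>b\<in>B. s b *\<^sub>R b)" by blast
    show ?thesis using p(2)[rule_format, of s] unfolding s by simp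
  qed
  then have "I_int \<Phi> \<mu> \<tau> h = p" by blast
  then show ?thesis using p(1) by simp
qed

lemma I_int_eq_polytope_integral:
  assumes "\<And>x. x \<in> fiber \<Phi> \<nu> \<Longrightarrow> XX \<Phi> \<tau> x = of_bool (\<forall>i. 0 \<le> x $ i)"
  shows "I_int \<Phi> \<mu> \<tau> h \<nu> = (LINT x:partition_polytope \<Phi> \<nu>|fiber_measure \<Phi> \<mu> \<nu>. h x)"
  unfolding I_int_def set_lebesgue_integral_def
  by (intro Bochner_Integration.integral_cong refl)
     (auto simp: fiber_measure_sets[OF gen leb] assms partition_polytope_def)

text \<open>
As \<open>A\<close> is nonempty, the two polytopes are disjoint, and on each of them \<open>h\<close> is up to sign the
integrable function \<open>XX \<Phi> \<tau> x * h x\<close>. This makes the two integrals on the right meaningful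
separately.
\<close>

lemma I_int_eq_polytope_difference:
  assumes t: "tope \<Phi> \<tau>" and h: "continuous_on UNIV h" and A: "A \<noteq> {}"
    and XX: "\<And>x. x \<in> fiber \<Phi> \<nu> \<Longrightarrow> XX \<Phi> \<tau> x = of_bool (\<forall>i. 0 \<le> x $ i)
      - (-1) ^ card A * of_bool ((\<forall>i\<in>A. x $ i < 0) \<and> (\<forall>i. i \<notin> A \<longrightarrow> 0 \<le> x $ i))"
  shows "I_int \<Phi> \<mu> \<tau> h \<nu> = (LINT x:partition_polytope \<Phi> \<nu>|fiber_measure \<Phi> \<mu> \<nu>. h x)
    - (-1) ^ card A * (LINT x:flipped_polytope \<Phi> A \<nu>|fiber_measure \<Phi> \<mu> \<nu>. h x)"
proof -
  let ?M = "fiber_measure \<Phi> \<mu> \<nu>" and ?F = "\<lambda>x. XX \<Phi> \<tau> x * h x"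
  let ?P = "partition_polytope \<Phi> \<nu>" and ?Q = "flipped_polytope \<Phi> A \<nu>"
  let ?s = "(-1) ^ card A :: real"
  have F: "integrable ?M ?F" by (rule proper_integrable[OF gen leb XX_proper[OF gen pt t h]])
  have m: "(\<lambda>x. x $ i) \<in> borel_measurable (borel :: (real ^ 'n) measure)" for i
    by (intro borel_measurable_continuous_onI continuous_intros)
  have "{x. \<forall>i. 0 \<le> x $ i} \<in> sets (borel :: (real ^ 'n) measure)" 
    using m by measurable
  then have P: "?P \<in> sets ?M"
    unfolding fiber_measure_sets[OF gen leb] sets_restrict_space
    by (intro image_eqI[of _ _ "{x. \<forall>i. 0 \<le> x $ i}"]) (auto simp: partition_polytope_def)
  have "{x. (\<forall>i\<in>A. x $ i < 0) \<and> (\<forall>i. i \<notin> A \<longrightarrow> 0 \<le> x $ i)} \<in> sets (borel :: (real ^ 'n) measure)"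
    using m by measurable
  then have Q: "?Q \<in> sets ?M"
    unfolding fiber_measure_sets[OF gen leb] sets_restrict_space
    by (intro image_eqI[of _ _ "{x. (\<forall>i\<in>A. x $ i < 0) \<and> (\<forall>i. i \<notin> A \<longrightarrow> 0 \<le> x $ i)}"])
       (auto simp: flipped_polytope_def)
  have iP: "integrable ?M (\<lambda>x. indicator ?P x *\<^sub>R ?F x)" and iQ: "integrable ?M (\<lambda>x. indicator ?Q x *\<^sub>R ?F x)"
    using integrable_mult_indicator[OF P F] integrable_mult_indicator[OF Q F] by auto
  obtain j where j: "j \<in> A" using A by blast
  have disj: "\<not> (\<forall>i. 0 \<le> x $ i) \<or> \<not> (\<forall>i\<in>A. x $ i < 0)" for x :: "real ^ 'n"
    using j by (meson not_less)
  have XX_P: "XX \<Phi> \<tau> x = 1" if "x \<in> ?P" for x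
  proof -
    have x: "x \<in> fiber \<Phi> \<nu>" "\<forall>i. 0 \<le> x $ i" using that by (auto simp: partition_polytope_def)
    then have "\<not> ((\<forall>i\<in>A. x $ i < 0) \<and> (\<forall>i. i \<notin> A \<longrightarrow> 0 \<le> x $ i))" using disj by blast
    then show ?thesis using XX[OF x(1)] x(2) by (simp only: of_bool_eq) simp
  qed
  have XX_Q: "XX \<Phi> \<tau> x = - ?s" if "x \<in> ?Q" for x
  proof -
    have x: "x \<in> fiber \<Phi> \<nu>" "(\<forall>i\<in>A. x $ i < 0) \<and> (\<forall>i. i \<notin> A \<longrightarrow> 0 \<le> x $ i)"
      using that by (auto simp: flipped_polytope_def)
    then have "\<not> (\<forall>i. 0 \<le> x $ i)" using disj by blast
    then show ?thesis using XX[OF x(1)] x(2) by (simp only: of_bool_eq) simp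
  qed
  have onP: "indicator ?P x *\<^sub>R ?F x = indicator ?P x *\<^sub>R h x" for x
    using XX_P[of x] by (simp add: indicator_def)
  have onQ: "indicator ?Q x *\<^sub>R ?F x = - ?s * (indicator ?Q x *\<^sub>R h x)" for x
    using XX_Q[of x] by (simp add: indicator_def)
  have "I_int \<Phi> \<mu> \<tau> h \<nu> = (LINT x|?M. indicator ?P x *\<^sub>R ?F x + indicator ?Q x *\<^sub>R ?F x)"
    unfolding I_int_def
  proof (intro Bochner_Integration.integral_cong refl)
    fix x assume "x \<in> space ?M"
    then have x: "x \<in> fiber \<Phi> \<nu>" by (simp add: fiber_measure_sets[OF gen leb])
    show "?F x = indicator ?P x *\<^sub>R ?F x + indicator ?Q x *\<^sub>R ?F x"
    proof (cases "x \<in> ?P \<or> x \<in> ?Q")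
      case True
      moreover have "\<not> (x \<in> ?P \<and> x \<in> ?Q)"
        using disj[of x] unfolding partition_polytope_def flipped_polytope_def by blast
      ultimately show ?thesis by (auto simp: indicator_def)
    next
      case False
      then have "\<not> (\<forall>i. 0 \<le> x $ i)" "\<not> ((\<forall>i\<in>A. x $ i < 0) \<and> (\<forall>i. i \<notin> A \<longrightarrow> 0 \<le> x $ i))"
        using x unfolding partition_polytope_def flipped_polytope_def by blast+
      then have "XX \<Phi> \<tau> x = 0" unfolding XX[OF x] by (simp only: of_bool_eq)
      then show ?thesis by simp
    qed
  qed
  also have "\<dots> = (LINT x|?M. indicator ?P x *\<^sub>R ?F x) + (LINT x|?M. indicator ?Q x *\<^sub>R ?F x)"
    by (rule Bochner_Integration.integral_add[OF iP iQ])
  also have "(LINT x|?M. indicator ?P x *\<^sub>R ?F x) = (LINT x|?M. indicator ?P x *\<^sub>R h x)"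
    unfolding onP ..
  also have "(LINT x|?M. indicator ?Q x *\<^sub>R ?F x) = (LINT x|?M. - ?s * (indicator ?Q x *\<^sub>R h x))"
    unfolding onQ ..
  also have "\<dots> = - ?s * (LINT x|?M. indicator ?Q x *\<^sub>R h x)" by (rule integral_mult_right_zero)
  finally show ?thesis by (simp add: set_lebesgue_integral_def)
qed

end

section \<open>Sums over lattice points\<close>

lemma finite_integer_points: "finite {x :: real ^ 'n::finite. x \<in> integer_points \<and> norm x \<le> M}"
proof (rule finite_surj)
  show "finite (PiE (UNIV :: 'n set) (\<lambda>_. {- \<lceil>M\<rceil>..\<lceil>M\<rceil>}))" by (intro finite_PiE) auto
  show "{x :: real ^ 'n. x \<in> integer_points \<and> norm x \<le> M}
      \<subseteq> (\<lambda>f. \<chi> i. of_int (f i)) ` PiE UNIV (\<lambda>_. {- \<lceil>M\<rceil>..\<lceil>M\<rceil>})"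
  proof clarify
    fix x :: "real ^ 'n" assume x: "x \<in> integer_points" "norm x \<le> M"
    have int: "x $ i = of_int \<lfloor>x $ i\<rfloor>" for i using x(1) by (simp add: integer_points_def)
    have "\<lfloor>x $ i\<rfloor> \<in> {- \<lceil>M\<rceil>..\<lceil>M\<rceil>}" for i
    proof -
      have "of_int \<bar>\<lfloor>x $ i\<rfloor>\<bar> \<le> M" using component_le_norm_cart[of x i] x(2) int[of i] by simp
      then have "\<bar>\<lfloor>x $ i\<rfloor>\<bar> \<le> \<lceil>M\<rceil>" by linarith
      then show ?thesis by auto
    qed
    then show "x \<in> (\<lambda>f. \<chi> i. of_int (f i)) ` PiE UNIV (\<lambda>_. {- \<lceil>M\<rceil>..\<lceil>M\<rceil>})"
      using int by (intro image_eqI[of _ _ "\<lambda>i. \<lfloor>x $ i\<rfloor>"]) (auto simp: vec_eq_iff)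
  qed
qed

lemma proper_summable:
  assumes F: "proper_on_fibers \<Phi> F" shows "F summable_on (fiber \<Phi> \<nu> \<inter> integer_points)"
proof (rule finite_nonzero_values_imp_summable_on)
  obtain M where M: "\<And>y. norm (\<Sum>i\<in>UNIV. y $ i *\<^sub>R \<Phi> i) \<le> norm \<nu> \<Longrightarrow> F y \<noteq> 0 \<Longrightarrow> norm y \<le> M"
    using proper_on_fibersD(2)[OF F] by blast
  show "finite {x \<in> fiber \<Phi> \<nu> \<inter> integer_points. F x \<noteq> 0}"
    by (rule finite_subset[OF _ finite_integer_points[of M]]) (auto simp: fiber_def intro: M)
qed

lemma lattice_sum_shift:
  fixes \<Phi> :: "'n::finite \<Rightarrow> 'f::euclidean_space" and F :: "real ^ 'n \<Rightarrow> real"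
  assumes t: "t \<in> \<int>"
  shows "(\<Sum>\<^sub>\<infinity>x\<in>fiber \<Phi> \<nu> \<inter> integer_points. F (x + axis j t))
    = (\<Sum>\<^sub>\<infinity>x\<in>fiber \<Phi> (\<nu> + t *\<^sub>R \<Phi> j) \<inter> integer_points. F x)"
proof (rule infsum_reindex_bij_betw)
  have int: "x + axis j s \<in> integer_points" if "s \<in> \<int>" "x \<in> integer_points" for x :: "real ^ 'n" and s
    using that by (auto simp: integer_points_def axis_def)
  have inv: "x + axis j s + axis j (- s) = x" for x :: "real ^ 'n" and s
    by (simp add: vec_eq_iff axis_def)
  show "bij_betw (\<lambda>x. x + axis j t) (fiber \<Phi> \<nu> \<inter> integer_points)
      (fiber \<Phi> (\<nu> + t *\<^sub>R \<Phi> j) \<inter> integer_points)"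
  proof (rule bij_betwI[of _ _ _ "\<lambda>x. x + axis j (- t)"])
    show "(\<lambda>x. x + axis j t) \<in> fiber \<Phi> \<nu> \<inter> integer_points \<rightarrow> fiber \<Phi> (\<nu> + t *\<^sub>R \<Phi> j) \<inter> integer_points"
      using int[OF t] fiber_axis[of _ \<Phi> \<nu> j t] by blast
    show "(\<lambda>x. x + axis j (- t)) \<in> fiber \<Phi> (\<nu> + t *\<^sub>R \<Phi> j) \<inter> integer_points \<rightarrow> fiber \<Phi> \<nu> \<inter> integer_points"
      using int[of "- t"] t fiber_axis[of _ \<Phi> "\<nu> + t *\<^sub>R \<Phi> j" j "- t"] by fastforce
  qed (use inv[of _ t] inv[of _ "- t"] in auto)
qed

text \<open>
The lattice with basis \<open>D\<close> in the sense of \<open>full_lattice\<close>, for spanning independent \<open>D\<close>.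
\<close>

definition int_span :: "'v::real_vector set \<Rightarrow> 'v set" where
  "int_span D = {(\<Sum>b\<in>D. of_int (c b) *\<^sub>R b) | c :: 'v \<Rightarrow> int. True}"

lemma int_span_sum: "(\<Sum>b\<in>D. of_int (c b) *\<^sub>R b) \<in> int_span D"
  by (auto simp: int_span_def)

lemma int_span_add: "x \<in> int_span D \<Longrightarrow> y \<in> int_span D \<Longrightarrow> x + y \<in> int_span D"
proof -
  assume "x \<in> int_span D" "y \<in> int_span D"
  then obtain c d where "x = (\<Sum>b\<in>D. of_int (c b) *\<^sub>R b)" "y = (\<Sum>b\<in>D. of_int (d b) *\<^sub>R b)"
    by (auto simp: int_span_def)
  then have "x + y = (\<Sum>b\<in>D. of_int (c b + d b) *\<^sub>R b)" by (simp add: scaleR_add_left sum.distrib)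
  then show ?thesis by (simp only: int_span_sum)
qed

lemma int_span_scale: "x \<in> int_span D \<Longrightarrow> of_int n *\<^sub>R x \<in> int_span D"
proof -
  assume "x \<in> int_span D"
  then obtain c where "x = (\<Sum>b\<in>D. of_int (c b) *\<^sub>R b)" by (auto simp: int_span_def)
  then have "of_int n *\<^sub>R x = (\<Sum>b\<in>D. of_int (n * c b) *\<^sub>R b)" by (simp add: scaleR_sum_right)
  then show ?thesis by (simp only: int_span_sum)
qed

lemma int_span_sum_mem: "(\<And>k. k \<in> S \<Longrightarrow> f k \<in> int_span D) \<Longrightarrow> (\<Sum>k\<in>S. of_int (c k) *\<^sub>R f k) \<in> int_span D"
proof (induction S rule: infinite_finite_induct)
  case (infinite A)
  then show ?case using int_span_sum[of "\<lambda>_. 0" D] by simp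
next
  case empty
  then show ?case using int_span_sum[of "\<lambda>_. 0" D] by simp
next
  case (insert x F)
  then show ?case by (simp add: int_span_add int_span_scale)
qed

lemma int_span_base: "finite D \<Longrightarrow> b \<in> D \<Longrightarrow> b \<in> int_span D"
proof -
  assume "finite D" "b \<in> D"
  then have "(\<Sum>b'\<in>D. of_int (of_bool (b' = b)) *\<^sub>R b') = (\<Sum>b'\<in>D. if b' = b then b else 0)"
    by (intro sum.cong) auto
  also have "\<dots> = b" using \<open>finite D\<close> \<open>b \<in> D\<close> by simp
  finally show ?thesis using int_span_sum[of "\<lambda>b'. of_bool (b' = b)" D] by metis
qed

lemma finite_int_span_bounded:
  fixes D :: "'f::euclidean_space set"
  assumes D: "independent D" shows "finite {x \<in> int_span D. norm x \<le> R}"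
proof -
  have finD: "finite D" using D by (rule independent_imp_finite)
  obtain d where d: "\<And>b b'. b' \<in> D \<Longrightarrow> d b \<bullet> b' = of_bool (b' = b)"
    using dual_vectors_exist[OF D] by blast
  show ?thesis
  proof (rule finite_surj)
    show "finite (PiE D (\<lambda>b. {- \<lceil>norm (d b) * R\<rceil>..\<lceil>norm (d b) * R\<rceil>}))"
      using finD by (intro finite_PiE) auto
    show "{x \<in> int_span D. norm x \<le> R}
        \<subseteq> (\<lambda>c. \<Sum>b\<in>D. of_int (c b) *\<^sub>R b) ` PiE D (\<lambda>b. {- \<lceil>norm (d b) * R\<rceil>..\<lceil>norm (d b) * R\<rceil>})"
    proof clarify
      fix x assume x: "x \<in> int_span D" "norm x \<le> R"
      obtain c where c: "x = (\<Sum>b\<in>D. of_int (c b) *\<^sub>R b)" using x(1) by (auto simp: int_span_def)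
      have bound: "c b \<in> {- \<lceil>norm (d b) * R\<rceil>..\<lceil>norm (d b) * R\<rceil>}" if b: "b \<in> D" for b
      proof -
        have "d b \<bullet> x = of_int (c b)" using b finD by (simp add: c inner_sum_right d)
        then have "\<bar>of_int (c b)\<bar> \<le> norm (d b) * norm x" using Cauchy_Schwarz_ineq2[of "d b" x] by simp
        also have "\<dots> \<le> norm (d b) * R" using x(2) by (intro mult_left_mono) auto
        finally have "of_int \<bar>c b\<bar> \<le> norm (d b) * R" by simp
        then have "\<bar>c b\<bar> \<le> \<lceil>norm (d b) * R\<rceil>" by linarith
        then show ?thesis by auto
      qed
      have "x = (\<Sum>b\<in>D. of_int (restrict c D b) *\<^sub>R b)" unfolding c by (intro sum.cong) auto
      moreover have "restrict c D \<in> PiE D (\<lambda>b. {- \<lceil>norm (d b) * R\<rceil>..\<lceil>norm (d b) * R\<rceil>})"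
        using bound by (intro restrict_PiE_iff[THEN iffD2]) blast
      ultimately show "x \<in> (\<lambda>c. \<Sum>b\<in>D. of_int (c b) *\<^sub>R b) ` PiE D (\<lambda>b. {- \<lceil>norm (d b) * R\<rceil>..\<lceil>norm (d b) * R\<rceil>})"
        by blast
    qed
  qed
qed

text \<open>
Write \<open>v\<close> with real coefficients. The multiples \<open>n *\<^sub>R v\<close>, reduced by the integral parts of their
coefficients, are lattice points in a bounded region, so two of them coincide.
\<close>

lemma multiple_in_sublattice:
  fixes \<Phi> :: "'n::finite \<Rightarrow> 'f::euclidean_space"
  assumes D: "independent D" and \<Phi>: "\<Phi> ` S \<subseteq> int_span D" and S: "span (\<Phi> ` S) = UNIV" and v: "v \<in> int_span D"
  shows "\<exists>n t. 0 < (n::nat) \<and> of_nat n *\<^sub>R v = (\<Sum>k\<in>S. of_int (t k) *\<^sub>R \<Phi> k)"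
proof -
  obtain q where q: "v = (\<Sum>k\<in>S. q k *\<^sub>R \<Phi> k)" using span_image_combination[of v \<Phi> S] S by auto
  define y where "y n = (\<Sum>k\<in>S. frac (real n * q k) *\<^sub>R \<Phi> k)" for n :: nat
  have y: "y n = of_nat n *\<^sub>R v - (\<Sum>k\<in>S. of_int \<lfloor>real n * q k\<rfloor> *\<^sub>R \<Phi> k)" for n
    by (simp add: y_def q frac_def scaleR_diff_left sum_subtractf scaleR_sum_right)
  have "range y \<subseteq> {x \<in> int_span D. norm x \<le> (\<Sum>k\<in>S. norm (\<Phi> k))}"
  proof clarify
    fix n
    have "norm (frac r *\<^sub>R \<Phi> k) \<le> norm (\<Phi> k)" for r k
      using mult_left_le_one_le[of "norm (\<Phi> k)" "frac r"] less_imp_le[OF frac_lt_1[of r]]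
      by (simp add: abs_of_nonneg[OF frac_ge_0])
    then have "norm (y n) \<le> (\<Sum>k\<in>S. norm (\<Phi> k))"
      unfolding y_def by (intro sum_norm_le)
    moreover have "y n \<in> int_span D"
    proof -
      have "(\<Sum>k\<in>S. of_int (- \<lfloor>real n * q k\<rfloor>) *\<^sub>R \<Phi> k) \<in> int_span D"
        using \<Phi> by (intro int_span_sum_mem) auto
      moreover have "of_nat n *\<^sub>R v \<in> int_span D" using int_span_scale[OF v, of "int n"] by simp
      moreover have "y n = of_nat n *\<^sub>R v + (\<Sum>k\<in>S. of_int (- \<lfloor>real n * q k\<rfloor>) *\<^sub>R \<Phi> k)"
        unfolding y by (simp add: sum_negf)
      ultimately show ?thesis by (simp only: int_span_add)
    qed
    ultimately show "y n \<in> int_span D \<and> norm (y n) \<le> (\<Sum>k\<in>S. norm (\<Phi> k))" by blast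
  qed
  then have "finite (range y)" using finite_int_span_bounded[OF D] by (rule finite_subset)
  then have "\<not> inj y" using finite_imageD[of y UNIV] by auto
  then obtain m n where mn: "m < n" "y m = y n" unfolding inj_def by (metis neqE)
  have "of_nat (n - m) *\<^sub>R v = of_nat n *\<^sub>R v - of_nat m *\<^sub>R v"
    using mn(1) by (simp add: of_nat_diff scaleR_diff_left)
  also have "\<dots> = (\<Sum>k\<in>S. of_int (\<lfloor>real n * q k\<rfloor> - \<lfloor>real m * q k\<rfloor>) *\<^sub>R \<Phi> k)"
    using mn(2) unfolding y by (simp add: scaleR_diff_left sum_subtractf algebra_simps)
  finally have "of_nat (n - m) *\<^sub>R v = (\<Sum>k\<in>S. of_int (\<lfloor>real n * q k\<rfloor> - \<lfloor>real m * q k\<rfloor>) *\<^sub>R \<Phi> k)" .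
  moreover have "0 < n - m" using mn(1) by simp
  ultimately show ?thesis
    by (intro exI[of _ "n - m"] exI[of _ "\<lambda>k. \<lfloor>real n * q k\<rfloor> - \<lfloor>real m * q k\<rfloor>"] conjI)
qed

lemma int_span_scaled:
  fixes D :: "'v::real_vector set"
  assumes "0 < (N::nat)"
  shows "int_span ((*\<^sub>R) (real N) ` D) = (*\<^sub>R) (real N) ` int_span D"
proof -
  have inj: "inj_on ((*\<^sub>R) (real N)) D" using assms by (auto simp: inj_on_def)
  have eq: "(\<Sum>b\<in>(*\<^sub>R) (real N) ` D. of_int (c b) *\<^sub>R b) = real N *\<^sub>R (\<Sum>b\<in>D. of_int (c (real N *\<^sub>R b)) *\<^sub>R b)" for c
    by (simp add: sum.reindex[OF inj] scaleR_sum_right mult.commute)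
  show ?thesis
  proof (intro equalityI subsetI)
    fix x assume "x \<in> int_span ((*\<^sub>R) (real N) ` D)"
    then obtain c where "x = (\<Sum>b\<in>(*\<^sub>R) (real N) ` D. of_int (c b) *\<^sub>R b)" by (auto simp: int_span_def)
    then have "x = real N *\<^sub>R (\<Sum>b\<in>D. of_int (c (real N *\<^sub>R b)) *\<^sub>R b)" by (simp only: eq)
    then show "x \<in> (*\<^sub>R) (real N) ` int_span D" by (simp only:) (intro imageI int_span_sum)
  next
    fix x assume "x \<in> (*\<^sub>R) (real N) ` int_span D"
    then obtain c where c: "x = real N *\<^sub>R (\<Sum>b\<in>D. of_int (c b) *\<^sub>R b)" by (auto simp: int_span_def)
    have "(\<Sum>b\<in>D. of_int (c ((1 / real N) *\<^sub>R (real N *\<^sub>R b))) *\<^sub>R b) = (\<Sum>b\<in>D. of_int (c b) *\<^sub>R b)"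
      using assms by (intro sum.cong refl) simp
    then have "x = (\<Sum>b\<in>(*\<^sub>R) (real N) ` D. of_int (c ((1 / real N) *\<^sub>R b)) *\<^sub>R b)" unfolding eq c by simp
    then show "x \<in> int_span ((*\<^sub>R) (real N) ` D)" by (simp only: int_span_sum)
  qed
qed

text \<open>
Coefficients in \<open>{0..<N}\<close> give representatives.
\<close>

lemma finite_cosets:
  fixes D :: "'v::real_vector set"
  assumes "finite D" "0 < (N::nat)"
  shows "finite ((\<lambda>x. (+) x ` ((*\<^sub>R) (real N) ` int_span D)) ` int_span D)"
proof (rule finite_surj)
  let ?L = "(*\<^sub>R) (real N) ` int_span D"
  show "finite (PiE D (\<lambda>_. {0..<int N}))" using assms by (intro finite_PiE) auto
  show "(\<lambda>x. (+) x ` ?L) ` int_span D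
      \<subseteq> (\<lambda>c. (+) (\<Sum>b\<in>D. of_int (c b) *\<^sub>R b) ` ?L) ` PiE D (\<lambda>_. {0..<int N})"
  proof clarify
    fix x assume "x \<in> int_span D"
    then obtain c where c: "x = (\<Sum>b\<in>D. of_int (c b) *\<^sub>R b)" by (auto simp: int_span_def)
    let ?r = "\<lambda>b\<in>D. c b mod int N"
    define w where "w = (\<Sum>b\<in>D. of_int (c b div int N) *\<^sub>R b)"
    have w: "w \<in> int_span D" "- w \<in> int_span D"
      unfolding w_def using int_span_scale[of w D "-1"] by (auto simp: w_def int_span_sum)
    have "of_int (c b) = real N * of_int (c b div int N) + of_int (c b mod int N)" for b
      by (metis mult_div_mod_eq of_int_add of_int_mult of_int_of_nat_eq)
    then have x: "x = real N *\<^sub>R w + (\<Sum>b\<in>D. of_int (?r b) *\<^sub>R b)"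
      unfolding c w_def by (simp add: scaleR_add_left sum.distrib scaleR_sum_right)
    have "(+) x ` ?L = (+) (\<Sum>b\<in>D. of_int (?r b) *\<^sub>R b) ` ?L"
    proof (intro equalityI subsetI)
      fix z assume "z \<in> (+) x ` ?L"
      then obtain v where v: "v \<in> int_span D" "z = x + real N *\<^sub>R v" by blast
      have "z = (\<Sum>b\<in>D. of_int (?r b) *\<^sub>R b) + real N *\<^sub>R (w + v)"
        unfolding v x by (simp add: scaleR_add_right)
      then show "z \<in> (+) (\<Sum>b\<in>D. of_int (?r b) *\<^sub>R b) ` ?L" using int_span_add[OF w(1) v(1)] by blast
    next
      fix z assume "z \<in> (+) (\<Sum>b\<in>D. of_int (?r b) *\<^sub>R b) ` ?L"
      then obtain v where v: "v \<in> int_span D" "z = (\<Sum>b\<in>D. of_int (?r b) *\<^sub>R b) + real N *\<^sub>R v" by blast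
      have "z = x + real N *\<^sub>R (- w + v)"
        unfolding v x by (simp add: algebra_simps)
      then show "z \<in> (+) x ` ?L" using int_span_add[OF w(2) v(1)] by blast
    qed
    moreover have "?r \<in> PiE D (\<lambda>_. {0..<int N})" using assms by auto
    ultimately show "(+) x ` ?L \<in> (\<lambda>c. (+) (\<Sum>b\<in>D. of_int (c b) *\<^sub>R b) ` ?L) ` PiE D (\<lambda>_. {0..<int N})"
      by blast
  qed
qed

text \<open>
The product of the multipliers from \<open>multiple_in_sublattice\<close>, over all \<open>S\<close> and all basis vectors,
works for all generating \<open>S\<close> at once.
\<close>

lemma common_multiple_in_sublattices:
  fixes \<Phi> :: "'n::finite \<Rightarrow> 'f::euclidean_space"
  assumes D: "independent D" and \<Phi>: "range \<Phi> \<subseteq> int_span D"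
  shows "\<exists>N. 0 < (N::nat) \<and> (\<forall>S v. span (\<Phi> ` S) = UNIV \<longrightarrow> v \<in> (*\<^sub>R) (real N) ` int_span D \<longrightarrow>
    (\<exists>t. v = (\<Sum>k\<in>S. of_int (t k) *\<^sub>R \<Phi> k)))"
proof -
  have finD: "finite D" using D by (rule independent_imp_finite)
  have "\<exists>n t. 0 < (n::nat) \<and> (span (\<Phi> ` S) = UNIV \<longrightarrow> b \<in> D \<longrightarrow> of_nat n *\<^sub>R b = (\<Sum>k\<in>S. of_int (t k) *\<^sub>R \<Phi> k))"
    for S b
  proof (cases "span (\<Phi> ` S) = UNIV \<and> b \<in> D")
    case True
    then show ?thesis using multiple_in_sublattice[OF D, of \<Phi> S b] \<Phi> int_span_base[OF finD] by blast
  qed auto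
  then obtain n t where nt: "\<And>S b. 0 < (n S b :: nat)"
    "\<And>S b. span (\<Phi> ` S) = UNIV \<Longrightarrow> b \<in> D \<Longrightarrow> of_nat (n S b) *\<^sub>R b = (\<Sum>k\<in>S. of_int (t S b k) *\<^sub>R \<Phi> k)"
    by metis
  define N where "N = (\<Prod>p\<in>UNIV \<times> D. n (fst p) (snd p))"
  have N: "0 < N" unfolding N_def using nt(1) by (intro prod_pos) auto
  have "\<exists>t. v = (\<Sum>k\<in>S. of_int (t k) *\<^sub>R \<Phi> k)"
    if S: "span (\<Phi> ` S) = UNIV" and v: "v \<in> (*\<^sub>R) (real N) ` int_span D" for S v
  proof -
    obtain c where c: "v = real N *\<^sub>R (\<Sum>b\<in>D. of_int (c b) *\<^sub>R b)" using v by (auto simp: int_span_def)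
    have dvd: "n S b dvd N" if "b \<in> D" for b
      unfolding N_def using finD that dvd_prodI[of "UNIV \<times> D" "(S, b)" "\<lambda>p. n (fst p) (snd p)"] by auto
    (* N v is a combination of the multiples n S b of the basis vectors, with cofactors m b. *)
    define m where "m b = N div n S b" for b
    have m: "N = m b * n S b" if "b \<in> D" for b using dvd[OF that] by (simp add: m_def)
    have "v = (\<Sum>b\<in>D. \<Sum>k\<in>S. of_int (c b * int (m b) * t S b k) *\<^sub>R \<Phi> k)"
      unfolding c scaleR_sum_right
    proof (rule sum.cong[OF refl])
      fix b assume b: "b \<in> D"
      have "real N *\<^sub>R of_int (c b) *\<^sub>R b = of_int (c b * int (m b)) *\<^sub>R (of_nat (n S b) *\<^sub>R b)"
        by (subst m[OF b]) (simp add: algebra_simps)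
      also have "\<dots> = (\<Sum>k\<in>S. of_int (c b * int (m b) * t S b k) *\<^sub>R \<Phi> k)"
        unfolding nt(2)[OF S b] by (simp add: scaleR_sum_right)
      finally show "real N *\<^sub>R of_int (c b) *\<^sub>R b = (\<Sum>k\<in>S. of_int (c b * int (m b) * t S b k) *\<^sub>R \<Phi> k)" .
    qed
    also have "\<dots> = (\<Sum>k\<in>S. of_int (\<Sum>b\<in>D. c b * int (m b) * t S b k) *\<^sub>R \<Phi> k)"
      by (subst sum.swap) (simp add: scaleR_sum_left)
    finally show ?thesis by (rule exI[where x = "\<lambda>k. \<Sum>b\<in>D. c b * int (m b) * t S b k"])
  qed
  with N show ?thesis by blast
qed

text \<open>
The sublattice consists of the multiples by \<open>N\<close> from \<open>common_multiple_in_sublattices\<close>. Its elements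
are integral combinations of every generating subfamily, as \<open>XX_operator_diff_nilpotent\<close> demands of
the steps; Newton expansion along its basis then gives a polynomial on each coset.
\<close>

lemma S_sum_quasi_polynomial:
  fixes \<Phi> :: "'n::finite \<Rightarrow> 'f::euclidean_space"
  assumes gen: "span (range \<Phi>) = UNIV" and pt: "pointed \<Phi>" and t: "tope \<Phi> \<tau>"
    and h: "real_polynomial_function h" and \<Lambda>: "full_lattice \<Lambda>" and \<Phi>: "range \<Phi> \<subseteq> \<Lambda>"
  shows "quasi_polynomial_on \<Lambda> (S_sum \<Phi> \<tau> h)"
proof -
  obtain D where D: "independent D" "span D = UNIV" "\<Lambda> = int_span D"
    using \<Lambda> by (auto simp: full_lattice_def int_span_def)
  have finD: "finite D" using D(1) by (rule independent_imp_finite)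
  obtain N where N: "0 < (N::nat)" "\<And>S v. span (\<Phi> ` S) = UNIV \<Longrightarrow> v \<in> (*\<^sub>R) (real N) ` int_span D \<Longrightarrow>
    \<exists>t. v = (\<Sum>k\<in>S. of_int (t k) *\<^sub>R \<Phi> k)"
    using common_multiple_in_sublattices[OF D(1), of \<Phi>] \<Phi> D(3) by blast
  let ?E = "(*\<^sub>R) (real N) ` int_span D" and ?D = "(*\<^sub>R) (real N) ` D"
  have E: "?E = int_span ?D" by (rule int_span_scaled[OF N(1), symmetric])
  have lin: "linear ((*\<^sub>R) (real N) :: 'f \<Rightarrow> 'f)" by (intro linearI) (simp_all add: scaleR_add_right)
  have inj: "inj ((*\<^sub>R) (real N) :: 'f \<Rightarrow> 'f)" using N(1) by (auto simp: inj_on_def)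
  have indD: "independent ?D"
    by (rule linear_independent_injective_image[OF lin D(1)]) (use inj in \<open>auto intro: inj_on_subset\<close>)
  have spanD: "span ?D = UNIV"
  proof -
    have "span ?D = (*\<^sub>R) (real N) ` UNIV" using linear_span_image[OF lin, of D] D(2) by simp
    moreover have "x \<in> range ((*\<^sub>R) (real N))" for x :: 'f
      using N(1) by (intro range_eqI[of _ _ "(1 / real N) *\<^sub>R x"]) simp
    ultimately show ?thesis by blast
  qed
  let ?L = "\<lambda>(F :: real ^ 'n \<Rightarrow> real) \<nu>. \<Sum>\<^sub>\<infinity>x\<in>fiber \<Phi> \<nu> \<inter> integer_points. F x"
  have S: "S_sum \<Phi> \<tau> h = ?L (\<lambda>x. XX \<Phi> \<tau> x * h x)" by (auto simp: S_sum_def)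
  have "\<exists>m. diff_nilpotent ?E m (?L (\<lambda>x. XX \<Phi> \<tau> x * h x))"
  proof (rule XX_operator_diff_nilpotent[where L = ?L and T = \<int> and E = ?E, OF gen pt t h])
    show "?L (\<lambda>x. F x + G x) \<nu> = ?L F \<nu> + ?L G \<nu>"
      if "proper_on_fibers \<Phi> F" "proper_on_fibers \<Phi> G" for F G \<nu>
      by (intro infsum_add proper_summable that)
    show "?L (\<lambda>x. F (x + axis j t)) \<nu> = ?L F (\<nu> + t *\<^sub>R \<Phi> j)" if "t \<in> \<int>" for F :: "real ^ 'n \<Rightarrow> real" and j t \<nu>
      by (rule lattice_sum_shift[OF that])
    show "\<exists>t. (\<forall>k\<in>S. t k \<in> \<int>) \<and> v = (\<Sum>k\<in>S. t k *\<^sub>R \<Phi> k)" if Sv: "span (\<Phi> ` S) = UNIV" "v \<in> ?E" for S v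
    proof -
      obtain t where "v = (\<Sum>k\<in>S. of_int (t k) *\<^sub>R \<Phi> k)" using N(2)[OF Sv] by blast
      then show ?thesis by (intro exI[of _ "\<lambda>k. of_int (t k)"]) simp
    qed
  qed simp
  then obtain m where nil: "diff_nilpotent ?E m (S_sum \<Phi> \<tau> h)" unfolding S by blast
  have newton: "S_sum \<Phi> \<tau> h (x + s *\<^sub>R b) = newton_expansion m b (S_sum \<Phi> \<tau> h) x s"
    if b: "b \<in> ?D" and "s \<in> \<int>" for x b s
  proof -
    obtain k where s: "s = of_int k" using \<open>s \<in> \<int>\<close> by (auto simp: Ints_def)
    have "b \<in> ?E" using b int_span_base[OF finD] by blast
    then show ?thesis unfolding s by (rule newton_expansion_int[OF nil])
  qed
  have "full_lattice ?E"
    unfolding full_lattice_def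
  proof (intro exI[of _ ?D] conjI)
    show "?E = {(\<Sum>b\<in>?D. of_int (c b) *\<^sub>R b) | c :: 'f \<Rightarrow> int. True}"
      unfolding E by (simp only: int_span_def)
  qed (use indD spanD in auto)
  moreover have "?E \<subseteq> \<Lambda>" unfolding D(3) using int_span_scale[of _ D "int N"] by auto
  moreover have "finite ((\<lambda>x. (+) x ` ?E) ` \<Lambda>)" unfolding D(3) by (rule finite_cosets[OF finD N(1)])
  moreover have "\<exists>p. real_polynomial_function p \<and> (\<forall>\<nu>'\<in>?E. S_sum \<Phi> \<tau> h (\<nu>\<^sub>0 + \<nu>') = p \<nu>')" for \<nu>\<^sub>0
  proof -
    have "\<exists>p. real_polynomial_function p \<and> (\<forall>s. (\<forall>b\<in>?D. s b \<in> \<int>) \<longrightarrow>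
        S_sum \<Phi> \<tau> h (\<nu>\<^sub>0 + (\<Sum>b\<in>?D. s b *\<^sub>R b)) = p (\<Sum>b\<in>?D. s b *\<^sub>R b))"
      by (rule polynomial_along_basis[OF indD, where m = m]) (rule newton)
    then obtain p where p: "real_polynomial_function p" "\<And>s. (\<forall>b\<in>?D. s b \<in> \<int>) \<Longrightarrow>
        S_sum \<Phi> \<tau> h (\<nu>\<^sub>0 + (\<Sum>b\<in>?D. s b *\<^sub>R b)) = p (\<Sum>b\<in>?D. s b *\<^sub>R b)" by blast
    have "S_sum \<Phi> \<tau> h (\<nu>\<^sub>0 + v) = p v" if v: "v \<in> ?E" for v
    proof -
      have "v \<in> int_span ?D" using v unfolding E .
      then obtain c where c: "v = (\<Sum>b\<in>?D. of_int (c b) *\<^sub>R b)" by (auto simp: int_span_def)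
      show ?thesis unfolding c by (rule p(2)) simp
    qed
    with p(1) show ?thesis by blast
  qed
  ultimately show ?thesis unfolding quasi_polynomial_on_def by blast
qed

lemma S_sum_eq_polytope_sum:
  assumes "\<And>x. x \<in> fiber \<Phi> \<nu> \<Longrightarrow> x \<in> integer_points \<Longrightarrow> XX \<Phi> \<tau> x = of_bool (\<forall>i. 0 \<le> x $ i)"
  shows "S_sum \<Phi> \<tau> h \<nu> = (\<Sum>\<^sub>\<infinity>x\<in>partition_polytope \<Phi> \<nu> \<inter> integer_points. h x)"
  unfolding S_sum_def by (rule infsum_cong_neutral) (auto simp: assms partition_polytope_def)

lemma S_sum_eq_polytope_difference:
  fixes \<Phi> :: "'n::finite \<Rightarrow> 'f::euclidean_space"
  assumes gen: "span (range \<Phi>) = UNIV" and pt: "pointed \<Phi>" 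
    and t: "tope \<Phi> \<tau>" and h: "continuous_on UNIV h" and A: "A \<noteq> {}"
    and XX: "\<And>x. x \<in> fiber \<Phi> \<nu> \<Longrightarrow> XX \<Phi> \<tau> x = of_bool (\<forall>i. 0 \<le> x $ i)
      - (-1) ^ card A * of_bool ((\<forall>i\<in>A. x $ i < 0) \<and> (\<forall>i. i \<notin> A \<longrightarrow> 0 \<le> x $ i))"
  shows "S_sum \<Phi> \<tau> h \<nu> = (\<Sum>\<^sub>\<infinity>x\<in>partition_polytope \<Phi> \<nu> \<inter> integer_points. h x)
    - (-1) ^ card A * (\<Sum>\<^sub>\<infinity>x\<in>flipped_polytope \<Phi> A \<nu> \<inter> integer_points. h x)"
proof -
  let ?X = "fiber \<Phi> \<nu> \<inter> integer_points" and ?F = "\<lambda>x. XX \<Phi> \<tau> x * h x" and ?s = "(-1) ^ card A :: real"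
  let ?p = "\<lambda>x :: real ^ 'n. of_bool (\<forall>i. 0 \<le> x $ i) :: real"
  let ?q = "\<lambda>x :: real ^ 'n. of_bool ((\<forall>i\<in>A. x $ i < 0) \<and> (\<forall>i. i \<notin> A \<longrightarrow> 0 \<le> x $ i)) :: real"
  obtain M where M: "\<And>y. norm (\<Sum>i\<in>UNIV. y $ i *\<^sub>R \<Phi> i) \<le> norm \<nu> \<Longrightarrow> ?F y \<noteq> 0 \<Longrightarrow> norm y \<le> M"
    using proper_on_fibersD(2)[OF XX_proper[OF gen pt t h]] by blast
  obtain j where j: "j \<in> A" using A by blast
  have disj: "?p x = 0 \<or> ?q x = 0" for x
  proof -
    have "\<not> (\<forall>i. 0 \<le> x $ i) \<or> \<not> (\<forall>i\<in>A. x $ i < 0)" using j by (meson not_less)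
    then show ?thesis by auto
  qed
  have bound: "norm x \<le> M" if "x \<in> ?X" "?p x * h x \<noteq> 0 \<or> - ?s * (?q x * h x) \<noteq> 0" for x
  proof (rule M)
    show "norm (\<Sum>i\<in>UNIV. x $ i *\<^sub>R \<Phi> i) \<le> norm \<nu>" using that(1) by (simp add: fiber_def)
    show "?F x \<noteq> 0" using that disj[of x] XX[of x] by auto
  qed
  have P: "(\<lambda>x. ?p x * h x) summable_on ?X"
    by (rule finite_nonzero_values_imp_summable_on, rule finite_subset[OF _ finite_integer_points[of M]])
       (use bound in blast)
  have Q: "(\<lambda>x. - ?s * (?q x * h x)) summable_on ?X"
    by (rule finite_nonzero_values_imp_summable_on, rule finite_subset[OF _ finite_integer_points[of M]])
       (use bound in blast)
  have "S_sum \<Phi> \<tau> h \<nu> = (\<Sum>\<^sub>\<infinity>x\<in>?X. ?p x * h x + - ?s * (?q x * h x))"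
    unfolding S_sum_def by (rule infsum_cong) (use XX in \<open>simp add: left_diff_distrib\<close>)
  also have "\<dots> = (\<Sum>\<^sub>\<infinity>x\<in>?X. ?p x * h x) + (\<Sum>\<^sub>\<infinity>x\<in>?X. - ?s * (?q x * h x))"
    by (rule infsum_add[OF P Q])
  also have "(\<Sum>\<^sub>\<infinity>x\<in>?X. - ?s * (?q x * h x)) = - ?s * (\<Sum>\<^sub>\<infinity>x\<in>?X. ?q x * h x)" by (rule infsum_cmult_right')
  also have "(\<Sum>\<^sub>\<infinity>x\<in>?X. ?p x * h x) = (\<Sum>\<^sub>\<infinity>x\<in>partition_polytope \<Phi> \<nu> \<inter> integer_points. h x)"
    by (rule infsum_cong_neutral) (auto simp: partition_polytope_def)
  also have "(\<Sum>\<^sub>\<infinity>x\<in>?X. ?q x * h x) = (\<Sum>\<^sub>\<infinity>x\<in>flipped_polytope \<Phi> A \<nu> \<inter> integer_points. h x)"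
    by (rule infsum_cong_neutral) (auto simp: flipped_polytope_def)
  finally show ?thesis by simp
qed

section \<open>Integrals and sums over the continued polytopes\<close>

theorem theorem54:
  fixes \<Phi> :: "'n::finite \<Rightarrow> 'f::euclidean_space"
    and \<tau> :: "'f set"
    and h :: "real ^ 'n \<Rightarrow> real"
    and \<mu> :: "(real ^ 'n) measure"
  assumes nonzero: "\<And>i. \<Phi> i \<noteq> 0"
    and generating: "span (range \<Phi>) = UNIV"
    and salient: "salient (gen_cone \<Phi> UNIV)"
    and tope: "tope \<Phi> \<tau>" and tope_in_cone: "\<tau> \<subseteq> gen_cone \<Phi> UNIV"
    and poly: "real_polynomial_function h"
    and lebesgue: "lebesgue_measure_on (fiber \<Phi> 0) \<mu>"
  shows "(real_polynomial_function (I_int \<Phi> \<mu> \<tau> h)) \<and>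
    (\<forall>\<Lambda>. full_lattice \<Lambda> \<and> range \<Phi> \<subseteq> \<Lambda> \<longrightarrow> quasi_polynomial_on \<Lambda> (S_sum \<Phi> \<tau> h)) \<and>
    (\<forall>\<nu>\<in>closure \<tau>.
       I_int \<Phi> \<mu> \<tau> h \<nu> = (LINT x:partition_polytope \<Phi> \<nu>|fiber_measure \<Phi> \<mu> \<nu>. h x)) \<and>
    (\<forall>\<Lambda>. full_lattice \<Lambda> \<and> range \<Phi> \<subseteq> \<Lambda> \<longrightarrow>
       (\<forall>\<nu>\<in>{u - v | u v. u \<in> \<tau> \<and> v \<in> zonotope \<Phi>} \<inter> \<Lambda>.
          S_sum \<Phi> \<tau> h \<nu> = (\<Sum>\<^sub>\<infinity>x\<in>partition_polytope \<Phi> \<nu> \<inter> integer_points. h x))) \<and>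
    (\<forall>\<tau>\<^sub>1 \<tau>\<^sub>2 H A.
       adjacent_topes \<Phi> \<tau>\<^sub>1 \<tau>\<^sub>2 H \<and> \<tau>\<^sub>1 \<subseteq> gen_cone \<Phi> UNIV \<and> A = side_indices \<Phi> H \<tau>\<^sub>1 \<longrightarrow>
       (\<forall>\<nu>\<in>\<tau>\<^sub>2.
          I_int \<Phi> \<mu> \<tau>\<^sub>1 h \<nu> =
            (LINT x:partition_polytope \<Phi> \<nu>|fiber_measure \<Phi> \<mu> \<nu>. h x)
            - (-1) ^ card A * (LINT x:flipped_polytope \<Phi> A \<nu>|fiber_measure \<Phi> \<mu> \<nu>. h x)) \<and>
       (\<forall>\<Lambda>. full_lattice \<Lambda> \<and> range \<Phi> \<subseteq> \<Lambda> \<longrightarrow>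
          (\<forall>\<nu>\<in>\<tau>\<^sub>2 \<inter> \<Lambda>.
             S_sum \<Phi> \<tau>\<^sub>1 h \<nu> =
               (\<Sum>\<^sub>\<infinity>x\<in>partition_polytope \<Phi> \<nu> \<inter> integer_points. h x)
               - (-1) ^ card A * (\<Sum>\<^sub>\<infinity>x\<in>flipped_polytope \<Phi> A \<nu> \<inter> integer_points. h x))))"
proof -
  note gen = generating and t = tope
  have pt: "pointed \<Phi>" by (rule pointed_of_salient[OF nonzero salient])
  have c: "continuous_on UNIV h"
    by (rule continuous_on_polymonial_function[OF poly[unfolded real_polynomial_function_eq]])
  have closure: "I_int \<Phi> \<mu> \<tau> h \<nu> = (LINT x:partition_polytope \<Phi> \<nu>|fiber_measure \<Phi> \<mu> \<nu>. h x)"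
    if "\<nu> \<in> closure \<tau>" for \<nu>
    by (rule I_int_eq_polytope_integral[OF gen lebesgue pt])
       (rule XX_on_closure[OF gen pt t tope_in_cone that])
  have zonotope: "S_sum \<Phi> \<tau> h \<nu> = (\<Sum>\<^sub>\<infinity>x\<in>partition_polytope \<Phi> \<nu> \<inter> integer_points. h x)"
    if \<nu>: "\<nu> \<in> {u - v | u v. u \<in> \<tau> \<and> v \<in> zonotope \<Phi>} \<inter> \<Lambda>" for \<nu> \<Lambda>
  proof -
    obtain u v where uv: "u \<in> \<tau>" "v \<in> zonotope \<Phi>" "\<nu> = u - v" using \<nu> by blast
    show ?thesis
      by (rule S_sum_eq_polytope_sum)
         (use XX_on_zonotope_shift[OF gen pt t tope_in_cone uv(1,2)] uv(3) in blast)
  qed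
  have wall_I: "I_int \<Phi> \<mu> \<tau>\<^sub>1 h \<nu> = (LINT x:partition_polytope \<Phi> \<nu>|fiber_measure \<Phi> \<mu> \<nu>. h x)
        - (-1) ^ card A * (LINT x:flipped_polytope \<Phi> A \<nu>|fiber_measure \<Phi> \<mu> \<nu>. h x)"
    and wall_S: "S_sum \<Phi> \<tau>\<^sub>1 h \<nu> = (\<Sum>\<^sub>\<infinity>x\<in>partition_polytope \<Phi> \<nu> \<inter> integer_points. h x)
        - (-1) ^ card A * (\<Sum>\<^sub>\<infinity>x\<in>flipped_polytope \<Phi> A \<nu> \<inter> integer_points. h x)"
    if adj: "adjacent_topes \<Phi> \<tau>\<^sub>1 \<tau>\<^sub>2 H \<and> \<tau>\<^sub>1 \<subseteq> gen_cone \<Phi> UNIV \<and> A = side_indices \<Phi> H \<tau>\<^sub>1"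
      and \<nu>: "\<nu> \<in> \<tau>\<^sub>2" for \<tau>\<^sub>1 \<tau>\<^sub>2 H A \<nu>
  proof -
    have t1: "tope \<Phi> \<tau>\<^sub>1" using adj by (simp add: adjacent_topes_def)
    have A: "A \<noteq> {}" and XX: "\<And>x. x \<in> fiber \<Phi> \<nu> \<Longrightarrow> XX \<Phi> \<tau>\<^sub>1 x = of_bool (\<forall>i. 0 \<le> x $ i)
        - (-1) ^ card A * of_bool ((\<forall>i\<in>A. x $ i < 0) \<and> (\<forall>i. i \<notin> A \<longrightarrow> 0 \<le> x $ i))"
      using XX_across_wall[OF gen pt _ _ _ \<nu>, of \<tau>\<^sub>1 H A] adj by blast+
    show "I_int \<Phi> \<mu> \<tau>\<^sub>1 h \<nu> = (LINT x:partition_polytope \<Phi> \<nu>|fiber_measure \<Phi> \<mu> \<nu>. h x)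
        - (-1) ^ card A * (LINT x:flipped_polytope \<Phi> A \<nu>|fiber_measure \<Phi> \<mu> \<nu>. h x)"
      by (rule I_int_eq_polytope_difference[OF gen lebesgue pt t1 c A XX])
    show "S_sum \<Phi> \<tau>\<^sub>1 h \<nu> = (\<Sum>\<^sub>\<infinity>x\<in>partition_polytope \<Phi> \<nu> \<inter> integer_points. h x)
        - (-1) ^ card A * (\<Sum>\<^sub>\<infinity>x\<in>flipped_polytope \<Phi> A \<nu> \<inter> integer_points. h x)"
      by (rule S_sum_eq_polytope_difference[OF gen pt t1 c A XX])
  qed
  show ?thesis
  proof (intro conjI, goal_cases)
    case 1
    show ?case by (rule I_int_polynomial[OF gen lebesgue pt t poly])
  next
    case 2
    show ?case using S_sum_quasi_polynomial[OF gen pt t poly] by blast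
  next
    case 3
    show ?case by (intro ballI closure)
  next
    case 4
    show ?case by (intro allI impI ballI) (rule zonotope)
  next
    case 5
    show ?case
      by (intro allI impI conjI ballI)
         (rule wall_I, assumption, assumption, rule wall_S, assumption, erule IntD1)
  qed
qed

end
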